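(* The functor $R\mapsto \mathfrak g(R)$ from the category of vertex Lie algebras to the category of local Lie algebras is fully faithful.
   Context: Conventions: $\mathbb K$ is a field of characteristic $0$. All vector spaces are super ($\mathbb Z/2$-graded); an algebra is a vector space with an even bilinear multiplication; Lie algebra means Lie superalgebra; for homogeneous $a,b$ put $\zeta^{ab}=(-1)^{p(a)p(b)}$ with $p$ the parity; algebra morphisms and structure maps are even; subsets of a super vector space are understood to contain the even and odd components of their elements. $x^{(n)}=x^n/n!$. A $\mathbb K[T]$-module is a vector space with an even operator $T$. A differential algebra is an algebra with an even derivation $T$. Unbounded conformal algebra: a $\mathbb K[T]$-module $R$ with an even linear map $R\otimes R\to R[[\lambda]]$, $a\otimes b\mapsto [a_\lambda b]=\sum_{t\ge0}a_tb\,\lambda^{(t)}$, such that $T[a_\lambda b]=[Ta_\lambda b]+[a_\lambda Tb]$ and $[Ta_\lambda b]=-\lambda[a_\lambda b]$. Morphisms are even $\mathbb K[T]$-linear maps $\phi$ with $\phi[a_\lambda b]=[\phi a_\lambda\phi b]$. It is a conformal algebra if always $[a_\lambda b]\in R[\lambda]$. A vertex Lie algebra is a conformal algebra with $[[a_\lambda b]_\mu c]=[a_\lambda[b_{\mu-\lambda}c]]-\zeta^{ab}[b_{\mu-\lambda}[a_\lambda c]]$ and $[a_\lambda b]=-\zeta^{ab}[b_{-\lambda-T}a]$, where $[b_{-\lambda-T}a]=\sum_t(-\lambda-T)^{(t)}(b_ta)$. Distributions: $\mathfrak g[[z^{\pm}]]$ is the space of all formal sums $a(z)=\sum_{t\in\mathbb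 Z}a_tz^{-t-1}$, $a_t\in\mathfrak g$; $\mathrm{res}_z a(z)=a_0$. For an algebra $\mathfrak g$ with bracket $[\,,]$ it is an unbounded conformal algebra with $T=\partial_z$ and $[a(w)_\lambda b(w)]=\mathrm{res}_z\,e^{(z-w)\lambda}[a(z),b(w)]$. Distributions $a(z),b(z)$ are local if $(z-w)^n[a(z),b(w)]=0$ for some $n\ge 0$; a subset is local if any two of its elements are local. For $F\subset\mathfrak g[[z^\pm]]$, $\bar F$ denotes the unbounded conformal subalgebra generated by $F$. Local Lie algebra: a differential Lie algebra $\mathfrak g$ together with a local subset $F_{\mathfrak g}\subset\mathfrak g[[z^\pm]]$ such that $Ta(z)=\partial_za(z)$ for $a(z)\in F_{\mathfrak g}$ and $\mathfrak g=\mathrm{span}\{a_t\mid a(z)\in F_{\mathfrak g},t\in\mathbb Z\}$. A morphism of local Lie algebras is a differential Lie algebra morphism $\phi:\mathfrak g\to\mathfrak g'$ with $\phi F_{\mathfrak g}\subset\bar F_{\mathfrak g'}$ ($\phi$ applied coefficientwise). The local Lie algebra $\mathfrak g(R)$ of a vertex Lie algebra $R$: the Lie algebra generated by the vector space $R\otimes\mathbb K[x^{\pm1}]$, with $a_t:=a\otimes x^t$, modulo the relations $(Ta)_t=-t\,a_{t-1}$ and $[a_t,b_s]=\sum_{i\ge0}\binom ti(a_ib)_{t+s-i}$ for $a,b\in R$, $t,s\in\mathbb Z$; derivation $T(a_t)=(Ta)_t$; and $F_{\mathfrak g(R)}=\{\sum_ta_tz^{-t-1}\mid a\in R\}$. A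 morphism $R\to R'$ induces $\mathfrak g(R)\to\mathfrak g(R')$, $a_t\mapsto(\phi a)_t$. *)

theory Defs
  imports Complex_Main "HOL-Library.Z2" "HOL-Library.FuncSet"
    "HOL-Algebra.Module" "HOL-Algebra.AbelCoset"
begin

section \<open>Super vector spaces\<close>

text \<open>
  The ground field is a type of class \<open>field_char_0\<close>; \<open>scalars\<close> is the corresponding
  ring record. A super vector space is a module record with two homogeneous components, indexed
  by \<^typ>\<open>bit\<close>. Of the inherited ring record, the field \<open>mult\<close> carries the (Lie) bracket when
  there is one and is otherwise unconstrained; the field \<open>one\<close> is never used.
\<close>

definition scalars :: "'k::field_char_0 ring"
  where "scalars = \<lparr>carrier = UNIV, monoid.mult = (*), one = 1, zero = 0, add = (+)\<rparr>"

record ('k, 'a) superspace = "('k, 'a) module" +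
  homog :: "bit \<Rightarrow> 'a set"

locale superspace = Module.module scalars V
  for V :: "('k::field_char_0, 'a, 'm) superspace_scheme" (structure) +
  assumes homog_submodule: "submodule (homog V p) scalars V"
    and homog_span: "carrier V = set_add V (homog V 0) (homog V 1)"
    and homog_disjoint: "homog V 0 \<inter> homog V 1 = {\<zero>}"

definition even_linear ::
  "('k, 'a, 'm) superspace_scheme \<Rightarrow> ('k, 'b, 'n) superspace_scheme \<Rightarrow> ('a \<Rightarrow> 'b) \<Rightarrow> bool"
  where "even_linear V W f \<longleftrightarrow>
    f \<in> carrier V \<rightarrow> carrier W \<and>
    (\<forall>x\<in>carrier V. \<forall>y\<in>carrier V. f (x \<oplus>\<^bsub>V\<^esub> y) = f x \<oplus>\<^bsub>W\<^esub> f y) \<and>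
    (\<forall>c. \<forall>x\<in>carrier V. f (c \<odot>\<^bsub>V\<^esub> x) = c \<odot>\<^bsub>W\<^esub> f x) \<and>
    (\<forall>p. f ` homog V p \<subseteq> homog W p)"

definition even_bilinear ::
  "('k, 'a, 'm) superspace_scheme \<Rightarrow> ('a \<Rightarrow> 'a \<Rightarrow> 'a) \<Rightarrow> bool"
  where "even_bilinear V m \<longleftrightarrow>
    (\<forall>x\<in>carrier V. \<forall>y\<in>carrier V. m x y \<in> carrier V) \<and>
    (\<forall>x\<in>carrier V. \<forall>y\<in>carrier V. \<forall>z\<in>carrier V.
       m (x \<oplus>\<^bsub>V\<^esub> y) z = m x z \<oplus>\<^bsub>V\<^esub> m y z \<and> m z (x \<oplus>\<^bsub>V\<^esub> y) = m z x \<oplus>\<^bsub>V\<^esub> m z y) \<and>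
    (\<forall>c. \<forall>x\<in>carrier V. \<forall>y\<in>carrier V.
       m (c \<odot>\<^bsub>V\<^esub> x) y = c \<odot>\<^bsub>V\<^esub> m x y \<and> m x (c \<odot>\<^bsub>V\<^esub> y) = c \<odot>\<^bsub>V\<^esub> m x y) \<and>
    (\<forall>p q. \<forall>x\<in>homog V p. \<forall>y\<in>homog V q. m x y \<in> homog V (p + q))"

definition graded_subset :: "('k, 'a, 'm) superspace_scheme \<Rightarrow> 'a set \<Rightarrow> bool"
  where "graded_subset V S \<longleftrightarrow> S \<subseteq> carrier V \<and>
    (\<forall>v\<in>S. \<exists>x\<in>S \<inter> homog V 0. \<exists>y\<in>S \<inter> homog V 1. v = x \<oplus>\<^bsub>V\<^esub> y)"

definition linear_span :: "('k::field_char_0, 'a, 'm) superspace_scheme \<Rightarrow> 'a set \<Rightarrow> 'a set"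
  where "linear_span V S = \<Inter>{H. submodule H scalars V \<and> S \<subseteq> H}"

definition parity_sign :: "bit \<Rightarrow> bit \<Rightarrow> 'k::field_char_0"
  where "parity_sign p q = (if p = 1 \<and> q = 1 then -1 else 1)"


section \<open>Differential Lie superalgebras\<close>

record ('k, 'a) kt_module = "('k, 'a) superspace" +
  der :: "'a \<Rightarrow> 'a"

locale kt_module = superspace V
  for V :: "('k::field_char_0, 'a, 'm) kt_module_scheme" (structure) +
  assumes der_even_linear: "even_linear V V (der V)"

locale differential_lie_algebra = kt_module \<gg>
  for \<gg> :: "('k::field_char_0, 'a, 'm) kt_module_scheme" (structure) +
  assumes bracket_bilinear: "even_bilinear \<gg> (mult \<gg>)"
    and bracket_skew: "\<lbrakk>x \<in> homog \<gg> p; y \<in> homog \<gg> q\<rbrakk>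
      \<Longrightarrow> x \<otimes> y = \<ominus> (parity_sign p q \<odot> (y \<otimes> x))"
    and bracket_jacobi: "\<lbrakk>x \<in> homog \<gg> p; y \<in> homog \<gg> q; z \<in> carrier \<gg>\<rbrakk>
      \<Longrightarrow> (x \<otimes> y) \<otimes> z = (x \<otimes> (y \<otimes> z)) \<ominus> (parity_sign p q \<odot> (y \<otimes> (x \<otimes> z)))"
    and der_bracket: "\<lbrakk>x \<in> carrier \<gg>; y \<in> carrier \<gg>\<rbrakk>
      \<Longrightarrow> der \<gg> (x \<otimes> y) = (der \<gg> x \<otimes> y) \<oplus> (x \<otimes> der \<gg> y)"


section \<open>Conformal and vertex Lie algebras\<close>

text \<open>
  A formal power series in \<open>\<lambda>\<close> is represented by its coefficients with respect to the divided
  powers \<open>\<lambda>\<^sup>n / n!\<close>; so \<open>nprod R n a b\<close> is the coefficient of \<open>\<lambda>\<^sup>n / n!\<close> in \<open>[a\<^sub>\<lambda> b]\<close>.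
\<close>

record ('k, 'a) conformal = "('k, 'a) kt_module" +
  nprod :: "nat \<Rightarrow> 'a \<Rightarrow> 'a \<Rightarrow> 'a"

locale unbounded_conformal_algebra = kt_module R
  for R :: "('k::field_char_0, 'a, 'm) conformal_scheme" (structure) +
  assumes nprod_bilinear: "even_bilinear R (nprod R n)"
    and der_nprod: "\<lbrakk>a \<in> carrier R; b \<in> carrier R\<rbrakk>
      \<Longrightarrow> der R (nprod R n a b) = nprod R n (der R a) b \<oplus> nprod R n a (der R b)"
    \<comment> \<open>\<open>[Ta\<^sub>\<lambda> b] = -\<lambda> [a\<^sub>\<lambda> b]\<close>, using \<open>\<lambda> \<cdot> \<lambda>\<^sup>n / n! = (n + 1) \<lambda>\<^sup>n\<^sup>+\<^sup>1 / (n + 1)!\<close>\<close>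
    and nprod_der_0: "\<lbrakk>a \<in> carrier R; b \<in> carrier R\<rbrakk> \<Longrightarrow> nprod R 0 (der R a) b = \<zero>"
    and nprod_der_Suc: "\<lbrakk>a \<in> carrier R; b \<in> carrier R\<rbrakk>
      \<Longrightarrow> nprod R (Suc n) (der R a) b = (- of_nat (Suc n)) \<odot> nprod R n a b"

locale conformal_algebra = unbounded_conformal_algebra R
  for R :: "('k::field_char_0, 'a, 'm) conformal_scheme" (structure) +
  assumes nprod_finite: "\<lbrakk>a \<in> carrier R; b \<in> carrier R\<rbrakk> \<Longrightarrow> finite {n. nprod R n a b \<noteq> \<zero>}"

text \<open>
  If \<open>F i j\<close> is the coefficient of \<open>\<lambda>\<^sup>i / i! \<cdot> \<nu>\<^sup>j / j!\<close> in a power series in \<open>\<lambda>, \<nu>\<close>, then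
  \<open>subst_difference R F i j\<close> is the coefficient of \<open>\<lambda>\<^sup>i / i! \<cdot> \<mu>\<^sup>j / j!\<close> after the substitution
  \<open>\<nu> = \<mu> - \<lambda>\<close>. By the binomial formula the divided power \<open>(\<mu> - \<lambda>)\<^sup>m / m!\<close> is the sum over \<open>k \<le> m\<close> of
  \<open>(-1)\<^sup>k \<cdot> \<lambda>\<^sup>k / k! \<cdot> \<mu>\<^sup>m\<^sup>-\<^sup>k / (m - k)!\<close>, and
  \<open>\<lambda>\<^sup>l / l! \<cdot> \<lambda>\<^sup>k / k!\<close> is \<open>(l + k) choose k\<close> times the divided power of exponent \<open>l + k\<close>.
\<close>

definition subst_difference ::
  "('k::field_char_0, 'a, 'm) conformal_scheme \<Rightarrow> (nat \<Rightarrow> nat \<Rightarrow> 'a) \<Rightarrow> nat \<Rightarrow> nat \<Rightarrow> 'a"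
  where "subst_difference R F i j =
    (\<Oplus>\<^bsub>R\<^esub>k\<in>{..i}. ((-1) ^ k * of_nat (i choose k)) \<odot>\<^bsub>R\<^esub> F (i - k) (j + k))"

text \<open>
  \<open>flipped_bracket R b a n\<close> is the coefficient of \<open>\<lambda>\<^sup>n / n!\<close> in \<open>[b\<^bsub>-\<lambda>-T\<^esub> a]\<close>: the divided power
  \<open>(-\<lambda>-T)\<^sup>t / t!\<close> is the sum over \<open>n + k = t\<close> of \<open>(-1)\<^sup>t \<cdot> \<lambda>\<^sup>n / n! \<cdot> T\<^sup>k / k!\<close>.
\<close>

definition flipped_bracket ::
  "('k::field_char_0, 'a, 'm) conformal_scheme \<Rightarrow> 'a \<Rightarrow> 'a \<Rightarrow> nat \<Rightarrow> 'a"
  where "flipped_bracket R b a n =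
    (\<Oplus>\<^bsub>R\<^esub>k\<in>{k. nprod R (n + k) b a \<noteq> \<zero>\<^bsub>R\<^esub>}.
       ((-1) ^ (n + k) / fact k) \<odot>\<^bsub>R\<^esub> (der R ^^ k) (nprod R (n + k) b a))"

locale vertex_lie_algebra = conformal_algebra R
  for R :: "('k::field_char_0, 'a, 'm) conformal_scheme" (structure) +
  assumes nprod_jacobi: "\<lbrakk>a \<in> homog R p; b \<in> homog R q; c \<in> carrier R\<rbrakk>
      \<Longrightarrow> nprod R j (nprod R i a b) c =
        subst_difference R (\<lambda>i j. nprod R i a (nprod R j b c)) i j \<ominus>
        (parity_sign p q \<odot> subst_difference R (\<lambda>i j. nprod R j b (nprod R i a c)) i j)"
    and nprod_skew: "\<lbrakk>a \<in> homog R p; b \<in> homog R q\<rbrakk>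
      \<Longrightarrow> nprod R n a b = \<ominus> (parity_sign p q \<odot> flipped_bracket R b a n)"

definition conformal_subalgebra ::
  "('k::field_char_0, 'a, 'm) conformal_scheme \<Rightarrow> 'a set \<Rightarrow> bool"
  where "conformal_subalgebra R S \<longleftrightarrow>
    submodule S scalars R \<and> graded_subset R S \<and> der R ` S \<subseteq> S \<and>
    (\<forall>n. \<forall>a\<in>S. \<forall>b\<in>S. nprod R n a b \<in> S)"

definition conformal_closure ::
  "('k::field_char_0, 'a, 'm) conformal_scheme \<Rightarrow> 'a set \<Rightarrow> 'a set"
  where "conformal_closure R F = \<Inter>{S. conformal_subalgebra R S \<and> F \<subseteq> S}"

text \<open>
  Morphisms are taken to be extensional functions, so that equality of morphisms is equality
  on the carrier.
\<close>

definition conformal_hom ::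
  "('k, 'a, 'm) conformal_scheme \<Rightarrow> ('k, 'b, 'n) conformal_scheme \<Rightarrow> ('a \<Rightarrow> 'b) set"
  where "conformal_hom R S = {f \<in> carrier R \<rightarrow>\<^sub>E carrier S. even_linear R S f \<and>
    (\<forall>a\<in>carrier R. f (der R a) = der S (f a)) \<and>
    (\<forall>n. \<forall>a\<in>carrier R. \<forall>b\<in>carrier R. f (nprod R n a b) = nprod S n (f a) (f b))}"


section \<open>Distributions\<close>

text \<open>
  The distribution with coefficients \<open>a\<^sub>t\<close> (at \<open>z\<^sup>-\<^sup>t\<^sup>-\<^sup>1\<close>) is the function \<open>a\<close>, and
  a distribution in \<open>z, w\<close> is a function \<open>F\<close> with \<open>F s t\<close> the coefficient at
  \<open>z\<^sup>-\<^sup>s\<^sup>-\<^sup>1 w\<^sup>-\<^sup>t\<^sup>-\<^sup>1\<close>. Hence multiplication by \<open>z\<close> increments the first index.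
\<close>

definition mult_z_minus_w ::
  "('k, 'a, 'm) kt_module_scheme \<Rightarrow> (int \<Rightarrow> int \<Rightarrow> 'a) \<Rightarrow> int \<Rightarrow> int \<Rightarrow> 'a"
  where "mult_z_minus_w \<gg> F = (\<lambda>s t. F (s + 1) t \<ominus>\<^bsub>\<gg>\<^esub> F s (t + 1))"

definition dist_bracket ::
  "('k, 'a, 'm) kt_module_scheme \<Rightarrow> (int \<Rightarrow> 'a) \<Rightarrow> (int \<Rightarrow> 'a) \<Rightarrow> int \<Rightarrow> int \<Rightarrow> 'a"
  where "dist_bracket \<gg> a b = (\<lambda>s t. a s \<otimes>\<^bsub>\<gg>\<^esub> b t)"

definition res_z :: "(int \<Rightarrow> int \<Rightarrow> 'a) \<Rightarrow> int \<Rightarrow> 'a"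
  where "res_z F = F 0"

definition dist_deriv ::
  "('k::field_char_0, 'a, 'm) kt_module_scheme \<Rightarrow> (int \<Rightarrow> 'a) \<Rightarrow> int \<Rightarrow> 'a"
  where "dist_deriv \<gg> a = (\<lambda>t. (- of_int t) \<odot>\<^bsub>\<gg>\<^esub> a (t - 1))"

definition distributions ::
  "('k::field_char_0, 'a, 'm) kt_module_scheme \<Rightarrow> ('k, int \<Rightarrow> 'a) conformal"
  where "distributions \<gg> =
    \<lparr>carrier = {a. \<forall>t. a t \<in> carrier \<gg>}, monoid.mult = undefined, one = undefined,
     zero = (\<lambda>t. \<zero>\<^bsub>\<gg>\<^esub>), add = (\<lambda>a b t. a t \<oplus>\<^bsub>\<gg>\<^esub> b t), smult = (\<lambda>c a t. c \<odot>\<^bsub>\<gg>\<^esub> a t),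
     homog = (\<lambda>p. {a. \<forall>t. a t \<in> homog \<gg> p}),
     der = dist_deriv \<gg>,
     nprod = (\<lambda>n a b. res_z ((mult_z_minus_w \<gg> ^^ n) (dist_bracket \<gg> a b)))\<rparr>"

definition local_pair ::
  "('k, 'a, 'm) kt_module_scheme \<Rightarrow> (int \<Rightarrow> 'a) \<Rightarrow> (int \<Rightarrow> 'a) \<Rightarrow> bool"
  where "local_pair \<gg> a b \<longleftrightarrow>
    (\<exists>n. (mult_z_minus_w \<gg> ^^ n) (dist_bracket \<gg> a b) = (\<lambda>s t. \<zero>\<^bsub>\<gg>\<^esub>))"


section \<open>Local Lie algebras\<close>

record ('k, 'a) local_lie = "('k, 'a) kt_module" +
  gen_fields :: "(int \<Rightarrow> 'a) set"

locale local_lie_algebra = differential_lie_algebra \<gg>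
  for \<gg> :: "('k::field_char_0, 'a, 'm) local_lie_scheme" (structure) +
  assumes fields_graded: "graded_subset (distributions \<gg>) (gen_fields \<gg>)"
    and fields_local: "\<lbrakk>a \<in> gen_fields \<gg>; b \<in> gen_fields \<gg>\<rbrakk> \<Longrightarrow> local_pair \<gg> a b"
    and fields_der: "a \<in> gen_fields \<gg> \<Longrightarrow> (\<lambda>t. der \<gg> (a t)) = dist_deriv \<gg> a"
    and fields_span: "carrier \<gg> = linear_span \<gg> {a t |a t. a \<in> gen_fields \<gg>}"

definition local_lie_hom ::
  "('k::field_char_0, 'a, 'm) local_lie_scheme \<Rightarrow> ('k, 'b, 'n) local_lie_scheme \<Rightarrow> ('a \<Rightarrow> 'b) set"
  where "local_lie_hom \<gg> \<hh> = {f \<in> carrier \<gg> \<rightarrow>\<^sub>E carrier \<hh>. even_linear \<gg> \<hh> f \<and>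
    (\<forall>x\<in>carrier \<gg>. \<forall>y\<in>carrier \<gg>. f (x \<otimes>\<^bsub>\<gg>\<^esub> y) = f x \<otimes>\<^bsub>\<hh>\<^esub> f y) \<and>
    (\<forall>x\<in>carrier \<gg>. f (der \<gg> x) = der \<hh> (f x)) \<and>
    (\<forall>a\<in>gen_fields \<gg>. f \<circ> a \<in> conformal_closure (distributions \<hh>) (gen_fields \<hh>))}"


section \<open>Lie superalgebras given by generators and relations\<close>

text \<open>
  The Lie superalgebra generated by a super vector space \<open>V\<close> modulo a set \<open>rels\<close> of pairs of
  expressions consists of the classes of Lie expressions in elements of \<open>V\<close> under the least
  congruence that contains \<open>rels\<close> and the linear relations of \<open>V\<close>, and whose quotient satisfies
  the axioms of a Lie superalgebra.
\<close>

datatype (dead 'k, gens: 'v) lie_expr =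
    Gen 'v
  | Zero
  | Plus "('k, 'v) lie_expr" "('k, 'v) lie_expr"
  | Scale 'k "('k, 'v) lie_expr"
  | Bracket "('k, 'v) lie_expr" "('k, 'v) lie_expr"
  for map: map_lie_expr

definition lie_exprs :: "('k, 'v, 'm) superspace_scheme \<Rightarrow> ('k, 'v) lie_expr set"
  where "lie_exprs V = {x. gens x \<subseteq> carrier V}"

inductive expr_parity :: "('k, 'v, 'm) superspace_scheme \<Rightarrow> bit \<Rightarrow> ('k, 'v) lie_expr \<Rightarrow> bool"
  for V where
  "v \<in> homog V p \<Longrightarrow> expr_parity V p (Gen v)"
| "expr_parity V p Zero"
| "expr_parity V p x \<Longrightarrow> expr_parity V p y \<Longrightarrow> expr_parity V p (Plus x y)"
| "expr_parity V p x \<Longrightarrow> expr_parity V p (Scale c x)"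
| "expr_parity V p x \<Longrightarrow> expr_parity V q y \<Longrightarrow> expr_parity V (p + q) (Bracket x y)"

inductive lie_eq ::
  "('k::field_char_0, 'v, 'm) superspace_scheme \<Rightarrow> (('k, 'v) lie_expr \<times> ('k, 'v) lie_expr) set \<Rightarrow>
    ('k, 'v) lie_expr \<Rightarrow> ('k, 'v) lie_expr \<Rightarrow> bool"
  for V rels where
  refl: "x \<in> lie_exprs V \<Longrightarrow> lie_eq V rels x x"
| sym: "lie_eq V rels x y \<Longrightarrow> lie_eq V rels y x"
| trans: "lie_eq V rels x y \<Longrightarrow> lie_eq V rels y z \<Longrightarrow> lie_eq V rels x z"
| cong_Plus: "lie_eq V rels x x' \<Longrightarrow> lie_eq V rels y y' \<Longrightarrow> lie_eq V rels (Plus x y) (Plus x' y')"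
| cong_Scale: "lie_eq V rels x x' \<Longrightarrow> lie_eq V rels (Scale c x) (Scale c x')"
| cong_Bracket:
    "lie_eq V rels x x' \<Longrightarrow> lie_eq V rels y y' \<Longrightarrow> lie_eq V rels (Bracket x y) (Bracket x' y')"
| Plus_assoc: "\<lbrakk>x \<in> lie_exprs V; y \<in> lie_exprs V; z \<in> lie_exprs V\<rbrakk>
    \<Longrightarrow> lie_eq V rels (Plus (Plus x y) z) (Plus x (Plus y z))"
| Plus_commute: "\<lbrakk>x \<in> lie_exprs V; y \<in> lie_exprs V\<rbrakk> \<Longrightarrow> lie_eq V rels (Plus x y) (Plus y x)"
| Plus_Zero: "x \<in> lie_exprs V \<Longrightarrow> lie_eq V rels (Plus Zero x) x"
| Plus_inverse: "x \<in> lie_exprs V \<Longrightarrow> lie_eq V rels (Plus x (Scale (-1) x)) Zero"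
| Scale_Plus: "\<lbrakk>x \<in> lie_exprs V; y \<in> lie_exprs V\<rbrakk>
    \<Longrightarrow> lie_eq V rels (Scale c (Plus x y)) (Plus (Scale c x) (Scale c y))"
| Scale_add: "x \<in> lie_exprs V \<Longrightarrow> lie_eq V rels (Scale (c + d) x) (Plus (Scale c x) (Scale d x))"
| Scale_mult: "x \<in> lie_exprs V \<Longrightarrow> lie_eq V rels (Scale (c * d) x) (Scale c (Scale d x))"
| Scale_one: "x \<in> lie_exprs V \<Longrightarrow> lie_eq V rels (Scale 1 x) x"
| Bracket_Plus_left: "\<lbrakk>x \<in> lie_exprs V; y \<in> lie_exprs V; z \<in> lie_exprs V\<rbrakk>
    \<Longrightarrow> lie_eq V rels (Bracket (Plus x y) z) (Plus (Bracket x z) (Bracket y z))"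
| Bracket_Plus_right: "\<lbrakk>x \<in> lie_exprs V; y \<in> lie_exprs V; z \<in> lie_exprs V\<rbrakk>
    \<Longrightarrow> lie_eq V rels (Bracket x (Plus y z)) (Plus (Bracket x y) (Bracket x z))"
| Bracket_Scale_left: "\<lbrakk>x \<in> lie_exprs V; y \<in> lie_exprs V\<rbrakk>
    \<Longrightarrow> lie_eq V rels (Bracket (Scale c x) y) (Scale c (Bracket x y))"
| Bracket_Scale_right: "\<lbrakk>x \<in> lie_exprs V; y \<in> lie_exprs V\<rbrakk>
    \<Longrightarrow> lie_eq V rels (Bracket x (Scale c y)) (Scale c (Bracket x y))"
| skew: "\<lbrakk>x \<in> lie_exprs V; y \<in> lie_exprs V; expr_parity V p x; expr_parity V q y\<rbrakk>
    \<Longrightarrow> lie_eq V rels (Bracket x y) (Scale (- parity_sign p q) (Bracket y x))"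
| jacobi: "\<lbrakk>x \<in> lie_exprs V; y \<in> lie_exprs V; z \<in> lie_exprs V;
      expr_parity V p x; expr_parity V q y\<rbrakk>
    \<Longrightarrow> lie_eq V rels (Bracket (Bracket x y) z)
      (Plus (Bracket x (Bracket y z)) (Scale (- parity_sign p q) (Bracket y (Bracket x z))))"
| Gen_add: "\<lbrakk>u \<in> carrier V; v \<in> carrier V\<rbrakk>
    \<Longrightarrow> lie_eq V rels (Gen (u \<oplus>\<^bsub>V\<^esub> v)) (Plus (Gen u) (Gen v))"
| Gen_smult: "v \<in> carrier V \<Longrightarrow> lie_eq V rels (Gen (c \<odot>\<^bsub>V\<^esub> v)) (Scale c (Gen v))"
| rel: "\<lbrakk>(x, y) \<in> rels; x \<in> lie_exprs V; y \<in> lie_exprs V\<rbrakk> \<Longrightarrow> lie_eq V rels x y"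

definition lie_class ::
  "('k::field_char_0, 'v, 'm) superspace_scheme \<Rightarrow> (('k, 'v) lie_expr \<times> ('k, 'v) lie_expr) set \<Rightarrow>
    ('k, 'v) lie_expr \<Rightarrow> ('k, 'v) lie_expr set"
  where "lie_class V rels x = {y. lie_eq V rels x y}"


section \<open>The local Lie algebra of a vertex Lie algebra\<close>

text \<open>
  \<open>laurent R\<close> is the tensor product of \<open>R\<close> with the Laurent polynomials in \<open>x\<close>: an element is the
  finitely supported family of its coefficients. \<open>monomial R a t\<close> is the tensor of \<open>a\<close> and \<open>x\<^sup>t\<close>.
\<close>

definition laurent :: "('k, 'a, 'm) superspace_scheme \<Rightarrow> ('k, int \<Rightarrow> 'a) superspace"
  where "laurent R =
    \<lparr>carrier = {v. (\<forall>t. v t \<in> carrier R) \<and> finite {t. v t \<noteq> \<zero>\<^bsub>R\<^esub>}},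
     monoid.mult = undefined, one = undefined,
     zero = (\<lambda>t. \<zero>\<^bsub>R\<^esub>), add = (\<lambda>u v t. u t \<oplus>\<^bsub>R\<^esub> v t), smult = (\<lambda>c v t. c \<odot>\<^bsub>R\<^esub> v t),
     homog = (\<lambda>p. {v. (\<forall>t. v t \<in> homog R p) \<and> finite {t. v t \<noteq> \<zero>\<^bsub>R\<^esub>}})\<rparr>"

definition monomial :: "('k, 'a, 'm) superspace_scheme \<Rightarrow> 'a \<Rightarrow> int \<Rightarrow> int \<Rightarrow> 'a"
  where "monomial R a t = (\<lambda>s. if s = t then a else \<zero>\<^bsub>R\<^esub>)"

definition loc_rels ::
  "('k::field_char_0, 'a, 'm) conformal_scheme \<Rightarrow>
    (('k, int \<Rightarrow> 'a) lie_expr \<times> ('k, int \<Rightarrow> 'a) lie_expr) set"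
  where "loc_rels R =
    {(Gen (monomial R (der R a) t), Scale (- of_int t) (Gen (monomial R a (t - 1)))) |a t.
       a \<in> carrier R} \<union>
    {(Bracket (Gen (monomial R a t)) (Gen (monomial R b s)),
      Gen (\<Oplus>\<^bsub>laurent R\<^esub>i\<in>{i. nprod R i a b \<noteq> \<zero>\<^bsub>R\<^esub>}.
        (of_int t gchoose i) \<odot>\<^bsub>laurent R\<^esub> monomial R (nprod R i a b) (t + s - int i))) |a b t s.
       a \<in> carrier R \<and> b \<in> carrier R}"

abbreviation loc_eq ::
  "('k::field_char_0, 'a, 'm) conformal_scheme \<Rightarrow>
    ('k, int \<Rightarrow> 'a) lie_expr \<Rightarrow> ('k, int \<Rightarrow> 'a) lie_expr \<Rightarrow> bool"
  where "loc_eq R \<equiv> lie_eq (laurent R) (loc_rels R)"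

abbreviation loc_class ::
  "('k::field_char_0, 'a, 'm) conformal_scheme \<Rightarrow>
    ('k, int \<Rightarrow> 'a) lie_expr \<Rightarrow> ('k, int \<Rightarrow> 'a) lie_expr set"
  where "loc_class R \<equiv> lie_class (laurent R) (loc_rels R)"

text \<open>The derivation of expressions that extends \<open>a\<^sub>t \<mapsto> (T a)\<^sub>t\<close>.\<close>

primrec expr_der ::
  "('a \<Rightarrow> 'a) \<Rightarrow> ('k, int \<Rightarrow> 'a) lie_expr \<Rightarrow> ('k, int \<Rightarrow> 'a) lie_expr" where
  "expr_der T (Gen v) = Gen (T \<circ> v)"
| "expr_der T Zero = Zero"
| "expr_der T (Plus x y) = Plus (expr_der T x) (expr_der T y)"
| "expr_der T (Scale c x) = Scale c (expr_der T x)"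
| "expr_der T (Bracket x y) = Plus (Bracket (expr_der T x) y) (Bracket x (expr_der T y))"

definition loc_lie ::
  "('k::field_char_0, 'a, 'm) conformal_scheme \<Rightarrow> ('k, ('k, int \<Rightarrow> 'a) lie_expr set) local_lie"
  where "loc_lie R =
    \<lparr>carrier = loc_class R ` lie_exprs (laurent R),
     monoid.mult = (\<lambda>X Y. \<Union>x\<in>X. \<Union>y\<in>Y. loc_class R (Bracket x y)),
     one = undefined,
     zero = loc_class R Zero,
     add = (\<lambda>X Y. \<Union>x\<in>X. \<Union>y\<in>Y. loc_class R (Plus x y)),
     smult = (\<lambda>c X. \<Union>x\<in>X. loc_class R (Scale c x)),
     homog = (\<lambda>p. loc_class R ` {x \<in> lie_exprs (laurent R). expr_parity (laurent R) p x}),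
     der = (\<lambda>X. \<Union>x\<in>X. loc_class R (expr_der (der R) x)),
     gen_fields = {\<lambda>t. loc_class R (Gen (monomial R a t)) |a. a \<in> carrier R}\<rparr>"

definition loc_lie_map ::
  "('k::field_char_0, 'a, 'm) conformal_scheme \<Rightarrow> ('k, 'b, 'n) conformal_scheme \<Rightarrow> ('a \<Rightarrow> 'b) \<Rightarrow>
    ('k, int \<Rightarrow> 'a) lie_expr set \<Rightarrow> ('k, int \<Rightarrow> 'b) lie_expr set"
  where "loc_lie_map R S f =
    (\<lambda>X\<in>carrier (loc_lie R). \<Union>x\<in>X. loc_class S (map_lie_expr (\<lambda>v. f \<circ> v) x))"


section \<open>Categories and fully faithful functors\<close>

record ('o, 'm) category =
  Obj :: "'o set"
  Hom :: "'o \<Rightarrow> 'o \<Rightarrow> 'm set"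
  Id :: "'o \<Rightarrow> 'm"
  Comp :: "'o \<Rightarrow> 'o \<Rightarrow> 'o \<Rightarrow> 'm \<Rightarrow> 'm \<Rightarrow> 'm"

locale category =
  fixes C :: "('o, 'm) category"
  assumes Id_in_Hom: "A \<in> Obj C \<Longrightarrow> Id C A \<in> Hom C A A"
    and Comp_in_Hom: "\<lbrakk>A \<in> Obj C; B \<in> Obj C; D \<in> Obj C; f \<in> Hom C A B; g \<in> Hom C B D\<rbrakk>
      \<Longrightarrow> Comp C A B D g f \<in> Hom C A D"
    and Comp_Id_right: "\<lbrakk>A \<in> Obj C; B \<in> Obj C; f \<in> Hom C A B\<rbrakk> \<Longrightarrow> Comp C A A B f (Id C A) = f"
    and Comp_Id_left: "\<lbrakk>A \<in> Obj C; B \<in> Obj C; f \<in> Hom C A B\<rbrakk> \<Longrightarrow> Comp C A B B (Id C B) f = f"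
    and Comp_assoc:
      "\<lbrakk>A \<in> Obj C; B \<in> Obj C; D \<in> Obj C; E \<in> Obj C;
        f \<in> Hom C A B; g \<in> Hom C B D; h \<in> Hom C D E\<rbrakk>
      \<Longrightarrow> Comp C A D E h (Comp C A B D g f) = Comp C A B E (Comp C B D E h g) f"

locale cat_functor = source: category C + target: category D
  for C :: "('o, 'm) category" and D :: "('p, 'n) category" +
  fixes F :: "'o \<Rightarrow> 'p" and Fm :: "'o \<Rightarrow> 'o \<Rightarrow> 'm \<Rightarrow> 'n"
  assumes F_Obj: "A \<in> Obj C \<Longrightarrow> F A \<in> Obj D"
    and Fm_Hom: "\<lbrakk>A \<in> Obj C; B \<in> Obj C; f \<in> Hom C A B\<rbrakk> \<Longrightarrow> Fm A B f \<in> Hom D (F A) (F B)"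
    and Fm_Id: "A \<in> Obj C \<Longrightarrow> Fm A A (Id C A) = Id D (F A)"
    and Fm_Comp: "\<lbrakk>A \<in> Obj C; B \<in> Obj C; E \<in> Obj C; f \<in> Hom C A B; g \<in> Hom C B E\<rbrakk>
      \<Longrightarrow> Fm A E (Comp C A B E g f) = Comp D (F A) (F B) (F E) (Fm B E g) (Fm A B f)"

locale fully_faithful_functor = cat_functor +
  assumes fully_faithful:
    "\<lbrakk>A \<in> Obj C; B \<in> Obj C\<rbrakk> \<Longrightarrow> bij_betw (Fm A B) (Hom C A B) (Hom D (F A) (F B))"

text \<open>
  The objects are the algebras whose carrier is a subset of the type \<open>'a\<close>, which is arbitrary;
  any set of algebras lives, up to isomorphism, in a single such type.
\<close>

definition vertex_lie_category ::
  "(('k::field_char_0, 'a) conformal, 'a \<Rightarrow> 'a) category"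
  where "vertex_lie_category =
    \<lparr>Obj = {R. vertex_lie_algebra R}, Hom = conformal_hom,
     Id = (\<lambda>R. \<lambda>a\<in>carrier R. a), Comp = (\<lambda>R S U g f. compose (carrier R) g f)\<rparr>"

definition local_lie_category ::
  "(('k::field_char_0, 'a) local_lie, 'a \<Rightarrow> 'a) category"
  where "local_lie_category =
    \<lparr>Obj = {\<gg>. local_lie_algebra \<gg>}, Hom = local_lie_hom,
     Id = (\<lambda>\<gg>. \<lambda>x\<in>carrier \<gg>. x), Comp = (\<lambda>\<gg> \<hh> \<kk> g f. compose (carrier \<gg>) g f)\<rparr>"

end

theory Submission
  imports Defs "HOL-Library.Poly_Mapping" "HOL-Computational_Algebra.Formal_Power_Series"
begin

text \<open>
  The Lie algebra of a vertex Lie algebra \<open>R\<close> is the quotient of \<open>R[x, x\<^sup>-\<^sup>1]\<close> by the image of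
  \<open>T + \<partial>\<^sub>x\<close>, with the 0-th product of the affinization as bracket: this product descends to the
  quotient, is skew-symmetric modulo the image and satisfies the Jacobi identity exactly.
  In particular \<open>a\<^sub>t = 0\<close> for \<open>t = -1\<close> forces \<open>a = 0\<close>, so \<open>a \<mapsto> a(z)\<close> is an injective morphism of
  unbounded conformal algebras. By locality its image is closed under all products, so the closure of the
  generating fields adds nothing, and a morphism of local Lie algebras sends each \<open>a(z)\<close> to some
  \<open>b(z)\<close> with a unique \<open>b\<close>; the map \<open>a \<mapsto> b\<close> is the required morphism of vertex Lie algebras.
\<close>

section \<open>The affinization\<close>

text \<open>The presentation alone does not show that the classes \<open>a_t\<close> stay apart,
  since its relations might collapse them; a concrete model is needed. Expressions are evaluated in
  the affinization itself, before any quotient is taken: there every defining relation holds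
  exactly, apart from skew-symmetry and \<open>(Ta)_t = -t a_{t-1}\<close>, which hold modulo the
  image of \<open>T + \<partial>\<^sub>x\<close>. Conversely, the commutator relation contracts each
  expression to a single generator. A class is thus a Laurent polynomial modulo that image, and
  questions about the presented algebra (is its derivation well defined, do its parities meet only
  in zero, is \<open>a\<close> determined by its field) become questions about Laurent polynomials.

  The double sums involved are awkward over a carrier set, where each term needs a proof of
  membership. They are therefore computed on a whole type. Over a field, the free vector space on
  the type of elements retracts linearly onto the given module, and conjugation with this retraction
  makes the operations total. The model serves only to produce normal forms, whose properties no
  longer mention it.\<close>

abbreviation lk where "lk \<equiv> Poly_Mapping.lookup"
abbreviation sgl where "sgl \<equiv> Poly_Mapping.single"

text \<open>Comparing coefficients in both skew-symmetry and the Jacobi identity comes down to this sum.\<close>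

lemma gbinomial_alternating_sum:
  fixes x s :: "'k::field_char_0"
  shows "(\<Sum>k\<le>m. (-1) ^ k * (x gchoose k) * ((x + s - of_nat k) gchoose (m - k))) = s gchoose m"
proof -
  \<comment> \<open>Upper negation makes the upper entry of the second factor equal to
    \<open>m - x - s - 1\<close>, independent of \<open>k\<close>, and the signs combine to
    \<open>(-1) ^ m\<close>. Vandermonde then applies, and a second negation restores
    \<open>s\<close>.\<close>
  have "(\<Sum>k\<le>m. (-1) ^ k * (x gchoose k) * ((x + s - of_nat k) gchoose (m - k)))
      = (\<Sum>k\<le>m. (-1) ^ m * ((x gchoose k) * ((of_nat m - x - s - 1) gchoose (m - k))))"
  proof (rule sum.cong)
    fix k assume "k \<in> {..m}"
    then have k: "k \<le> m" by simp
    have "(x + s - of_nat k) gchoose (m - k)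
        = (-1) ^ (m - k) * ((of_nat (m - k) - (x + s - of_nat k) - 1) gchoose (m - k))"
      by (subst gbinomial_negated_upper) simp
    also have "of_nat (m - k) - (x + s - of_nat k) - 1 = of_nat m - x - s - 1"
      using k by (simp add: of_nat_diff)
    finally have *: "(x + s - of_nat k) gchoose (m - k) = (-1) ^ (m - k) * ((of_nat m - x - s - 1) gchoose (m - k))" .
    have "(-1::'k) ^ k * (-1) ^ (m - k) = (-1) ^ m"
      using k by (simp flip: power_add)
    then show "(-1) ^ k * (x gchoose k) * ((x + s - of_nat k) gchoose (m - k))
      = (-1) ^ m * ((x gchoose k) * ((of_nat m - x - s - 1) gchoose (m - k)))"
      unfolding * by (metis (no_types, opaque_lifting) mult.assoc mult.left_commute)
  qed simp
  also have "\<dots> = (-1) ^ m * ((of_nat m - s - 1) gchoose m)"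
  proof -
    have "x + (of_nat m - x - s - 1) = of_nat m - s - 1" by simp
    then show ?thesis
      using gbinomial_Vandermonde[of x "of_nat m - x - s - 1" m]
      by (simp only: atLeast0AtMost flip: sum_distrib_left)
  qed
  also have "\<dots> = s gchoose m"
    by (subst (2) gbinomial_negated_upper) simp
  finally show ?thesis .
qed

section \<open>Finitely supported functions and additive maps\<close>

lemma poly_mapping_sum_single:
  fixes u :: "'i \<Rightarrow>\<^sub>0 'a::comm_monoid_add"
  shows "(\<Sum>k\<in>Poly_Mapping.keys u. sgl k (lk u k)) = u"
  by (rule poly_mapping_eqI)
    (auto simp: lookup_sum lookup_single when_def in_keys_iff sum.delta)

text \<open>Confining the coefficients to a set \<open>S\<close> carries parity and range conditions
  through the reduction to monomials.\<close>

lemma poly_mapping_induct_on [consumes 1, case_names zero single add]: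
  fixes u :: "'i \<Rightarrow>\<^sub>0 'a::comm_monoid_add"
  assumes "\<And>k. lk u k \<in> S" and "Q 0" and "\<And>k a. a \<in> S \<Longrightarrow> Q (sgl k a)"
    and "\<And>u v. Q u \<Longrightarrow> Q v \<Longrightarrow> Q (u + v)"
  shows "Q u"
proof -
  have *: "Q (\<Sum>k\<in>A. sgl k (lk u k))" if "finite A" for A
    using that by induction (use assms in auto)
  show ?thesis using *[OF finite_keys[of u]] by (simp only: poly_mapping_sum_single)
qed

lemma additive_sum:
  fixes f :: "'a::ab_group_add \<Rightarrow> 'b::ab_group_add"
  assumes "\<And>u v. f (u + v) = f u + f v"
  shows "f 0 = 0" "f (u - v) = f u - f v" "f (- u) = - f u" "f (sum g A) = (\<Sum>x\<in>A. f (g x))"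
proof -
  show 0: "f 0 = 0" using assms[of 0 0] by simp
  show "f (- u) = - f u" for u using assms[of u "- u"] 0 by (simp add: eq_neg_iff_add_eq_0 add.commute)
  then show "f (u - v) = f u - f v" using assms[of u "- v"] by simp
  show "f (sum g A) = (\<Sum>x\<in>A. f (g x))"
    by (induction A rule: infinite_finite_induct) (auto simp: 0 assms)
qed

lemma poly_mapping_additive_eq:
  fixes f g :: "('i \<Rightarrow>\<^sub>0 'a::ab_group_add) \<Rightarrow> 'b::ab_group_add"
  assumes "\<And>u v. f (u + v) = f u + f v" "\<And>u v. g (u + v) = g u + g v"
    and "\<And>k a. f (sgl k a) = g (sgl k a)"
  shows "f u = g u"
proof -
  have "\<And>k. lk u k \<in> UNIV" by simp
  then show ?thesis
    by (induction u rule: poly_mapping_induct_on) (use assms additive_sum(1)[of f] additive_sum(1)[of g] in auto)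
qed

text \<open>The map out of a direct sum supplied by its universal property, from maps
  \<open>f k\<close> on the summands.\<close>

definition extend_sum :: "('i \<Rightarrow> 'a::ab_group_add \<Rightarrow> 'b::ab_group_add) \<Rightarrow> ('i \<Rightarrow>\<^sub>0 'a) \<Rightarrow> 'b"
  where "extend_sum f u = (\<Sum>k\<in>Poly_Mapping.keys u. f k (lk u k))"

lemma extend_sum_add:
  assumes "\<And>k a b. f k (a + b) = f k a + f k b"
  shows "extend_sum f (u + v) = extend_sum f u + extend_sum f v"
  unfolding extend_sum_def
  by (rule setsum_keys_plus_distrib) (use assms additive_sum(1)[of "f _"] in auto)

lemma extend_sum_single:
  assumes "f k 0 = 0"
  shows "extend_sum f (sgl k a) = f k a"
  using assms by (simp add: extend_sum_def)

lemma extend_sum_add_fun: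
  "extend_sum (\<lambda>k a. f k a + g k a) u = extend_sum f u + extend_sum g u"
  by (simp add: extend_sum_def sum.distrib)

text \<open>\<open>Poly_Mapping.map\<close> leaves zero coefficients at zero whatever
  \<open>f\<close> does there; this is why the formula for coefficients asks for
  \<open>f 0 = 0\<close>.\<close>

definition coeffwise :: "('a::ab_group_add \<Rightarrow> 'a) \<Rightarrow> ('i \<Rightarrow>\<^sub>0 'a) \<Rightarrow> ('i \<Rightarrow>\<^sub>0 'a)"
  where "coeffwise f = Poly_Mapping.map f"

lemma lookup_coeffwise: "f 0 = 0 \<Longrightarrow> lk (coeffwise f u) k = f (lk u k)"
  unfolding coeffwise_def by (cases "lk u k = 0") (auto simp: map.rep_eq when_def)

lemma coeffwise_add:
  assumes "\<And>a b. f (a + b) = f a + f b"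
  shows "coeffwise f (u + v) = coeffwise f u + coeffwise f v"
  by (rule poly_mapping_eqI) (simp add: lookup_coeffwise additive_sum(1)[OF assms] assms lookup_add)

lemma coeffwise_single:
  assumes "f 0 = 0"
  shows "coeffwise f (sgl k a) = sgl k (f a)"
  by (rule poly_mapping_eqI) (simp add: lookup_coeffwise assms lookup_single when_def)

text \<open>
  A vertex Lie algebra whose operations are total on a type, so that sums need no carrier conditions.
  The homogeneous parts \<open>H p\<close> need not span the type.
\<close>

locale total_vertex_lie =
  fixes sc :: "'k::field_char_0 \<Rightarrow> 'w::ab_group_add \<Rightarrow> 'w"  (infixr \<open>*s\<close> 75)
    and T :: "'w \<Rightarrow> 'w" and P :: "nat \<Rightarrow> 'w \<Rightarrow> 'w \<Rightarrow> 'w" and H :: "bit \<Rightarrow> 'w set"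
  assumes sc_vs: "vector_space sc"
    and T_add: "T (a + b) = T a + T b" and T_sc: "T (c *s a) = c *s T a"
    and P_add_left: "P n (a + b) d = P n a d + P n b d"
    and P_add_right: "P n a (b + d) = P n a b + P n a d"
    and P_sc_left: "P n (c *s a) b = c *s P n a b"
    and P_sc_right: "P n a (c *s b) = c *s P n a b"
    and T_P: "T (P n a b) = P n (T a) b + P n a (T b)"
    and P_T_0: "P 0 (T a) b = 0"
    and P_T_Suc: "P (Suc n) (T a) b = (- of_nat (Suc n)) *s P n a b"
    and P_finite: "finite {n. P n a b \<noteq> 0}"
    and P_jacobi: "a \<in> H p \<Longrightarrow> b \<in> H q \<Longrightarrow> P j (P i a b) d =
        (\<Sum>k\<le>i. ((-1) ^ k * of_nat (i choose k)) *s P (i - k) a (P (j + k) b d))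
        - parity_sign p q *s (\<Sum>k\<le>i. ((-1) ^ k * of_nat (i choose k)) *s P (j + k) b (P (i - k) a d))"
    and P_skew: "a \<in> H p \<Longrightarrow> b \<in> H q \<Longrightarrow> P n a b =
        - (parity_sign p q *s (\<Sum>k | P (n + k) b a \<noteq> 0. ((-1) ^ (n + k) / fact k) *s (T ^^ k) (P (n + k) b a)))"
    and H_zero: "0 \<in> H p" and H_add: "a \<in> H p \<Longrightarrow> b \<in> H p \<Longrightarrow> a + b \<in> H p"
    and H_sc: "a \<in> H p \<Longrightarrow> c *s a \<in> H p"
    and H_P: "a \<in> H p \<Longrightarrow> b \<in> H q \<Longrightarrow> P n a b \<in> H (p + q)"
begin

sublocale vs: vector_space sc by (rule sc_vs)

lemma P_zero [simp]: "P n 0 b = 0" "P n a 0 = 0"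
  using P_sc_left[of n 0 0 b] P_sc_right[of n a 0 0] by auto

lemma T_zero [simp]: "T 0 = 0" using T_sc[of 0 0] by simp

section \<open>Operators and bracket on Laurent polynomials\<close>

definition aff_scale :: "'k \<Rightarrow> (int \<Rightarrow>\<^sub>0 'w) \<Rightarrow> (int \<Rightarrow>\<^sub>0 'w)" (infixr \<open>*m\<close> 75)
  where "aff_scale c = coeffwise (sc c)"
definition aff_T :: "(int \<Rightarrow>\<^sub>0 'w) \<Rightarrow> (int \<Rightarrow>\<^sub>0 'w)" where "aff_T = coeffwise T"
definition x_der :: "(int \<Rightarrow>\<^sub>0 'w) \<Rightarrow> (int \<Rightarrow>\<^sub>0 'w)"
  where "x_der = extend_sum (\<lambda>t a. sgl (t - 1) (of_int t *s a))"
text \<open>On the monomial \<open>a x^t\<close> this is the difference of the two sides of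
  \<open>(Ta)_t = -t a_{t-1}\<close>, so its image is the subspace to be divided out.\<close>

definition total_der :: "(int \<Rightarrow>\<^sub>0 'w) \<Rightarrow> (int \<Rightarrow>\<^sub>0 'w)" where "total_der u = aff_T u + x_der u"

text \<open>The 0-th product of \<open>a x^t\<close> and \<open>b x^s\<close> in the affinization,
  which is the commutator formula for \<open>[a_t, b_s]\<close>.\<close>

definition beta :: "int \<Rightarrow> 'w \<Rightarrow> int \<Rightarrow> 'w \<Rightarrow> (int \<Rightarrow>\<^sub>0 'w)"
  where "beta t a s b = (\<Sum>i | P i a b \<noteq> 0. sgl (t + s - int i) ((of_int t gchoose i) *s P i a b))"

definition aff_bracket :: "(int \<Rightarrow>\<^sub>0 'w) \<Rightarrow> (int \<Rightarrow>\<^sub>0 'w) \<Rightarrow> (int \<Rightarrow>\<^sub>0 'w)"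
  where "aff_bracket u v = extend_sum (\<lambda>t a. extend_sum (\<lambda>s b. beta t a s b) v) u"

lemma aff_scale_add: "c *m (u + v) = c *m u + c *m v"
  by (simp add: aff_scale_def coeffwise_add vs.scale_right_distrib)
lemma lookup_aff_scale: "lk (c *m u) k = c *s lk u k"
  by (simp add: aff_scale_def lookup_coeffwise)
lemma aff_scale_single: "c *m sgl k a = sgl k (c *s a)"
  by (simp add: aff_scale_def coeffwise_single)
lemma aff_T_add: "aff_T (u + v) = aff_T u + aff_T v"
  by (simp add: aff_T_def coeffwise_add T_add)
lemma aff_T_single: "aff_T (sgl k a) = sgl k (T a)"
  by (simp add: aff_T_def coeffwise_single)
lemma lookup_aff_T: "lk (aff_T u) k = T (lk u k)"
  by (simp add: aff_T_def lookup_coeffwise)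
lemma x_der_add: "x_der (u + v) = x_der u + x_der v"
  by (simp add: x_der_def extend_sum_add vs.scale_right_distrib single_add)
lemma x_der_single: "x_der (sgl t a) = sgl (t - 1) (of_int t *s a)"
  by (simp add: x_der_def extend_sum_single)
lemma lookup_x_der: "lk (x_der u) k = of_int (k + 1) *s lk u (k + 1)"
proof -
  have "(\<lambda>u. lk (x_der u) k) u = (\<lambda>u. of_int (k + 1) *s lk u (k + 1)) u"
    by (rule poly_mapping_additive_eq)
      (auto simp: x_der_add lookup_add vs.scale_right_distrib x_der_single lookup_single when_def)
  then show ?thesis by simp
qed
lemma total_der_add: "total_der (u + v) = total_der u + total_der v"
  by (simp add: total_der_def aff_T_add x_der_add)
lemma total_der_single: "total_der (sgl t a) = sgl t (T a) + sgl (t - 1) (of_int t *s a)"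
  by (simp add: total_der_def aff_T_single x_der_single)
lemma lookup_total_der: "lk (total_der u) k = T (lk u k) + of_int (k + 1) *s lk u (k + 1)"
  by (simp add: total_der_def lookup_aff_T lookup_x_der lookup_add)

lemmas aff_scale_sum = additive_sum[of "aff_scale _", OF aff_scale_add]
lemmas aff_T_sum = additive_sum[of aff_T, OF aff_T_add]
lemmas x_der_sum = additive_sum[of x_der, OF x_der_add]
lemmas total_der_sum = additive_sum[of total_der, OF total_der_add]

lemma aff_scale_one: "1 *m u = u"
  by (rule poly_mapping_eqI) (simp add: lookup_aff_scale)
lemma aff_scale_aff_scale: "c *m d *m u = (c * d) *m u"
  by (rule poly_mapping_eqI) (simp add: lookup_aff_scale)
lemma aff_scale_left_add: "(c + d) *m u = c *m u + d *m u"
  by (rule poly_mapping_eqI) (simp add: lookup_aff_scale lookup_add vs.scale_left_distrib)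
lemma aff_scale_minus_one: "(- 1) *m u = - u"
  by (rule poly_mapping_eqI) (simp add: lookup_aff_scale)
lemma aff_scale_minus: "(- c) *m u = - (c *m u)"
  by (rule poly_mapping_eqI) (simp add: lookup_aff_scale)
lemma aff_T_aff_scale: "aff_T (c *m u) = c *m aff_T u"
  by (rule poly_mapping_eqI) (simp add: lookup_aff_scale lookup_aff_T T_sc)
lemma total_der_aff_scale: "total_der (c *m u) = c *m total_der u"
  by (rule poly_mapping_eqI)
    (simp add: lookup_aff_scale lookup_total_der T_sc vs.scale_right_distrib mult.commute)

lemma P_bound: obtains N where "\<And>i. i \<ge> N \<Longrightarrow> P i a b = 0"
proof -
  obtain N where "\<forall>i\<in>{n. P n a b \<noteq> 0}. i < N"
    using P_finite[of a b] unfolding finite_nat_set_iff_bounded by blast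
  then show thesis by (intro that[of N]) (auto simp: not_less[symmetric])
qed

text \<open>The set of nonzero products changes with the arguments. A common initial range allows
  several such sums to be combined term by term.\<close>

lemma beta_eq:
  assumes "\<And>i. i \<ge> N \<Longrightarrow> P i a b = 0"
  shows "beta t a s b = (\<Sum>i<N. sgl (t + s - int i) ((of_int t gchoose i) *s P i a b))"
  unfolding beta_def
  by (rule sum.mono_neutral_left) (use assms not_le_imp_less in \<open>auto\<close>)

lemma beta_add_left: "beta t (a + a') s b = beta t a s b + beta t a' s b"
proof -
  obtain N where N: "\<And>i. i \<ge> N \<Longrightarrow> P i a b = 0" using P_bound[of a b] by blast
  obtain N' where N': "\<And>i. i \<ge> N' \<Longrightarrow> P i a' b = 0" using P_bound[of a' b] by blast
  show ?thesis
    by (subst (1 2 3) beta_eq[where N = "max N N'"])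
      (auto simp: N N' P_add_left vs.scale_right_distrib single_add sum.distrib)
qed

lemma beta_add_right: "beta t a s (b + b') = beta t a s b + beta t a s b'"
proof -
  obtain N where N: "\<And>i. i \<ge> N \<Longrightarrow> P i a b = 0" using P_bound[of a b] by blast
  obtain N' where N': "\<And>i. i \<ge> N' \<Longrightarrow> P i a b' = 0" using P_bound[of a b'] by blast
  show ?thesis
    by (subst (1 2 3) beta_eq[where N = "max N N'"])
      (auto simp: N N' P_add_right vs.scale_right_distrib single_add sum.distrib)
qed

lemma beta_sc: "beta t (c *s a) s b = c *m beta t a s b" "beta t a s (c *s b) = c *m beta t a s b"
proof -
  obtain N where N: "\<And>i. i \<ge> N \<Longrightarrow> P i a b = 0" using P_bound[of a b] by blast
  show "beta t (c *s a) s b = c *m beta t a s b" "beta t a s (c *s b) = c *m beta t a s b"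
    by (subst (1 2) beta_eq[where N = N], auto simp: N P_sc_left P_sc_right aff_scale_sum aff_scale_single mult.commute)+
qed

lemma beta_zero [simp]: "beta t 0 s b = 0" "beta t a s 0 = 0"
  by (simp_all add: beta_def)

lemma aff_bracket_add_left: "aff_bracket (u + u') v = aff_bracket u v + aff_bracket u' v"
  unfolding aff_bracket_def by (rule extend_sum_add) (simp only: extend_sum_add_fun[symmetric] beta_add_left[symmetric])

lemma aff_bracket_add_right: "aff_bracket u (v + v') = aff_bracket u v + aff_bracket u v'"
  unfolding aff_bracket_def by (simp add: extend_sum_add beta_add_right extend_sum_add_fun)

lemma aff_bracket_single: "aff_bracket (sgl t a) (sgl s b) = beta t a s b"
  unfolding aff_bracket_def by (simp add: extend_sum_single)

lemmas aff_bracket_sum_left = additive_sum[of "\<lambda>u. aff_bracket u _", OF aff_bracket_add_left]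
lemmas aff_bracket_sum_right = additive_sum[of "aff_bracket _", OF aff_bracket_add_right]

lemma aff_bracket_aff_scale_left: "aff_bracket (c *m u) v = c *m aff_bracket u v"
  by (rule poly_mapping_additive_eq[of "\<lambda>u. aff_bracket (c *m u) v" "\<lambda>u. c *m aff_bracket u v"],
      simp_all add: aff_bracket_add_left aff_scale_add aff_scale_single,
      rule poly_mapping_additive_eq[of "\<lambda>v. aff_bracket _ v" "\<lambda>v. c *m aff_bracket _ v"])
    (simp_all add: aff_bracket_add_right aff_scale_add aff_bracket_single beta_sc)

lemma aff_bracket_aff_scale_right: "aff_bracket u (c *m v) = c *m aff_bracket u v"
  by (rule poly_mapping_additive_eq[of "\<lambda>u. aff_bracket u (c *m v)" "\<lambda>u. c *m aff_bracket u v"],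
      simp_all add: aff_bracket_add_left aff_scale_add aff_scale_single,
      rule poly_mapping_additive_eq[of "\<lambda>v. aff_bracket _ (c *m v)" "\<lambda>v. c *m aff_bracket _ v"])
    (simp_all add: aff_bracket_add_right aff_scale_add aff_scale_single aff_bracket_single beta_sc)

section \<open>Derivations of the bracket\<close>

lemma aff_T_aff_bracket: "aff_T (aff_bracket u v) = aff_bracket (aff_T u) v + aff_bracket u (aff_T v)"
proof (rule poly_mapping_additive_eq[of "\<lambda>u. aff_T (aff_bracket u v)" "\<lambda>u. aff_bracket (aff_T u) v + aff_bracket u (aff_T v)"];
    (simp add: aff_bracket_add_left aff_T_add)?)
  fix t a
  show "aff_T (aff_bracket (sgl t a) v) = aff_bracket (aff_T (sgl t a)) v + aff_bracket (sgl t a) (aff_T v)"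
  proof (rule poly_mapping_additive_eq[of "\<lambda>v. aff_T (aff_bracket (sgl t a) v)"]; (simp add: aff_bracket_add_right aff_T_add)?)
    fix s b
    obtain N where N: "\<And>i. i \<ge> N \<Longrightarrow> P i a b = 0" using P_bound[of a b] by blast
    obtain N' where N': "\<And>i. i \<ge> N' \<Longrightarrow> P i a (T b) = 0" using P_bound[of a "T b"] by blast
    obtain N'' where N'': "\<And>i. i \<ge> N'' \<Longrightarrow> P i (T a) b = 0" using P_bound[of "T a" b] by blast
    show "aff_T (aff_bracket (sgl t a) (sgl s b)) = aff_bracket (aff_T (sgl t a)) (sgl s b) + aff_bracket (sgl t a) (aff_T (sgl s b))"
      unfolding aff_T_single aff_bracket_single
      by (subst (1 2 3) beta_eq[where N = "max N (max N' N'')"])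
        (auto simp: N N' N'' aff_T_sum aff_T_single T_sc T_P vs.scale_right_distrib single_add sum.distrib)
  qed
qed

lemma x_der_aff_bracket: "x_der (aff_bracket u v) = aff_bracket (x_der u) v + aff_bracket u (x_der v)"
proof (rule poly_mapping_additive_eq[of "\<lambda>u. x_der (aff_bracket u v)" "\<lambda>u. aff_bracket (x_der u) v + aff_bracket u (x_der v)"];
    (simp add: aff_bracket_add_left x_der_add)?)
  fix t a
  show "x_der (aff_bracket (sgl t a) v) = aff_bracket (x_der (sgl t a)) v + aff_bracket (sgl t a) (x_der v)"
  proof (rule poly_mapping_additive_eq[of "\<lambda>v. x_der (aff_bracket (sgl t a) v)"]; (simp add: aff_bracket_add_right x_der_add)?)
    fix s b
    obtain N where N: "\<And>i. i \<ge> N \<Longrightarrow> P i a b = 0" using P_bound[of a b] by blast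
    \<comment> \<open>The exponent is split as \<open>(t - i) + s\<close>, and absorption gives
      \<open>(t - i) * (t gchoose i) = t * ((t - 1) gchoose i)\<close>.\<close>
    have *: "(of_int (t + s - int i) :: 'k) * (of_int t gchoose i)
        = of_int t * (of_int (t - 1) gchoose i) + of_int s * (of_int t gchoose i)" for i
      using gbinomial_absorb_comp[of "of_int t :: 'k" i] by (simp add: algebra_simps)
    show "x_der (aff_bracket (sgl t a) (sgl s b)) = aff_bracket (x_der (sgl t a)) (sgl s b) + aff_bracket (sgl t a) (x_der (sgl s b))"
    proof -
      have "x_der (beta t a s b) = (\<Sum>i<N. sgl (t + s - int i - 1) ((of_int (t + s - int i) * (of_int t gchoose i)) *s P i a b))"
        by (subst beta_eq[OF N]) (simp_all add: x_der_sum x_der_single)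
      also have "\<dots> = (\<Sum>i<N. sgl (t - 1 + s - int i) ((of_int t * (of_int (t - 1) gchoose i)) *s P i a b)
          + sgl (t + (s - 1) - int i) ((of_int s * (of_int t gchoose i)) *s P i a b))"
        unfolding * vs.scale_left_distrib single_add
        by (intro sum.cong arg_cong2[where f = "(+)"] arg_cong2[where f = sgl]) auto
      also have "\<dots> = of_int t *m beta (t - 1) a s b + of_int s *m beta t a (s - 1) b"
        by (subst (1 2) beta_eq[OF N]) (simp_all add: aff_scale_sum aff_scale_single sum.distrib)
      finally show ?thesis by (simp add: x_der_single aff_bracket_single beta_sc)
    qed
  qed
qed

text \<open>In the affinization \<open>T + \<partial>\<^sub>x\<close> is the translation operator,
  and a 0-th product vanishes when translation is applied to its left factor. Concretely,
  \<open>P_T_Suc\<close> and absorption give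
  \<open>[(Ta) x^t, v] = - t [a x^(t-1), v]\<close>.\<close>

lemma aff_bracket_total_der_left: "aff_bracket (total_der u) v = 0"
proof (rule poly_mapping_additive_eq[of "\<lambda>u. aff_bracket (total_der u) v" "\<lambda>u. 0"]; (simp add: aff_bracket_add_left total_der_add)?)
  fix t a
  show "aff_bracket (total_der (sgl t a)) v = 0"
  proof (rule poly_mapping_additive_eq[of "\<lambda>v. aff_bracket (total_der (sgl t a)) v" "\<lambda>u. 0"]; (simp add: aff_bracket_add_right)?)
    fix s b
    obtain N where N: "\<And>i. i \<ge> N \<Longrightarrow> P i a b = 0" using P_bound[of a b] by blast
    \<comment> \<open>By \<open>P_T_Suc\<close> the products of \<open>T a\<close> are those of
      \<open>a\<close> moved up by one index, so the bound grows by one.\<close>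
    have N': "P i (T a) b = 0" if "i \<ge> Suc N" for i
      using that by (cases i) (auto simp: P_T_Suc N)
    have *: "(of_int t gchoose Suc i) * (- of_nat (Suc i)) = - ((of_int t :: 'k) * (of_int (t - 1) gchoose i))" for i
      using gbinomial_absorption[of i "of_int t :: 'k"] by (simp add: algebra_simps)
    have "beta t (T a) s b = (\<Sum>i<N. sgl (t + s - int i - 1) ((of_int t gchoose Suc i) *s (- of_nat (Suc i)) *s P i a b))"
      by (subst beta_eq[OF N'], assumption, subst sum.lessThan_Suc_shift) (simp add: P_T_0 P_T_Suc algebra_simps)
    also have "\<dots> = (\<Sum>i<N. - sgl (t - 1 + s - int i) (of_int t *s (of_int (t - 1) gchoose i) *s P i a b))"
      unfolding vs.scale_scale * by (simp add: single_uminus algebra_simps)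
    also have "\<dots> = - (of_int t *m beta (t - 1) a s b)"
      by (subst beta_eq[OF N]) (simp_all add: aff_scale_sum aff_scale_single sum_negf)
    finally show "aff_bracket (total_der (sgl t a)) (sgl s b) = 0"
      by (simp add: total_der_single aff_bracket_add_left aff_bracket_single beta_sc)
  qed
qed

text \<open>\<open>T\<close> and \<open>\<partial>\<^sub>x\<close> are both derivations of the
  bracket, and the term of the Leibniz rule with the derivative on the left is zero. The image of
  \<open>total_der\<close> is thus absorbed from either side.\<close>

lemma aff_bracket_total_der_right: "aff_bracket u (total_der v) = total_der (aff_bracket u v)"
  using aff_bracket_total_der_left[of u v] by (simp add: total_der_def aff_T_aff_bracket x_der_aff_bracket aff_bracket_add_left aff_bracket_add_right algebra_simps)

section \<open>Congruence modulo total derivatives and skew-symmetry\<close>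

definition cong :: "(int \<Rightarrow>\<^sub>0 'w) \<Rightarrow> (int \<Rightarrow>\<^sub>0 'w) \<Rightarrow> bool" (infix \<open>\<approx>\<close> 50)
  where "u \<approx> v \<longleftrightarrow> (\<exists>w. u = v + total_der w)"

lemma cong_refl [simp]: "u \<approx> u"
  unfolding cong_def by (rule exI[of _ 0]) (simp add: total_der_sum)
lemma cong_sym: "u \<approx> v \<Longrightarrow> v \<approx> u"
  unfolding cong_def by (erule exE, rule_tac x = "- w" in exI) (simp add: total_der_sum)
lemma cong_trans [trans]: "u \<approx> v \<Longrightarrow> v \<approx> w \<Longrightarrow> u \<approx> w"
  unfolding cong_def by (metis total_der_add add.assoc)
lemma cong_add: "u \<approx> u' \<Longrightarrow> v \<approx> v' \<Longrightarrow> u + v \<approx> u' + v'"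
  unfolding cong_def by (elim exE, rule_tac x = "w + wa" in exI) (simp add: total_der_add algebra_simps)
lemma cong_aff_scale: "u \<approx> v \<Longrightarrow> c *m u \<approx> c *m v"
  unfolding cong_def by (metis total_der_aff_scale aff_scale_add)
lemma cong_sum: "(\<And>x. x \<in> A \<Longrightarrow> f x \<approx> g x) \<Longrightarrow> sum f A \<approx> sum g A"
  by (induction A rule: infinite_finite_induct) (auto intro: cong_add)
lemma cong_aff_bracket: "u \<approx> u' \<Longrightarrow> v \<approx> v' \<Longrightarrow> aff_bracket u v \<approx> aff_bracket u' v'"
  unfolding cong_def by (elim exE) (auto simp: aff_bracket_add_left aff_bracket_add_right aff_bracket_total_der_left aff_bracket_total_der_right)
text \<open>Integration by parts: modulo the image of \<open>T + \<partial>\<^sub>x\<close>, the operator \<open>T\<close> acts as \<open>-\<partial>\<^sub>x\<close>.\<close>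

lemma cong_single_T_power:
  "sgl m ((T ^^ k) c) \<approx> sgl (m - int k) (((-1) ^ k * fact k * (of_int m gchoose k)) *s c)"
proof (induction k arbitrary: m)
  case (Suc k)
  \<comment> \<open>One integration by parts contributes \<open>-m\<close>; absorption turns
    \<open>m * ((m - 1) gchoose k)\<close> into \<open>(k + 1) * (m gchoose (k + 1))\<close>, whose
    first factor completes the factorial.\<close>
  have eq: "(- of_int m :: 'k) * ((-1) ^ k * fact k * (of_int (m - 1) gchoose k))
      = (-1) ^ Suc k * fact (Suc k) * (of_int m gchoose Suc k)"
    using arg_cong[OF gbinomial_absorption[of k "of_int m :: 'k"], of "(*) ((-1) ^ Suc k * fact k)"]
    by (simp add: algebra_simps)
  have "sgl m ((T ^^ Suc k) c) \<approx> (- of_int m) *m sgl (m - 1) ((T ^^ k) c)"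
    unfolding cong_def
    by (rule exI[of _ "sgl m ((T ^^ k) c)"]) (simp add: total_der_single aff_scale_single single_uminus)
  also have X: "\<dots> \<approx> (- of_int m) *m sgl (m - 1 - int k) (((-1) ^ k * fact k * (of_int (m - 1) gchoose k)) *s c)"
    by (intro cong_aff_scale Suc.IH)
  also have "(- of_int m) *m sgl (m - 1 - int k) (((-1) ^ k * fact k * (of_int (m - 1) gchoose k)) *s c)
    = sgl (m - int (Suc k)) (((-1) ^ Suc k * fact (Suc k) * (of_int m gchoose Suc k)) *s c)"
    unfolding aff_scale_single vs.scale_scale eq by (intro arg_cong2[where f = sgl]) simp_all
  finally show ?case .
qed simp

text \<open>After \<open>P_skew\<close> is inserted, each power of \<open>T\<close> is removed by
  parts. What remains in front of \<open>P m b a\<close> is an alternating sum over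
  \<open>n \<le> m\<close>, which \<open>gbinomial_alternating_sum\<close> evaluates to
  \<open>s gchoose m\<close>. Powers of \<open>T\<close> enter through the axiom, so only a
  congruence can be expected.\<close>

lemma beta_skew:
  assumes a: "a \<in> H p" and b: "b \<in> H q"
  shows "beta t a s b \<approx> (- parity_sign p q) *m beta s b t a"
proof -
  let ?z = "parity_sign p q :: 'k"
  obtain N1 where N1: "\<And>i. i \<ge> N1 \<Longrightarrow> P i a b = 0" using P_bound[of a b] by blast
  obtain N2 where N2: "\<And>i. i \<ge> N2 \<Longrightarrow> P i b a = 0" using P_bound[of b a] by blast
  define N where "N = max N1 N2"
  have Na: "P i a b = 0" and Nb: "P i b a = 0" if "i \<ge> N" for i
    using that N1 N2 by (auto simp: N_def)
  \<comment> \<open>Reindexing by \<open>m = n + k\<close> with one cutoff \<open>N\<close> for all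
    \<open>n\<close> makes the double sum below run over a triangle, where the order of summation
    can be exchanged.\<close>
  have skew: "P n a b = (- ?z) *s (\<Sum>m\<in>{n..<N}. ((-1) ^ m / fact (m - n)) *s (T ^^ (m - n)) (P m b a))" for n
  proof -
    have T0: "(T ^^ k) 0 = 0" for k by (induction k) auto
    have "(\<Sum>k | P (n + k) b a \<noteq> 0. ((-1) ^ (n + k) / fact k) *s (T ^^ k) (P (n + k) b a))
      = (\<Sum>k<N - n. ((-1) ^ (n + k) / fact k) *s (T ^^ k) (P (n + k) b a))"
    proof (rule sum.mono_neutral_left)
      show "{k. P (n + k) b a \<noteq> 0} \<subseteq> {..<N - n}"
      proof
        fix k assume "k \<in> {k. P (n + k) b a \<noteq> 0}"
        then have "\<not> N \<le> n + k" using Nb by blast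
        then show "k \<in> {..<N - n}" by auto
      qed
      show "\<forall>k\<in>{..<N - n} - {k. P (n + k) b a \<noteq> 0}. ((-1) ^ (n + k) / fact k) *s (T ^^ k) (P (n + k) b a) = 0"
        by (simp add: T0)
    qed simp
    also have "\<dots> = (\<Sum>m\<in>{n..<N}. ((-1) ^ m / fact (m - n)) *s (T ^^ (m - n)) (P m b a))"
      by (rule sum.reindex_bij_witness[of _ "\<lambda>m. m - n" "\<lambda>k. n + k"]) auto
    finally show ?thesis using P_skew[OF a b, of n] by simp
  qed
  have "beta t a s b = (\<Sum>n<N. sgl (t + s - int n) ((of_int t gchoose n) *s
      (- ?z) *s (\<Sum>m\<in>{n..<N}. ((-1) ^ m / fact (m - n)) *s (T ^^ (m - n)) (P m b a))))"
    by (subst beta_eq[OF Na], assumption) (simp only: skew)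
  also have "\<dots> = (- ?z) *m (\<Sum>n<N. \<Sum>m\<in>{n..<N}.
      ((of_int t gchoose n) * (-1) ^ m / fact (m - n)) *m sgl (t + s - int n) ((T ^^ (m - n)) (P m b a)))"
    by (simp add: aff_scale_sum aff_scale_single vs.scale_sum_right mult.commute mult.left_commute
        additive_sum(4)[of "sgl _", OF single_add])
  finally have 1: "beta t a s b = (- ?z) *m (\<Sum>n<N. \<Sum>m\<in>{n..<N}.
      ((of_int t gchoose n) * (-1) ^ m / fact (m - n)) *m sgl (t + s - int n) ((T ^^ (m - n)) (P m b a)))" .
  have 2: "(- ?z) *m (\<Sum>n<N. \<Sum>m\<in>{n..<N}.
      ((of_int t gchoose n) * (-1) ^ m / fact (m - n)) *m sgl (t + s - int n) ((T ^^ (m - n)) (P m b a)))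
    \<approx> (- ?z) *m (\<Sum>n<N. \<Sum>m\<in>{n..<N}.
      ((of_int t gchoose n) * (-1) ^ m / fact (m - n)) *m sgl (t + s - int n - int (m - n))
        (((-1) ^ (m - n) * fact (m - n) * (of_int (t + s - int n) gchoose (m - n))) *s P m b a))"
    by (rule cong_aff_scale, rule cong_sum, rule cong_sum, rule cong_aff_scale, rule cong_single_T_power)
  have "(\<Sum>n<N. \<Sum>m\<in>{n..<N}.
      ((of_int t gchoose n) * (-1) ^ m / fact (m - n)) *m sgl (t + s - int n - int (m - n))
        (((-1) ^ (m - n) * fact (m - n) * (of_int (t + s - int n) gchoose (m - n))) *s P m b a))
    = (\<Sum>n<N. \<Sum>m\<in>{n..<N}. sgl (s + t - int m)
        (((-1) ^ n * (of_int t gchoose n) * (of_int (t + s - int n) gchoose (m - n))) *s P m b a))"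
  proof (intro sum.cong HOL.refl)
    fix n m assume "m \<in> {n..<N}"
    then have nm: "n \<le> m" by simp
    then obtain j where j: "m = n + j" using le_Suc_ex by blast
    \<comment> \<open>The factorial from integration by parts cancels the one from the divided
      power, and with \<open>m = n + j\<close> the signs \<open>(-1) ^ m\<close> and
      \<open>(-1) ^ j\<close> leave \<open>(-1) ^ n\<close>.\<close>
    have "((of_int t gchoose n) * (-1) ^ m / fact (m - n)) * ((-1) ^ (m - n) * fact (m - n) * (of_int (t + s - int n) gchoose (m - n)))
      = (-1) ^ n * (of_int t gchoose n) * ((of_int (t + s - int n) gchoose (m - n)) :: 'k)"
      unfolding j by (simp add: power_add mult.assoc[symmetric] flip: power_mult_distrib)
    moreover have "t + s - int n - int (m - n) = s + t - int m" using nm by simp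
    ultimately show "((of_int t gchoose n) * (-1) ^ m / fact (m - n)) *m sgl (t + s - int n - int (m - n))
        (((-1) ^ (m - n) * fact (m - n) * (of_int (t + s - int n) gchoose (m - n))) *s P m b a)
      = sgl (s + t - int m) (((-1) ^ n * (of_int t gchoose n) * (of_int (t + s - int n) gchoose (m - n))) *s P m b a)"
      by (simp only: aff_scale_single vs.scale_scale)
  qed
  also have "\<dots> = (\<Sum>m<N. \<Sum>n\<le>m. sgl (s + t - int m)
        (((-1) ^ n * (of_int t gchoose n) * (of_int (t + s - int n) gchoose (m - n))) *s P m b a))"
    unfolding sum.Sigma[OF finite_lessThan ballI[OF finite_atLeastLessThan]] sum.Sigma[OF finite_lessThan ballI[OF finite_atMost]]
    by (rule sum.reindex_bij_witness[of _ "\<lambda>(m,n). (n,m)" "\<lambda>(m,n). (n,m)"]) auto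
  also have "\<dots> = (\<Sum>m<N. sgl (s + t - int m) ((\<Sum>n\<le>m. ((-1) ^ n * (of_int t gchoose n) * (of_int (t + s - int n) gchoose (m - n)))) *s P m b a))"
    by (simp add: vs.scale_sum_left additive_sum(4)[of "sgl _", OF single_add])
  also have "\<dots> = beta s b t a"
    using gbinomial_alternating_sum[of "of_int t :: 'k" "of_int s"]
    by (subst beta_eq[OF Nb]) simp_all
  finally show ?thesis using 2 unfolding 1 by (simp only:)
qed


lemma sum_single_parity:
  assumes "\<And>i. x i \<in> H r"
  shows "\<forall>k. lk (\<Sum>i\<in>A. sgl (g i) (x i)) k \<in> H r"
  by (induction A rule: infinite_finite_induct)
    (auto simp: H_zero lookup_add lookup_single when_def assms intro!: H_add)

lemma aff_bracket_parity:
  assumes "\<And>k. lk u k \<in> H p" "\<And>k. lk v k \<in> H q"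
  shows "lk (aff_bracket u v) k \<in> H (p + q)"
proof -
  have "\<forall>k. lk (aff_bracket u v) k \<in> H (p + q)"
    using assms(1)
  proof (induction u rule: poly_mapping_induct_on)
    case (single t a)
    note a = this
    show ?case using assms(2)
    proof (induction v rule: poly_mapping_induct_on)
      case (single s b)
      have "\<forall>k. lk (\<Sum>i\<in>A. sgl (t + s - int i) ((of_int t gchoose i) *s P i a b)) k \<in> H (p + q)" for A
        by (rule sum_single_parity) (intro H_sc H_P a single)
      then show ?case by (simp add: aff_bracket_single beta_def)
    qed (auto simp: aff_bracket_add_right lookup_add H_zero H_add aff_bracket_sum_right)
  qed (auto simp: aff_bracket_add_left lookup_add H_zero H_add aff_bracket_sum_left)
  then show ?thesis by blast
qed

lemma aff_bracket_skew:
  assumes "\<And>k. lk u k \<in> H p" "\<And>k. lk v k \<in> H q"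
  shows "aff_bracket u v \<approx> (- parity_sign p q) *m aff_bracket v u"
  using assms(1)
proof (induction u rule: poly_mapping_induct_on)
  case (single t a)
  note a = this
  show ?case using assms(2)
  proof (induction v rule: poly_mapping_induct_on)
    case (single s b)
    then show ?case using beta_skew[OF a] by (simp add: aff_bracket_single)
  qed (auto simp: aff_bracket_add_right aff_bracket_add_left aff_scale_add aff_bracket_sum_right aff_bracket_sum_left aff_scale_sum intro: cong_add)
qed (auto simp: aff_bracket_add_right aff_bracket_add_left aff_scale_add aff_bracket_sum_right aff_bracket_sum_left aff_scale_sum intro: cong_add)

section \<open>The Jacobi identity\<close>

lemma P_P_bound:
  "\<exists>N. \<forall>i j. i \<ge> N \<or> j \<ge> N \<longrightarrow> P j (P i a b) d = 0 \<and> P j d (P i a b) = 0"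
proof -
  obtain M where M: "\<And>i. i \<ge> M \<Longrightarrow> P i a b = 0" using P_bound[of a b] by blast
  have "\<exists>K. \<forall>j\<ge>K. P j x d = 0 \<and> P j d x = 0" for x
    using P_bound[of x d] P_bound[of d x] by (metis nat_le_linear order_trans)
  then obtain K where K: "\<And>x j. j \<ge> K x \<Longrightarrow> P j x d = 0 \<and> P j d x = 0" by metis
  \<comment> \<open>The sum dominates the bound of every \<open>P i a b\<close> with
    \<open>i < M\<close>, and beyond \<open>M\<close> the inner product is zero; so \<open>N\<close>
    works uniformly in both indices.\<close>
  define N where "N = M + (\<Sum>i<M. K (P i a b))"
  have *: "P j (P i a b) d = 0 \<and> P j d (P i a b) = 0" if "i \<ge> N \<or> j \<ge> N" for i j
  proof (cases "i \<ge> M")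
    case False
    then have "K (P i a b) \<le> (\<Sum>i<M. K (P i a b))" by (intro member_le_sum) auto
    then have "j \<ge> K (P i a b)" using False that by (auto simp: N_def)
    then show ?thesis by (rule K)
  qed (simp add: M)
  show ?thesis by (rule exI[of _ N]) (use * in blast)
qed

text \<open>Terms with the same \<open>i + j\<close> belong to the same power of \<open>x\<close>,
  so the square is regrouped by antidiagonals. The triangle \<open>i + j < 2 * N\<close> contains
  the square, and \<open>g\<close> vanishes on the rest of it.\<close>

lemma sum_square_diagonals:
  fixes g :: "nat \<Rightarrow> nat \<Rightarrow> 'b::comm_monoid_add"
  assumes "\<And>i j. i \<ge> N \<or> j \<ge> N \<Longrightarrow> g i j = 0"
  shows "(\<Sum>i<N. \<Sum>j<N. g i j) = (\<Sum>n<2 * N. \<Sum>i\<le>n. g i (n - i))"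
proof -
  have "(\<Sum>i<N. \<Sum>j<N. g i j) = (\<Sum>(i,j)\<in>{..<N} \<times> {..<N}. g i j)"
    by (simp add: sum.cartesian_product)
  also have "\<dots> = (\<Sum>(i,j)\<in>{(i,j). i + j < 2 * N}. g i j)"
  proof (rule sum.mono_neutral_left)
    show "finite {(i,j). i + j < 2 * N}"
      by (rule finite_subset[of _ "{..<2 * N} \<times> {..<2 * N}"]) auto
    show "{..<N} \<times> {..<N} \<subseteq> {(i,j). i + j < 2 * N}" by auto
    show "\<forall>x\<in>{(i,j). i + j < 2 * N} - {..<N} \<times> {..<N}. (case x of (i,j) \<Rightarrow> g i j) = 0"
    proof
      fix x assume "x \<in> {(i,j). i + j < 2 * N} - {..<N} \<times> {..<N}"
      then have "fst x \<ge> N \<or> snd x \<ge> N" by (auto simp: not_less)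
      then show "(case x of (i,j) \<Rightarrow> g i j) = 0" by (simp add: assms split_beta)
    qed
  qed
  finally show ?thesis by (simp add: sum.triangle_reindex)
qed

text \<open>With \<open>l = i - k\<close> fixed, trinomial revision splits off the factor
  \<open>t gchoose l\<close>. The remaining sum over \<open>k\<close> is
  \<open>gbinomial_alternating_sum\<close> with \<open>x = t - l\<close> and
  \<open>m = n - l\<close>. In the Jacobi identity the left side comes from the products
  \<open>(a_i b)_j d\<close> with \<open>i + j = n\<close>, and the right side from the iterated
  actions of \<open>a\<close> and \<open>b\<close> on \<open>d\<close>.\<close>

lemma jacobi_coefficient:
  fixes E :: "nat \<Rightarrow> nat \<Rightarrow> 'w" and t s :: 'k
  shows "(\<Sum>i\<le>n. ((t gchoose i) * ((t + s - of_nat i) gchoose (n - i))) *s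
      (\<Sum>k\<le>i. ((-1) ^ k * of_nat (i choose k)) *s E (i - k) (n - i + k)))
    = (\<Sum>l\<le>n. ((t gchoose l) * (s gchoose (n - l))) *s E l (n - l))"
proof -
  have "(\<Sum>i\<le>n. ((t gchoose i) * ((t + s - of_nat i) gchoose (n - i))) *s
      (\<Sum>k\<le>i. ((-1) ^ k * of_nat (i choose k)) *s E (i - k) (n - i + k)))
    = (\<Sum>i\<le>n. \<Sum>k\<le>i. (((t gchoose i) * ((t + s - of_nat i) gchoose (n - i))) * ((-1) ^ k * of_nat (i choose k))) *s E (i - k) (n - i + k))"
    by (simp add: vs.scale_sum_right)
  also have "\<dots> = (\<Sum>l\<le>n. \<Sum>k\<le>n - l. (((t gchoose (l + k)) * ((t + s - of_nat (l + k)) gchoose (n - (l + k)))) * ((-1) ^ k * of_nat ((l + k) choose k))) *s E l (n - l))"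
    unfolding sum.Sigma[OF finite_atMost ballI[OF finite_atMost]]
    by (rule sum.reindex_bij_witness[of _ "\<lambda>(l,k). (l + k, k)" "\<lambda>(i,k). (i - k, k)"]) (auto simp: Suc_diff_le)
  also have "\<dots> = (\<Sum>l\<le>n. ((t gchoose l) * (s gchoose (n - l))) *s E l (n - l))"
  proof (intro sum.cong HOL.refl)
    fix l assume "l \<in> {..n}"
    have "(\<Sum>k\<le>n - l. ((t gchoose (l + k)) * ((t + s - of_nat (l + k)) gchoose (n - (l + k)))) * ((-1) ^ k * of_nat ((l + k) choose k)))
       = (\<Sum>k\<le>n - l. (t gchoose l) * ((-1) ^ k * ((t - of_nat l) gchoose k) * ((t - of_nat l + s - of_nat k) gchoose (n - l - k))))"
    proof (intro sum.cong HOL.refl)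
      fix k
      have "(t gchoose (l + k)) * of_nat ((l + k) choose k) = (t gchoose l) * ((t - of_nat l) gchoose k)"
        using gbinomial_trinomial_revision[of l "l + k" t] binomial_symmetric[of k "l + k"]
        by (simp add: binomial_gbinomial[of "l + k" l, symmetric] flip: of_nat_add) 
      then show "((t gchoose (l + k)) * ((t + s - of_nat (l + k)) gchoose (n - (l + k)))) * ((-1) ^ k * of_nat ((l + k) choose k))
        = (t gchoose l) * ((-1) ^ k * ((t - of_nat l) gchoose k) * ((t - of_nat l + s - of_nat k) gchoose (n - l - k)))"
        by (simp add: algebra_simps)
    qed
    also have "\<dots> = (t gchoose l) * (s gchoose (n - l))"
      unfolding sum_distrib_left[symmetric] gbinomial_alternating_sum ..
    finally show "(\<Sum>k\<le>n - l. (((t gchoose (l + k)) * ((t + s - of_nat (l + k)) gchoose (n - (l + k)))) * ((-1) ^ k * of_nat ((l + k) choose k))) *s E l (n - l))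
      = ((t gchoose l) * (s gchoose (n - l))) *s E l (n - l)"
      by (simp flip: vs.scale_sum_left)
  qed
  finally show ?thesis .
qed

text \<open>The Jacobi axiom for \<open>P\<close> contains no power of \<open>T\<close>, so nothing
  is integrated by parts and the identity is exact.\<close>

lemma beta_jacobi:
  assumes a: "a \<in> H p" and b: "b \<in> H q"
  shows "aff_bracket (beta t a s b) (sgl r d)
    = aff_bracket (sgl t a) (beta s b r d) - parity_sign p q *m aff_bracket (sgl s b) (beta t a r d)"
proof -
  let ?z = "parity_sign p q :: 'k"
  obtain N1 where N1: "\<forall>i j. i \<ge> N1 \<or> j \<ge> N1 \<longrightarrow> P j (P i a b) d = 0 \<and> P j d (P i a b) = 0"
    using P_P_bound[of a b d] by (rule exE)
  obtain N2 where N2: "\<forall>i j. i \<ge> N2 \<or> j \<ge> N2 \<longrightarrow> P j (P i b d) a = 0 \<and> P j a (P i b d) = 0"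
    using P_P_bound[of b d a] by (rule exE)
  obtain N3 where N3: "\<forall>i j. i \<ge> N3 \<or> j \<ge> N3 \<longrightarrow> P j (P i a d) b = 0 \<and> P j b (P i a d) = 0"
    using P_P_bound[of a d b] by (rule exE)
  obtain N4 where N4: "\<And>i. i \<ge> N4 \<Longrightarrow> P i a b = 0" using P_bound[of a b] by blast
  obtain N5 where N5: "\<And>i. i \<ge> N5 \<Longrightarrow> P i b d = 0" using P_bound[of b d] by blast
  obtain N6 where N6: "\<And>i. i \<ge> N6 \<Longrightarrow> P i a d = 0" using P_bound[of a d] by blast
  define N where "N = Max {N1, N2, N3, N4, N5, N6}"
  have N: "N1 \<le> N" "N2 \<le> N" "N3 \<le> N" "N4 \<le> N" "N5 \<le> N" "N6 \<le> N" by (auto simp: N_def)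
  have f0: "P j (P i a b) d = 0" "P j a (P i b d) = 0" "P j b (P i a d) = 0" if "i \<ge> N \<or> j \<ge> N" for i j
  proof -
    have "N1 \<le> i \<or> N1 \<le> j" "N2 \<le> i \<or> N2 \<le> j" "N3 \<le> i \<or> N3 \<le> j"
      using that N by linarith+
    then show "P j (P i a b) d = 0" "P j a (P i b d) = 0" "P j b (P i a d) = 0"
      using N1 N2 N3 by blast+
  qed
  have b0: "P i a b = 0" "P i b d = 0" "P i a d = 0" if "i \<ge> N" for i
    using N4[of i] N5[of i] N6[of i] that N by auto
  \<comment> \<open>Both sums in \<open>P_jacobi\<close> carry the same coefficients and the same
    pair of indices \<open>(i - k, j + k)\<close>. They merge into one sum over the supercommutator
    \<open>E\<close> of the actions of \<open>a\<close> and \<open>b\<close> on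
    \<open>d\<close>.\<close>
  define E where "E l m = P l a (P m b d) - ?z *s P m b (P l a d)" for l m
  have E: "P (n - i) (P i a b) d = (\<Sum>k\<le>i. ((-1) ^ k * of_nat (i choose k)) *s E (i - k) (n - i + k))" for n i
    unfolding P_jacobi[OF a b] E_def
    by (simp add: vs.scale_right_diff_distrib sum_subtractf vs.scale_sum_right mult.commute mult.left_commute)
  have B1: "beta t' (P i a b) r d = (\<Sum>j<N. sgl (t' + r - int j) ((of_int t' gchoose j) *s P j (P i a b) d))" for t' i
    by (rule beta_eq) (simp add: f0)
  have B2: "beta t a s' (P i b d) = (\<Sum>j<N. sgl (t + s' - int j) ((of_int t gchoose j) *s P j a (P i b d)))" for s' i
    by (rule beta_eq) (simp add: f0)
  have B3: "beta s b t' (P i a d) = (\<Sum>j<N. sgl (s + t' - int j) ((of_int s gchoose j) *s P j b (P i a d)))" for t' i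
    by (rule beta_eq) (simp add: f0)
  note sums = additive_sum(4)[of "sgl _", OF single_add]
  have "aff_bracket (beta t a s b) (sgl r d)
      = (\<Sum>i<N. \<Sum>j<N. sgl (t + s + r - int (i + j)) (((of_int t gchoose i) * (of_int (t + s - int i) gchoose j)) *s P j (P i a b) d))"
    by (subst beta_eq[OF b0(1)], assumption)
      (simp add: aff_bracket_sum_left aff_bracket_single beta_sc B1 aff_scale_sum aff_scale_single algebra_simps)
  also have "\<dots> = (\<Sum>n<2 * N. \<Sum>i\<le>n. sgl (t + s + r - int n) (((of_int t gchoose i) * (of_int (t + s - int i) gchoose (n - i))) *s P (n - i) (P i a b) d))"
    by (subst sum_square_diagonals) (auto simp: f0)
  also have "\<dots> = (\<Sum>n<2 * N. sgl (t + s + r - int n) (\<Sum>i\<le>n. ((of_int t gchoose i) * ((of_int t + of_int s - of_nat i) gchoose (n - i))) *s P (n - i) (P i a b) d))"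
    by (simp add: sums)
  also have "\<dots> = (\<Sum>n<2 * N. sgl (t + s + r - int n) (\<Sum>l\<le>n. ((of_int t gchoose l) * (of_int s gchoose (n - l))) *s E l (n - l)))"
    unfolding E jacobi_coefficient ..
  also have "\<dots> = (\<Sum>n<2 * N. \<Sum>l\<le>n. sgl (t + s + r - int n) (((of_int t gchoose l) * (of_int s gchoose (n - l))) *s E l (n - l)))"
    by (simp add: sums)
  also have "\<dots> = (\<Sum>l<N. \<Sum>m<N. sgl (t + s + r - int (l + m)) (((of_int t gchoose l) * (of_int s gchoose m)) *s E l m))"
    by (subst sum_square_diagonals) (auto simp: E_def f0)
  also have "\<dots> = (\<Sum>l<N. \<Sum>m<N. sgl (t + s + r - int (l + m)) (((of_int t gchoose l) * (of_int s gchoose m)) *s P l a (P m b d)))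
     - ?z *m (\<Sum>l<N. \<Sum>m<N. sgl (t + s + r - int (l + m)) (((of_int t gchoose l) * (of_int s gchoose m)) *s P m b (P l a d)))"
    unfolding E_def by (simp add: aff_scale_sum aff_scale_single single_diff vs.scale_right_diff_distrib sum_subtractf mult.commute mult.left_commute)
  finally have *: "aff_bracket (beta t a s b) (sgl r d) = (\<Sum>l<N. \<Sum>m<N. sgl (t + s + r - int (l + m)) (((of_int t gchoose l) * (of_int s gchoose m)) *s P l a (P m b d)))
     - ?z *m (\<Sum>l<N. \<Sum>m<N. sgl (t + s + r - int (l + m)) (((of_int t gchoose l) * (of_int s gchoose m)) *s P m b (P l a d)))" .
  have "(\<Sum>l<N. \<Sum>m<N. sgl (t + s + r - int (l + m)) (((of_int t gchoose l) * (of_int s gchoose m)) *s P l a (P m b d)))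
     = aff_bracket (sgl t a) (beta s b r d)"
    by (subst beta_eq[OF b0(2)], assumption, subst sum.swap)
      (simp add: aff_bracket_sum_right aff_bracket_single beta_sc B2 aff_scale_sum aff_scale_single algebra_simps)
  moreover have "(\<Sum>l<N. \<Sum>m<N. sgl (t + s + r - int (l + m)) (((of_int t gchoose l) * (of_int s gchoose m)) *s P m b (P l a d)))
     = aff_bracket (sgl s b) (beta t a r d)"
    by (subst beta_eq[OF b0(3)], assumption)
      (simp add: aff_bracket_sum_right aff_bracket_single beta_sc B3 aff_scale_sum aff_scale_single algebra_simps)
  ultimately show ?thesis using * by (simp only:)
qed

text \<open>Only \<open>u\<close> and \<open>v\<close> carry parities, so they are reduced to
  monomials with homogeneous coefficients; \<open>w\<close> is arbitrary and is reduced by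
  additivity alone.\<close>

lemma aff_bracket_jacobi:
  assumes u: "\<And>k. lk u k \<in> H p" and v: "\<And>k. lk v k \<in> H q"
  shows "aff_bracket (aff_bracket u v) w = aff_bracket u (aff_bracket v w) - parity_sign p q *m aff_bracket v (aff_bracket u w)"
  using u
proof (induction u rule: poly_mapping_induct_on)
  case (single t a)
  note a = this
  show ?case using v
  proof (induction v rule: poly_mapping_induct_on)
    case (single s b)
    show ?case
      by (rule poly_mapping_additive_eq[of "aff_bracket _"])
        (auto simp: aff_bracket_add_right aff_scale_add aff_bracket_single beta_jacobi[OF a single])
  qed (auto simp: aff_bracket_add_right aff_bracket_add_left aff_scale_add aff_bracket_sum_right aff_bracket_sum_left aff_scale_sum)
qed (auto simp: aff_bracket_add_right aff_bracket_add_left aff_scale_add aff_bracket_sum_right aff_bracket_sum_left aff_scale_sum)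

end

section \<open>Realizing a vertex Lie algebra by total operations\<close>

lemma scalars_simps [simp]:
  "carrier (scalars :: 'k::field_char_0 ring) = UNIV"
  "\<one>\<^bsub>scalars\<^esub> = (1 :: 'k)" "\<zero>\<^bsub>scalars\<^esub> = (0 :: 'k)"
  "x \<otimes>\<^bsub>scalars\<^esub> y = x * (y :: 'k)" "x \<oplus>\<^bsub>scalars\<^esub> y = x + (y :: 'k)"
  by (simp_all add: scalars_def)

lemma cring_scalars: "cring (scalars :: 'k::field_char_0 ring)"
proof (rule cringI)
  show "abelian_group (scalars :: 'k ring)"
    by (rule abelian_groupI) (auto simp: algebra_simps intro: exI[of _ "- x" for x])
  show "Group.comm_monoid (scalars :: 'k ring)"
    by (rule comm_monoidI) (auto simp: algebra_simps)
qed (simp add: algebra_simps)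

lemma uminus_scalars [simp]: "\<ominus>\<^bsub>scalars\<^esub> x = - (x :: 'k::field_char_0)"
proof -
  interpret cring "scalars :: 'k ring" by (rule cring_scalars)
  show ?thesis using l_neg[of x] by (simp add: eq_neg_iff_add_eq_0)
qed

lemma vector_space_coeffwise: "vector_space (\<lambda>c. coeffwise ((*) (c :: 'k::field)) :: ('i \<Rightarrow>\<^sub>0 'k) \<Rightarrow> _)"
  by unfold_locales (auto intro!: poly_mapping_eqI simp: lookup_coeffwise lookup_add algebra_simps)

text \<open>A left inverse of the identity on \<open>N\<close>, extended to the whole space with
  values in \<open>N\<close>, is a projection. Applied to the kernel of an evaluation map it yields
  a linear section.\<close>

lemma (in vector_space) linear_projection_exists:
  assumes "subspace N"
  obtains g where "Vector_Spaces.linear scale scale g" "\<And>x. g x \<in> N" "\<And>x. x \<in> N \<Longrightarrow> g x = x"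
proof -
  interpret pair: vector_space_pair scale scale ..
  have "\<exists>g. g ` UNIV \<subseteq> N \<and> Vector_Spaces.linear scale scale g \<and> (\<forall>v\<in>N. g (id v) = v)"
    by (rule pair.linear_exists_left_inverse_on[OF linear_id assms]) simp
  then show thesis using that by auto
qed

lemma (in superspace) scalar_simps [simp]:
  "x \<in> carrier V \<Longrightarrow> c \<odot> x \<in> carrier V"
  "x \<in> carrier V \<Longrightarrow> 0 \<odot> x = \<zero>" "c \<odot> \<zero> = \<zero>" "x \<in> carrier V \<Longrightarrow> 1 \<odot> x = x"
  using smult_closed[of c x] smult_l_null[of x] smult_r_null[of c] smult_one[of x] by simp_all

lemma (in superspace) scalar_distrib:
  "x \<in> carrier V \<Longrightarrow> (c + d) \<odot> x = c \<odot> x \<oplus> d \<odot> x"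
  "x \<in> carrier V \<Longrightarrow> y \<in> carrier V \<Longrightarrow> c \<odot> (x \<oplus> y) = c \<odot> x \<oplus> c \<odot> y"
  "x \<in> carrier V \<Longrightarrow> (c * d) \<odot> x = c \<odot> (d \<odot> x)"
  "x \<in> carrier V \<Longrightarrow> (- c) \<odot> x = \<ominus> (c \<odot> x)"
  using smult_l_distr[of c d x] smult_r_distr[of c x y] smult_assoc1[of c d x] smult_l_minus[of c x]
  by simp_all

lemma (in superspace) homogD: "x \<in> homog V p \<Longrightarrow> x \<in> carrier V"
  using submoduleE(1)[OF homog_submodule] by blast

lemma (in superspace) homog_closed [simp]:
  "\<zero> \<in> homog V p" "x \<in> homog V p \<Longrightarrow> y \<in> homog V p \<Longrightarrow> x \<oplus> y \<in> homog V p"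
  "x \<in> homog V p \<Longrightarrow> c \<odot> x \<in> homog V p" "x \<in> homog V p \<Longrightarrow> \<ominus> x \<in> homog V p"
proof -
  interpret submodule "homog V p" scalars V by (rule homog_submodule)
  show "\<zero> \<in> homog V p" using one_closed by simp
  show "x \<in> homog V p \<Longrightarrow> y \<in> homog V p \<Longrightarrow> x \<oplus> y \<in> homog V p" using m_closed[of x y] by simp
  show "x \<in> homog V p \<Longrightarrow> c \<odot> x \<in> homog V p" using smult_closed[of c x] by simp
  show "x \<in> homog V p \<Longrightarrow> \<ominus> x \<in> homog V p" using m_inv_closed[of x] by (simp add: a_inv_def)
qed

lemma (in superspace) homog_decomp:
  assumes "x \<in> carrier V"
  obtains y z where "y \<in> homog V 0" "z \<in> homog V 1" "x = y \<oplus> z"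
  using assms homog_span by (auto simp: set_add_def')

lemma (in superspace) homog_inter:
  assumes "x \<in> homog V p" "x \<in> homog V q" "p \<noteq> q"
  shows "x = \<zero>"
  using assms homog_disjoint by (cases p; cases q) auto

lemma additive_finsum:
  fixes f :: "'a \<Rightarrow> 'b::ab_group_add"
  assumes "abelian_monoid V"
    and "\<And>x y. x \<in> carrier V \<Longrightarrow> y \<in> carrier V \<Longrightarrow> f (x \<oplus>\<^bsub>V\<^esub> y) = f x + f y"
    and "finite A" "g \<in> A \<rightarrow> carrier V"
  shows "f (\<Oplus>\<^bsub>V\<^esub>i\<in>A. g i) = (\<Sum>i\<in>A. f (g i))"
proof -
  interpret abelian_monoid V by (rule assms)
  have 0: "f \<zero>\<^bsub>V\<^esub> = 0" using assms(2)[of "\<zero>\<^bsub>V\<^esub>" "\<zero>\<^bsub>V\<^esub>"] by simp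
  from assms(3,4) show ?thesis
    by induction (use 0 assms(2) in \<open>auto simp: finsum_insert Pi_iff finsum_closed\<close>)
qed

text \<open>A module is a retract of the free vector space on its underlying type: the evaluation map splits linearly.\<close>

lemma module_embedding:
  fixes V :: "('k::field_char_0, 'a, 'm) module_scheme"
  assumes "Module.module scalars V"
  obtains emb :: "'a \<Rightarrow> ('a \<Rightarrow>\<^sub>0 'k)" and q :: "('a \<Rightarrow>\<^sub>0 'k) \<Rightarrow> 'a"
  where "\<And>w. q w \<in> carrier V" "\<And>w w'. q (w + w') = q w \<oplus>\<^bsub>V\<^esub> q w'"
    "\<And>c w. q (coeffwise ((*) c) w) = c \<odot>\<^bsub>V\<^esub> q w"
    "\<And>a b. a \<in> carrier V \<Longrightarrow> b \<in> carrier V \<Longrightarrow> emb (a \<oplus>\<^bsub>V\<^esub> b) = emb a + emb b"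
    "\<And>c a. a \<in> carrier V \<Longrightarrow> emb (c \<odot>\<^bsub>V\<^esub> a) = coeffwise ((*) c) (emb a)"
    "\<And>a. a \<in> carrier V \<Longrightarrow> q (emb a) = a"
proof -
  interpret V: Module.module scalars V by (rule assms)
  interpret vs: vector_space "\<lambda>c. coeffwise ((*) (c :: 'k)) :: ('a \<Rightarrow>\<^sub>0 'k) \<Rightarrow> _"
    by (rule vector_space_coeffwise)
  \<comment> \<open>Labels outside the carrier are skipped, so evaluation is total and always lands
    in the carrier.\<close>
  define q where "q w = (\<Oplus>\<^bsub>V\<^esub>a\<in>Poly_Mapping.keys w \<inter> carrier V. lk w a \<odot>\<^bsub>V\<^esub> a)" for w :: "'a \<Rightarrow>\<^sub>0 'k"
  have q_eq: "q w = (\<Oplus>\<^bsub>V\<^esub>a\<in>A. lk w a \<odot>\<^bsub>V\<^esub> a)"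
    if "finite A" "A \<subseteq> carrier V" "Poly_Mapping.keys w \<inter> carrier V \<subseteq> A" for w A
    unfolding q_def
    by (rule V.add.finprod_mono_neutral_cong_left) (use that in \<open>auto simp: in_keys_iff V.smult_l_null[simplified]\<close>)
  have q_closed: "q w \<in> carrier V" for w
    unfolding q_def by (rule V.finsum_closed) auto
  have q_add: "q (w + w') = q w \<oplus>\<^bsub>V\<^esub> q w'" for w w'
  proof -
    let ?A = "(Poly_Mapping.keys w \<union> Poly_Mapping.keys w') \<inter> carrier V"
    have "q (w + w') = (\<Oplus>\<^bsub>V\<^esub>a\<in>?A. lk (w + w') a \<odot>\<^bsub>V\<^esub> a)"
      by (rule q_eq) (use Poly_Mapping.keys_add[of w w'] in auto)
    also have "\<dots> = (\<Oplus>\<^bsub>V\<^esub>a\<in>?A. (lk w a \<odot>\<^bsub>V\<^esub> a) \<oplus>\<^bsub>V\<^esub> (lk w' a \<odot>\<^bsub>V\<^esub> a))"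
      by (rule V.finsum_cong') (auto simp: lookup_add V.smult_l_distr[simplified])
    also have "\<dots> = (\<Oplus>\<^bsub>V\<^esub>a\<in>?A. lk w a \<odot>\<^bsub>V\<^esub> a) \<oplus>\<^bsub>V\<^esub> (\<Oplus>\<^bsub>V\<^esub>a\<in>?A. lk w' a \<odot>\<^bsub>V\<^esub> a)"
      by (rule V.finsum_addf) auto
    also have "(\<Oplus>\<^bsub>V\<^esub>a\<in>?A. lk w a \<odot>\<^bsub>V\<^esub> a) = q w" by (rule q_eq[symmetric]) auto
    also have "(\<Oplus>\<^bsub>V\<^esub>a\<in>?A. lk w' a \<odot>\<^bsub>V\<^esub> a) = q w'" by (rule q_eq[symmetric]) auto
    finally show ?thesis .
  qed
  have q_sc: "q (coeffwise ((*) c) w) = c \<odot>\<^bsub>V\<^esub> q w" for c w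
  proof -
    have "q (coeffwise ((*) c) w) = (\<Oplus>\<^bsub>V\<^esub>a\<in>Poly_Mapping.keys w \<inter> carrier V. lk (coeffwise ((*) c) w) a \<odot>\<^bsub>V\<^esub> a)"
      by (rule q_eq) (auto simp: lookup_coeffwise in_keys_iff)
    also have "\<dots> = (\<Oplus>\<^bsub>V\<^esub>a\<in>Poly_Mapping.keys w \<inter> carrier V. c \<odot>\<^bsub>V\<^esub> (lk w a \<odot>\<^bsub>V\<^esub> a))"
      by (rule V.finsum_cong') (auto simp: lookup_coeffwise V.smult_assoc1[simplified])
    also have "\<dots> = c \<odot>\<^bsub>V\<^esub> q w"
      unfolding q_def by (rule V.finsum_smult_ldistr[symmetric]) auto
    finally show ?thesis .
  qed
  have q_single: "q (sgl a 1) = a" if "a \<in> carrier V" for a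
    using that by (subst q_eq[of "{a}"]) (auto simp: V.finsum_singleton V.smult_one[simplified])
  have q0: "q 0 = \<zero>\<^bsub>V\<^esub>" by (simp add: q_def)
  have q_minus: "q (w - w') = q w \<ominus>\<^bsub>V\<^esub> q w'" for w w'
    using q_add[of "w - w'" w'] q_closed by (simp add: V.minus_eq V.a_assoc V.r_neg)
  define N where "N = {w. q w = \<zero>\<^bsub>V\<^esub>}"
  have "vs.subspace N"
    by (rule vs.subspaceI) (auto simp: N_def q0 q_add q_sc)
  then obtain g where g: "Vector_Spaces.linear (\<lambda>c. coeffwise ((*) c)) (\<lambda>c. coeffwise ((*) c)) g"
    "\<And>x. g x \<in> N" "\<And>x. x \<in> N \<Longrightarrow> g x = x"
    using vs.linear_projection_exists by blast
  interpret g: Vector_Spaces.linear "\<lambda>c. coeffwise ((*) c)" "\<lambda>c. coeffwise ((*) c)" g by (rule g)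
  \<comment> \<open>\<open>f\<close> vanishes on the kernel \<open>N\<close> and moves each vector
    only within its coset. It therefore depends on \<open>q x\<close> alone, and this makes
    \<open>emb\<close> linear although \<open>sgl a 1\<close> is not linear in
    \<open>a\<close>.\<close>
  define f where "f x = x - g x" for x
  have f_eq: "f x = f y" if "q x = q y" for x y
  proof -
    have "x - y \<in> N" using that q_closed by (simp add: N_def q_minus V.minus_eq V.r_neg)
    then have "g x - g y = x - y" using g(3) by (simp flip: g.diff)
    then show ?thesis by (simp add: f_def algebra_simps)
  qed
  have qf: "q (f x) = q x" for x
    using g(2)[of x] q_closed by (simp add: f_def N_def q_minus V.minus_eq)
  define emb where "emb a = f (sgl a 1)" for a
  show thesis
  proof (rule that[of q emb])
    fix a b assume ab: "a \<in> carrier V" "b \<in> carrier V"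
    show "emb (a \<oplus>\<^bsub>V\<^esub> b) = emb a + emb b"
      proof -
      have "f (sgl (a \<oplus>\<^bsub>V\<^esub> b) 1) = f (sgl a 1 + sgl b 1)"
        by (rule f_eq) (use ab in \<open>simp add: q_add q_single\<close>)
      then show ?thesis by (simp add: emb_def f_def g.add)
    qed
  next
    fix c a assume a: "a \<in> carrier V"
    show "emb (c \<odot>\<^bsub>V\<^esub> a) = coeffwise ((*) c) (emb a)"
      proof -
      have "f (sgl (c \<odot>\<^bsub>V\<^esub> a) 1) = f (coeffwise ((*) c) (sgl a 1))"
        by (rule f_eq) (use a in \<open>simp add: q_sc q_single\<close>)
      then show ?thesis by (simp add: emb_def f_def g.scale vs.scale_right_diff_distrib)
    qed
  next
    fix a assume "a \<in> carrier V"
    then show "q (emb a) = a" by (simp add: emb_def qf q_single)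
  qed (simp_all add: q_closed q_add q_sc)
qed


section \<open>Laurent polynomials with coefficients in a superspace\<close>

context superspace
begin

lemma laurent_simps:
  "carrier (laurent V) = {v. (\<forall>t. v t \<in> carrier V) \<and> finite {t. v t \<noteq> \<zero>}}"
  "\<zero>\<^bsub>laurent V\<^esub> = (\<lambda>t. \<zero>)" "u \<oplus>\<^bsub>laurent V\<^esub> v = (\<lambda>t. u t \<oplus> v t)"
  "c \<odot>\<^bsub>laurent V\<^esub> v = (\<lambda>t. c \<odot> v t)"
  "homog (laurent V) p = {v. (\<forall>t. v t \<in> homog V p) \<and> finite {t. v t \<noteq> \<zero>}}"
  by (simp_all add: laurent_def)

lemma laurent_homog_carrier: "u \<in> homog (laurent V) p \<Longrightarrow> u \<in> carrier (laurent V)"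
  by (auto simp: laurent_simps intro: homogD)

lemma laurentD: "v \<in> carrier (laurent V) \<Longrightarrow> v t \<in> carrier V"
  by (simp add: laurent_simps)

lemma laurent_finite_add:
  assumes "finite {t. u t \<noteq> \<zero>}" "finite {t. v t \<noteq> \<zero>}"
  shows "finite {t. u t \<oplus> v t \<noteq> \<zero>}"
  by (rule finite_subset[of _ "{t. u t \<noteq> \<zero>} \<union> {t. v t \<noteq> \<zero>}"]) (use assms in auto)

lemma laurent_closed [simp]:
  "u \<in> carrier (laurent V) \<Longrightarrow> v \<in> carrier (laurent V) \<Longrightarrow> u \<oplus>\<^bsub>laurent V\<^esub> v \<in> carrier (laurent V)"
  "u \<in> carrier (laurent V) \<Longrightarrow> c \<odot>\<^bsub>laurent V\<^esub> u \<in> carrier (laurent V)"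
  "\<zero>\<^bsub>laurent V\<^esub> \<in> carrier (laurent V)"
  "a \<in> carrier V \<Longrightarrow> monomial V a t \<in> carrier (laurent V)"
proof -
  show "c \<odot>\<^bsub>laurent V\<^esub> u \<in> carrier (laurent V)" if "u \<in> carrier (laurent V)"
  proof -
    have "finite {t. c \<odot> u t \<noteq> \<zero>}"
      by (rule finite_subset[of _ "{t. u t \<noteq> \<zero>}"]) (use that in \<open>auto simp: laurent_simps\<close>)
    then show ?thesis using that by (simp add: laurent_simps)
  qed
  show "monomial V a t \<in> carrier (laurent V)" if "a \<in> carrier V"
  proof -
    have "finite {s. monomial V a t s \<noteq> \<zero>}"
      by (rule finite_subset[of _ "{t}"]) (auto simp: monomial_def)
    then show ?thesis using that by (auto simp: laurent_simps monomial_def)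
  qed
qed (auto simp: laurent_simps laurent_finite_add)

lemma laurent_abelian_group: "abelian_group (laurent V)"
proof (rule abelian_groupI)
  fix u assume u: "u \<in> carrier (laurent V)"
  have "(- 1) \<odot> x \<oplus> x = \<zero>" if "x \<in> carrier V" for x
    using that by (simp add: scalar_distrib l_neg)
  then have "(- 1) \<odot>\<^bsub>laurent V\<^esub> u \<oplus>\<^bsub>laurent V\<^esub> u = \<zero>\<^bsub>laurent V\<^esub>"
    using u by (auto simp: laurent_simps)
  then show "\<exists>v\<in>carrier (laurent V). v \<oplus>\<^bsub>laurent V\<^esub> u = \<zero>\<^bsub>laurent V\<^esub>"
    using u by (intro bexI[of _ "(- 1) \<odot>\<^bsub>laurent V\<^esub> u"]) auto
qed (simp_all, auto simp: laurent_simps a_ac)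

end

lemma laurent_comp:
  assumes v: "v \<in> carrier (laurent V)"
    and f: "\<And>x. x \<in> carrier V \<Longrightarrow> f x \<in> carrier W" "f \<zero>\<^bsub>V\<^esub> = \<zero>\<^bsub>W\<^esub>"
  shows "f \<circ> v \<in> carrier (laurent W)"
proof -
  have "finite {t. f (v t) \<noteq> \<zero>\<^bsub>W\<^esub>}"
    by (rule finite_subset[of _ "{t. v t \<noteq> \<zero>\<^bsub>V\<^esub>}"]) (use v f in \<open>auto simp: laurent_def\<close>)
  then show ?thesis using v f by (simp add: laurent_def)
qed

context vertex_lie_algebra
begin

lemma der_closed [simp]: "a \<in> carrier R \<Longrightarrow> der R a \<in> carrier R"
  and der_add [simp]: "a \<in> carrier R \<Longrightarrow> b \<in> carrier R \<Longrightarrow> der R (a \<oplus> b) = der R a \<oplus> der R b"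
  and der_smult [simp]: "a \<in> carrier R \<Longrightarrow> der R (c \<odot> a) = c \<odot> der R a"
  and der_homog [simp]: "a \<in> homog R p \<Longrightarrow> der R a \<in> homog R p"
  using der_even_linear unfolding even_linear_def by blast+

lemma der_zero [simp]: "der R \<zero> = \<zero>"
  using der_smult[of \<zero> 0] by simp

lemma nprod_props [simp]:
  "a \<in> carrier R \<Longrightarrow> b \<in> carrier R \<Longrightarrow> nprod R n a b \<in> carrier R"
  "a \<in> carrier R \<Longrightarrow> b \<in> carrier R \<Longrightarrow> d \<in> carrier R \<Longrightarrow> nprod R n (a \<oplus> b) d = nprod R n a d \<oplus> nprod R n b d"
  "a \<in> carrier R \<Longrightarrow> b \<in> carrier R \<Longrightarrow> d \<in> carrier R \<Longrightarrow> nprod R n d (a \<oplus> b) = nprod R n d a \<oplus> nprod R n d b"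
  "a \<in> carrier R \<Longrightarrow> b \<in> carrier R \<Longrightarrow> nprod R n (c \<odot> a) b = c \<odot> nprod R n a b"
  "a \<in> carrier R \<Longrightarrow> b \<in> carrier R \<Longrightarrow> nprod R n a (c \<odot> b) = c \<odot> nprod R n a b"
  using nprod_bilinear[of n] by (simp_all add: even_bilinear_def)

lemma nprod_homog: "a \<in> homog R p \<Longrightarrow> b \<in> homog R p' \<Longrightarrow> nprod R n a b \<in> homog R (p + p')"
  using nprod_bilinear[of n] by (simp add: even_bilinear_def)

lemma der_comp_laurent: "v \<in> carrier (laurent R) \<Longrightarrow> der R \<circ> v \<in> carrier (laurent R)"
  by (rule laurent_comp) auto

end

text \<open>\<open>q\<close> retracts a whole type onto the carrier and \<open>emb\<close> is a
  linear section of it. Conjugation with the pair makes the operations total, and the image of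
  \<open>emb\<close> is a faithful copy of the algebra.\<close>

locale embedded_vertex_lie_algebra = vertex_lie_algebra R
  for R :: "('k::field_char_0, 'a, 'm) conformal_scheme" (structure) +
  fixes emb :: "'a \<Rightarrow> ('a \<Rightarrow>\<^sub>0 'k)" and q :: "('a \<Rightarrow>\<^sub>0 'k) \<Rightarrow> 'a"
  assumes q_closed [simp]: "q w \<in> carrier R"
    and q_add: "q (w + w') = q w \<oplus> q w'"
    and q_sc: "q (coeffwise ((*) c) w) = c \<odot> q w"
    and emb_add: "a \<in> carrier R \<Longrightarrow> b \<in> carrier R \<Longrightarrow> emb (a \<oplus> b) = emb a + emb b"
    and emb_sc: "a \<in> carrier R \<Longrightarrow> emb (c \<odot> a) = coeffwise ((*) c) (emb a)"
    and q_emb [simp]: "a \<in> carrier R \<Longrightarrow> q (emb a) = a"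
begin

abbreviation "sc \<equiv> \<lambda>c :: 'k. coeffwise ((*) c) :: ('a \<Rightarrow>\<^sub>0 'k) \<Rightarrow> _"
definition "Tw w = emb (der R (q w))"
definition "Pw n x y = emb (nprod R n (q x) (q y))"
definition "Hw p = emb ` homog R p"

lemma emb_zero [simp]: "emb \<zero> = 0"
  using emb_add[of \<zero> \<zero>] by simp

lemma q_zero [simp]: "q 0 = \<zero>"
  using q_emb[of \<zero>] by simp

lemma emb_eq_0 [simp]: "a \<in> carrier R \<Longrightarrow> emb a = 0 \<longleftrightarrow> a = \<zero>"
  using q_emb[of a] by (auto simp del: q_emb)

lemma emb_minus: "a \<in> carrier R \<Longrightarrow> emb (\<ominus> a) = - emb a"
  using emb_add[of a "\<ominus> a"] by (simp add: r_neg eq_neg_iff_add_eq_0 add.commute)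

lemma emb_finsum: "finite A \<Longrightarrow> g \<in> A \<rightarrow> carrier R \<Longrightarrow> emb (\<Oplus>i\<in>A. g i) = (\<Sum>i\<in>A. emb (g i))"
  by (rule additive_finsum) (auto simp: emb_add abelian_monoid_axioms)

lemma der_power: "a \<in> carrier R \<Longrightarrow> (der R ^^ k) a \<in> carrier R \<and> emb ((der R ^^ k) a) = (Tw ^^ k) (emb a)"
proof (induction k)
  case (Suc k)
  have "Tw (emb x) = emb (der R x)" if "x \<in> carrier R" for x using that by (simp add: Tw_def)
  then show ?case using Suc by (metis der_closed comp_apply funpow.simps(2))
qed simp

lemma emb_subst_difference:
  assumes "\<And>i j. F i j \<in> carrier R"
  shows "emb (subst_difference R F i j) = (\<Sum>k\<le>i. sc ((-1) ^ k * of_nat (i choose k)) (emb (F (i - k) (j + k))))"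
  unfolding subst_difference_def by (subst emb_finsum) (auto simp: assms emb_sc)

lemma subst_difference_closed [simp]:
  assumes "\<And>i j. F i j \<in> carrier R"
  shows "subst_difference R F i j \<in> carrier R"
  unfolding subst_difference_def by (rule finsum_closed) (auto simp: assms)

lemma flipped_bracket:
  assumes "a \<in> carrier R" "b \<in> carrier R"
  shows "flipped_bracket R b a n \<in> carrier R"
    and "emb (flipped_bracket R b a n) = (\<Sum>k | emb (nprod R (n + k) b a) \<noteq> 0.
      sc ((-1) ^ (n + k) / fact k) ((Tw ^^ k) (emb (nprod R (n + k) b a))))"
proof -
  have "finite ((\<lambda>k. n + k) -` {m. nprod R m b a \<noteq> \<zero>})"
    by (rule finite_vimageI[OF nprod_finite[OF assms(2,1)]]) (simp add: inj_def)
  then have fin: "finite {k. nprod R (n + k) b a \<noteq> \<zero>}" by (simp add: vimage_def)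
  show "flipped_bracket R b a n \<in> carrier R"
    unfolding flipped_bracket_def by (rule finsum_closed) (auto simp: der_power assms)
  show "emb (flipped_bracket R b a n) = (\<Sum>k | emb (nprod R (n + k) b a) \<noteq> 0.
      sc ((-1) ^ (n + k) / fact k) ((Tw ^^ k) (emb (nprod R (n + k) b a))))"
    unfolding flipped_bracket_def
    by (subst emb_finsum[OF fin]) (auto simp: der_power assms emb_sc)
qed

text \<open>Between two nested operations \<open>q (emb x)\<close> cancels, so each axiom is the
  image under \<open>emb\<close> of the corresponding axiom of \<open>R\<close>, evaluated at
  \<open>q a\<close>, \<open>q b\<close> and \<open>q d\<close>.\<close>

sublocale M: total_vertex_lie sc Tw Pw Hw
proof
  note vs = vector_space.vector_space_assms[OF vector_space_coeffwise]
  show "sc x (a + b) = sc x a + sc x b" "sc (x + y) a = sc x a + sc y a"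
    "sc x (sc y a) = sc (x * y) a" "sc 1 a = a" for x y a b
    by (simp_all only: vs)
  show "Tw (a + b) = Tw a + Tw b" "Tw (sc c a) = sc c (Tw a)" for a b c
    by (simp_all add: Tw_def q_add q_sc emb_add emb_sc)
  show "Pw n (a + b) d = Pw n a d + Pw n b d" "Pw n a (b + d) = Pw n a b + Pw n a d"
    "Pw n (sc c a) b = sc c (Pw n a b)" "Pw n a (sc c b) = sc c (Pw n a b)" for n a b d c
    by (simp_all add: Pw_def q_add q_sc emb_add emb_sc)
  show "Tw (Pw n a b) = Pw n (Tw a) b + Pw n a (Tw b)" for n a b
    by (simp add: Tw_def Pw_def der_nprod emb_add)
  show "Pw 0 (Tw a) b = 0" for a b
    by (simp add: Tw_def Pw_def nprod_der_0)
  show "Pw (Suc n) (Tw a) b = sc (- of_nat (Suc n)) (Pw n a b)" for n a b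
    by (simp add: Tw_def Pw_def nprod_der_Suc emb_sc del: of_nat_Suc)
  show "finite {n. Pw n a b \<noteq> 0}" for a b
    using nprod_finite[of "q a" "q b"] by (simp add: Pw_def)
  show "Pw j (Pw i a b) d =
        (\<Sum>k\<le>i. sc ((-1) ^ k * of_nat (i choose k)) (Pw (i - k) a (Pw (j + k) b d)))
        - sc (parity_sign p p') (\<Sum>k\<le>i. sc ((-1) ^ k * of_nat (i choose k)) (Pw (j + k) b (Pw (i - k) a d)))"
    if ab: "a \<in> Hw p" "b \<in> Hw p'" for a b p p' i j d
  proof -
    obtain a' b' where a': "a' \<in> homog R p" "a = emb a'" and b': "b' \<in> homog R p'" "b = emb b'"
      using ab by (auto simp: Hw_def)
    note cl = homogD[OF a'(1)] homogD[OF b'(1)]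
    show ?thesis
      using nprod_jacobi[OF a'(1) b'(1), of "q d" j i] cl
      by (simp add: Pw_def a'(2) b'(2) minus_eq emb_add emb_minus emb_sc emb_subst_difference)
  qed
  show "Pw n a b = - sc (parity_sign p p') (\<Sum>k | Pw (n + k) b a \<noteq> 0. sc ((-1) ^ (n + k) / fact k) ((Tw ^^ k) (Pw (n + k) b a)))"
    if ab: "a \<in> Hw p" "b \<in> Hw p'" for a b p p' n
  proof -
    obtain a' b' where a': "a' \<in> homog R p" "a = emb a'" and b': "b' \<in> homog R p'" "b = emb b'"
      using ab by (auto simp: Hw_def)
    note cl = homogD[OF a'(1)] homogD[OF b'(1)]
    show ?thesis
      using cl by (simp only: Pw_def a'(2) b'(2) q_emb nprod_skew[OF a'(1) b'(1)]
         emb_minus emb_sc flipped_bracket scalar_simps)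
  qed
  show "0 \<in> Hw p" for p unfolding Hw_def by (rule image_eqI[of _ _ \<zero>]) auto
  show "a + b \<in> Hw p" if "a \<in> Hw p" "b \<in> Hw p" for a b p
    using that unfolding Hw_def by (auto simp: homogD simp flip: emb_add)
  show "sc c a \<in> Hw p" if "a \<in> Hw p" for a c p
    using that unfolding Hw_def by (auto simp: homogD simp flip: emb_sc)
  show "Pw n a b \<in> Hw (p + p')" if "a \<in> Hw p" "b \<in> Hw p'" for n a b p p'
    using that unfolding Hw_def Pw_def by (auto simp only: homogD q_emb intro!: imageI nprod_homog)
qed

end

section \<open>Normal forms of Lie expressions\<close>

lemma lie_exprs_simps [simp]:
  "Gen v \<in> lie_exprs V \<longleftrightarrow> v \<in> carrier V" "Zero \<in> lie_exprs V"
  "Plus x y \<in> lie_exprs V \<longleftrightarrow> x \<in> lie_exprs V \<and> y \<in> lie_exprs V"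
  "Scale c x \<in> lie_exprs V \<longleftrightarrow> x \<in> lie_exprs V"
  "Bracket x y \<in> lie_exprs V \<longleftrightarrow> x \<in> lie_exprs V \<and> y \<in> lie_exprs V"
  by (auto simp: lie_exprs_def)

declare lie_eq.trans [trans]

lemma lie_eq_Scale_zero:
  assumes "x \<in> lie_exprs V"
  shows "lie_eq V rels (Scale 0 x) Zero"
proof -
  have "lie_eq V rels (Scale 0 x) (Plus (Scale 1 x) (Scale (-1) x))"
    using lie_eq.Scale_add[OF assms, of rels 1 "-1"] by simp
  moreover have "lie_eq V rels \<dots> (Plus x (Scale (-1) x))"
    by (intro lie_eq.cong_Plus lie_eq.Scale_one lie_eq.refl) (auto simp: assms)
  ultimately show ?thesis
    using lie_eq.Plus_inverse[OF assms] by (blast intro: lie_eq.trans)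
qed

lemma lie_eq_Bracket_Zero:
  assumes "x \<in> lie_exprs V"
  shows "lie_eq V rels (Bracket Zero x) Zero" "lie_eq V rels (Bracket x Zero) Zero"
proof -
  \<comment> \<open>Written as a multiple by the scalar 0, \<open>Zero\<close> can be pulled out of
    either side of a bracket.\<close>
  have *: "lie_eq V rels Zero (Scale 0 Zero)"
    by (rule lie_eq.sym[OF lie_eq_Scale_zero]) simp
  have "lie_eq V rels (Bracket Zero x) (Bracket (Scale 0 Zero) x)"
    by (intro lie_eq.cong_Bracket * lie_eq.refl assms)
  also have "lie_eq V rels \<dots> (Scale 0 (Bracket Zero x))"
    by (rule lie_eq.Bracket_Scale_left) (auto simp: assms)
  also have "lie_eq V rels \<dots> Zero"
    by (rule lie_eq_Scale_zero) (simp add: assms)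
  finally show "lie_eq V rels (Bracket Zero x) Zero" .
  have "lie_eq V rels (Bracket x Zero) (Bracket x (Scale 0 Zero))"
    by (intro lie_eq.cong_Bracket * lie_eq.refl assms)
  also have "lie_eq V rels \<dots> (Scale 0 (Bracket x Zero))"
    by (rule lie_eq.Bracket_Scale_right) (auto simp: assms)
  also have "lie_eq V rels \<dots> Zero"
    by (rule lie_eq_Scale_zero) (simp add: assms)
  finally show "lie_eq V rels (Bracket x Zero) Zero" .
qed

lemma (in superspace) lie_eq_Gen_zero: "lie_eq (laurent V) rels (Gen \<zero>\<^bsub>laurent V\<^esub>) Zero"
proof -
  have "lie_eq (laurent V) rels (Gen (0 \<odot>\<^bsub>laurent V\<^esub> \<zero>\<^bsub>laurent V\<^esub>)) (Scale 0 (Gen \<zero>\<^bsub>laurent V\<^esub>))"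
    by (rule lie_eq.Gen_smult) simp
  moreover have "0 \<odot>\<^bsub>laurent V\<^esub> \<zero>\<^bsub>laurent V\<^esub> = \<zero>\<^bsub>laurent V\<^esub>"
    by (simp add: laurent_simps)
  ultimately show ?thesis
    using lie_eq_Scale_zero[of "Gen \<zero>\<^bsub>laurent V\<^esub>" "laurent V" rels]
    by (auto intro: lie_eq.trans)
qed

lemma (in superspace) lookup_Abs_laurent:
  assumes "v \<in> carrier (laurent V)" "f \<zero> = (0 :: 'b::zero)"
  shows "lk (Abs_poly_mapping (\<lambda>t. f (v t))) t = f (v t)"
proof -
  have "finite {t. f (v t) \<noteq> 0}"
    by (rule finite_subset[of _ "{t. v t \<noteq> \<zero>}"]) (use assms in \<open>auto simp: laurent_simps\<close>)
  then show ?thesis by simp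
qed

section \<open>Evaluation of expressions in the affinization\<close>

context embedded_vertex_lie_algebra
begin

text \<open>The value is taken in the affinization and not in its quotient, so that congruent
  expressions have explicit values whose difference is an explicit total derivative. At a generator
  \<open>Abs_poly_mapping\<close> is meaningful because elements of \<open>laurent R\<close> have
  finite support.\<close>

primrec ev :: "('k, int \<Rightarrow> 'a) lie_expr \<Rightarrow> (int \<Rightarrow>\<^sub>0 'a \<Rightarrow>\<^sub>0 'k)" where
  "ev (Gen v) = Abs_poly_mapping (\<lambda>t. emb (v t))"
| "ev Zero = 0"
| "ev (Plus x y) = ev x + ev y"
| "ev (Scale c x) = M.aff_scale c (ev x)"
| "ev (Bracket x y) = M.aff_bracket (ev x) (ev y)"

lemma lookup_ev_Gen [simp]: "v \<in> carrier (laurent R) \<Longrightarrow> lk (ev (Gen v)) t = emb (v t)"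
  unfolding ev.simps by (rule lookup_Abs_laurent) auto

lemma ev_Gen_monomial: "a \<in> carrier R \<Longrightarrow> ev (Gen (monomial R a t)) = sgl t (emb a)"
  by (rule poly_mapping_eqI, subst lookup_ev_Gen, erule laurent_closed(4)) (simp_all add: lookup_single monomial_def when_def)

lemma ev_Gen_add:
  "u \<in> carrier (laurent R) \<Longrightarrow> v \<in> carrier (laurent R) \<Longrightarrow>
    ev (Gen (u \<oplus>\<^bsub>laurent R\<^esub> v)) = ev (Gen u) + ev (Gen v)"
  by (rule poly_mapping_eqI)
    (simp add: lookup_add laurentD emb_add del: ev.simps, simp add: laurent_simps emb_add)

lemma ev_Gen_smult:
  "v \<in> carrier (laurent R) \<Longrightarrow> ev (Gen (c \<odot>\<^bsub>laurent R\<^esub> v)) = M.aff_scale c (ev (Gen v))"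
  by (rule poly_mapping_eqI)
    (simp add: M.lookup_aff_scale laurentD emb_sc del: ev.simps, simp add: laurent_simps emb_sc)

lemma bracket_sum_closed:
  assumes "a \<in> carrier R" "b \<in> carrier R"
  shows "(\<Oplus>\<^bsub>laurent R\<^esub>i\<in>{i. nprod R i a b \<noteq> \<zero>}.
        (of_int t gchoose i) \<odot>\<^bsub>laurent R\<^esub> monomial R (nprod R i a b) (t + s - int i)) \<in> carrier (laurent R)"
  by (rule abelian_monoid.finsum_closed[OF abelian_group.axioms(1)[OF laurent_abelian_group]])
    (auto simp: assms)

lemma ev_Gen_bracket_sum:
  assumes "a \<in> carrier R" "b \<in> carrier R"
  shows "ev (Gen (\<Oplus>\<^bsub>laurent R\<^esub>i\<in>{i. nprod R i a b \<noteq> \<zero>}.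
        (of_int t gchoose i) \<odot>\<^bsub>laurent R\<^esub> monomial R (nprod R i a b) (t + s - int i)))
    = M.beta t (emb a) s (emb b)"
proof -
  have "ev (Gen (\<Oplus>\<^bsub>laurent R\<^esub>i\<in>{i. nprod R i a b \<noteq> \<zero>}.
        (of_int t gchoose i) \<odot>\<^bsub>laurent R\<^esub> monomial R (nprod R i a b) (t + s - int i)))
    = (\<Sum>i\<in>{i. nprod R i a b \<noteq> \<zero>}. ev (Gen ((of_int t gchoose i) \<odot>\<^bsub>laurent R\<^esub> monomial R (nprod R i a b) (t + s - int i))))"
    by (rule additive_finsum[of _ "\<lambda>v. ev (Gen v)"])
      (auto simp: assms abelian_group.axioms(1)[OF laurent_abelian_group] nprod_finite ev_Gen_add simp del: ev.simps)
  also have "\<dots> = M.beta t (emb a) s (emb b)"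
    by (simp add: assms M.beta_def Pw_def ev_Gen_smult ev_Gen_monomial M.aff_scale_single del: ev.simps)
  finally show ?thesis .
qed

lemma ev_parity: "expr_parity (laurent R) p x \<Longrightarrow> \<forall>t. lk (ev x) t \<in> Hw p"
proof (induction rule: expr_parity.induct)
  case (1 v p)
  then show ?case by (simp add: laurent_homog_carrier del: ev.simps) (auto simp: laurent_simps Hw_def)
next
  case (5 p x q y)
  then show ?case using M.aff_bracket_parity by simp
qed (auto simp: M.H_zero M.H_add M.H_sc lookup_add M.lookup_aff_scale)

text \<open>Soundness of the model. It limits what the relations can identify and is the source of
  every later proof that two classes differ.\<close>

lemma ev_cong: "loc_eq R x y \<Longrightarrow> M.cong (ev x) (ev y)"
proof (induction rule: lie_eq.induct)
  case (sym x y)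
  show ?case by (rule M.cong_sym[OF sym(2)])
next
  case (trans x y z)
  then show ?case by (blast intro: M.cong_trans)
next
  case (skew x y p q)
  then show ?case using M.aff_bracket_skew[of "ev x" p "ev y" q] ev_parity by simp
next
  case (jacobi x y z p q)
  then have "ev (Bracket (Bracket x y) z) = ev (Plus (Bracket x (Bracket y z)) (Scale (- parity_sign p q) (Bracket y (Bracket x z))))"
    using M.aff_bracket_jacobi[of "ev x" p "ev y" q "ev z"] ev_parity
    by (simp add: M.aff_scale_minus)
  then show ?case by (simp only: M.cong_refl)
next
  case (Gen_add u v)
  then show ?case by (simp only: ev_Gen_add ev.simps(3) M.cong_refl)
next
  case (Gen_smult v c)
  then show ?case by (simp only: ev_Gen_smult ev.simps(4) M.cong_refl)
next
  case (rel x y)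
  from rel(1) show ?case unfolding loc_rels_def
  proof (elim UnE CollectE exE conjE)
    fix a t assume xy: "(x, y) = (Gen (monomial R (der R a) t), Scale (- of_int t) (Gen (monomial R a (t - 1))))"
      and a: "a \<in> carrier R"
    \<comment> \<open>The monomial \<open>a x^t\<close> is the witness: its total derivative is
      \<open>(Ta) x^t + t a x^(t-1)\<close>.\<close>
    have "ev x = ev y + M.total_der (sgl t (emb a))"
      using xy a by (simp add: ev_Gen_monomial M.total_der_single M.aff_scale_single Tw_def del: ev.simps(1) flip: single_add)
    then show ?thesis unfolding M.cong_def by blast
  next
    fix a b t s assume "(x, y) = (Bracket (Gen (monomial R a t)) (Gen (monomial R b s)),
      Gen (\<Oplus>\<^bsub>laurent R\<^esub>i\<in>{i. nprod R i a b \<noteq> \<zero>}.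
        (of_int t gchoose i) \<odot>\<^bsub>laurent R\<^esub> monomial R (nprod R i a b) (t + s - int i)))"
      and "a \<in> carrier R" "b \<in> carrier R"
    then show ?thesis
      by (simp add: ev_Gen_bracket_sum ev_Gen_monomial M.aff_bracket_single del: ev.simps(1))
  qed
qed (auto intro: M.cong_add M.cong_aff_scale M.cong_aff_bracket
     simp: M.aff_scale_add M.aff_scale_left_add M.aff_scale_aff_scale M.aff_scale_one M.aff_scale_minus_one algebra_simps
       M.aff_bracket_add_left M.aff_bracket_add_right M.aff_bracket_aff_scale_left M.aff_bracket_aff_scale_right)

section \<open>Elimination of brackets\<close>

definition "proj u = (\<lambda>t. q (lk u t))"

lemma proj_closed [simp]: "proj u \<in> carrier (laurent R)"
proof -
  have "finite {t. q (lk u t) \<noteq> \<zero>}"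
    by (rule finite_subset[of _ "Poly_Mapping.keys u"]) (auto simp: in_keys_iff)
  then show ?thesis by (simp add: laurent_simps proj_def)
qed

lemma proj_add: "proj (u + v) = proj u \<oplus>\<^bsub>laurent R\<^esub> proj v"
  by (simp add: proj_def laurent_simps lookup_add q_add)

lemma proj_aff_scale: "proj (M.aff_scale c u) = c \<odot>\<^bsub>laurent R\<^esub> proj u"
  by (simp add: proj_def laurent_simps M.lookup_aff_scale q_sc)

lemma proj_ev_Gen [simp]: "v \<in> carrier (laurent R) \<Longrightarrow> proj (ev (Gen v)) = v"
  by (auto simp: proj_def laurentD simp del: ev.simps)

text \<open>The range of \<open>emb\<close> on the carrier, written as a fixed point condition so
  that closure under the operations is checked by rewriting.\<close>

definition "emb_range = {w. emb (q w) = w}"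

lemma emb_range_closed: "0 \<in> emb_range" "a \<in> emb_range \<Longrightarrow> b \<in> emb_range \<Longrightarrow> a + b \<in> emb_range" "a \<in> emb_range \<Longrightarrow> sc c a \<in> emb_range" "Pw n a b \<in> emb_range"
  "x \<in> carrier R \<Longrightarrow> emb x \<in> emb_range"
  by (auto simp: emb_range_def q_add q_sc emb_add emb_sc Pw_def)

lemma aff_bracket_emb_range: "lk (M.aff_bracket u v) k \<in> emb_range"
proof -
  have "\<forall>k. lk (\<Sum>i\<in>A. sgl (t + s - int i) (sc (of_int t gchoose i) (Pw i a b))) k \<in> emb_range" for A t s a b
    by (induction A rule: infinite_finite_induct)
      (auto simp: lookup_add lookup_single when_def emb_range_closed)
  then have beta: "\<forall>k. lk (M.beta t a s b) k \<in> emb_range" for t a s b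
    unfolding M.beta_def by blast
  have "\<forall>k. lk (M.aff_bracket (sgl t a) v) k \<in> emb_range" for t a
  proof -
    have "\<And>k. lk v k \<in> UNIV" by simp
    then show ?thesis
      by (induction v rule: poly_mapping_induct_on)
        (auto simp: M.aff_bracket_sum_right M.aff_bracket_add_right lookup_add emb_range_closed M.aff_bracket_single beta)
  qed
  note single = this
  have "\<And>k. lk u k \<in> UNIV" by simp
  then have "\<forall>k. lk (M.aff_bracket u v) k \<in> emb_range"
    by (induction u rule: poly_mapping_induct_on)
        (auto simp: M.aff_bracket_sum_left M.aff_bracket_add_left lookup_add emb_range_closed single)
  then show ?thesis ..
qed

lemma ev_emb_range: "x \<in> lie_exprs (laurent R) \<Longrightarrow> lk (ev x) k \<in> emb_range"
  by (induction x) (auto simp: emb_range_closed lookup_add M.lookup_aff_scale aff_bracket_emb_range laurentD simp del: ev.simps(1))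

lemma proj_zero: "proj 0 = \<zero>\<^bsub>laurent R\<^esub>"
  by (simp add: proj_def laurent_simps)

lemma proj_single: "proj (sgl t a) = monomial R (q a) t"
  by (auto simp: proj_def monomial_def lookup_single when_def)

lemma Gen_proj_add: "loc_eq R (Gen (proj (u + v))) (Plus (Gen (proj u)) (Gen (proj v)))"
  unfolding proj_add by (rule lie_eq.Gen_add) auto

lemma Gen_proj_zero: "loc_eq R (Gen (proj 0)) Zero"
  unfolding proj_zero by (rule lie_eq_Gen_zero)

text \<open>Expanding both arguments by bilinearity leaves two monomials, for which this is the
  commutator relation of the presentation.\<close>

lemma Bracket_Gen_eq:
  assumes "\<And>k. lk u k \<in> emb_range" "\<And>k. lk v k \<in> emb_range"
  shows "loc_eq R (Bracket (Gen (proj u)) (Gen (proj v))) (Gen (proj (M.aff_bracket u v)))"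
  using assms(1)
proof (induction u rule: poly_mapping_induct_on)
  case zero
  have "loc_eq R (Bracket (Gen (proj 0)) (Gen (proj v))) (Bracket Zero (Gen (proj v)))"
    by (intro lie_eq.cong_Bracket Gen_proj_zero lie_eq.refl) simp
  also have "loc_eq R \<dots> Zero"
    by (rule lie_eq_Bracket_Zero) simp
  also have "loc_eq R \<dots> (Gen (proj 0))" by (rule lie_eq.sym[OF Gen_proj_zero])
  finally show ?case by (simp add: M.aff_bracket_sum_left)
next
  case (add u u')
  have "loc_eq R (Bracket (Gen (proj (u + u'))) (Gen (proj v)))
      (Bracket (Plus (Gen (proj u)) (Gen (proj u'))) (Gen (proj v)))"
    by (intro lie_eq.cong_Bracket Gen_proj_add lie_eq.refl) simp
  also have "loc_eq R \<dots> (Plus (Bracket (Gen (proj u)) (Gen (proj v))) (Bracket (Gen (proj u')) (Gen (proj v))))"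
    by (rule lie_eq.Bracket_Plus_left) auto
  also have "loc_eq R \<dots> (Plus (Gen (proj (M.aff_bracket u v))) (Gen (proj (M.aff_bracket u' v))))"
    by (rule lie_eq.cong_Plus[OF add])
  also have "loc_eq R \<dots> (Gen (proj (M.aff_bracket u v + M.aff_bracket u' v)))"
    by (rule lie_eq.sym[OF Gen_proj_add])
  finally show ?case by (simp add: M.aff_bracket_add_left)
next
  case (single t a)
  note a = this
  show ?case using assms(2)
  proof (induction v rule: poly_mapping_induct_on)
    case zero
    have "loc_eq R (Bracket (Gen (proj (sgl t a))) (Gen (proj 0))) (Bracket (Gen (proj (sgl t a))) Zero)"
      by (intro lie_eq.cong_Bracket Gen_proj_zero lie_eq.refl) simp
    also have "loc_eq R \<dots> Zero"
      by (rule lie_eq_Bracket_Zero) simp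
    also have "loc_eq R \<dots> (Gen (proj 0))" by (rule lie_eq.sym[OF Gen_proj_zero])
    finally show ?case by (simp add: M.aff_bracket_sum_right)
  next
    case (add v v')
    let ?x = "Gen (proj (sgl t a))"
    have "loc_eq R (Bracket ?x (Gen (proj (v + v'))))
        (Bracket ?x (Plus (Gen (proj v)) (Gen (proj v'))))"
      by (intro lie_eq.cong_Bracket Gen_proj_add lie_eq.refl) simp
    also have "loc_eq R \<dots> (Plus (Bracket ?x (Gen (proj v))) (Bracket ?x (Gen (proj v'))))"
      by (rule lie_eq.Bracket_Plus_right) auto
    also have "loc_eq R \<dots> (Plus (Gen (proj (M.aff_bracket (sgl t a) v))) (Gen (proj (M.aff_bracket (sgl t a) v'))))"
      by (rule lie_eq.cong_Plus[OF add])
    also have "loc_eq R \<dots> (Gen (proj (M.aff_bracket (sgl t a) v + M.aff_bracket (sgl t a) v')))"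
      by (rule lie_eq.sym[OF Gen_proj_add])
    finally show ?case by (simp add: M.aff_bracket_add_right)
  next
    case (single s b)
    let ?S = "\<Oplus>\<^bsub>laurent R\<^esub>i\<in>{i. nprod R i (q a) (q b) \<noteq> \<zero>}.
        (of_int t gchoose i) \<odot>\<^bsub>laurent R\<^esub> monomial R (nprod R i (q a) (q b)) (t + s - int i)"
    have S: "?S \<in> carrier (laurent R)" by (rule bracket_sum_closed) auto
    have "proj (ev (Gen ?S)) = ?S" by (rule proj_ev_Gen[OF S])
    moreover have "ev (Gen ?S) = M.aff_bracket (sgl t a) (sgl s b)"
      using a single by (subst ev_Gen_bracket_sum) (auto simp: M.aff_bracket_single emb_range_def)
    moreover have "loc_eq R (Bracket (Gen (monomial R (q a) t)) (Gen (monomial R (q b) s))) (Gen ?S)"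
    proof (rule lie_eq.rel)
      show "(Bracket (Gen (monomial R (q a) t)) (Gen (monomial R (q b) s)), Gen ?S) \<in> loc_rels R"
        unfolding loc_rels_def using q_closed by blast
    qed (use S in auto)
    ultimately show ?case by (simp add: proj_single)
  qed
qed

text \<open>Brackets of generators are again generators up to congruence, so brackets can be removed
  from the inside out. Together with \<open>ev_cong\<close> this makes the model complete: no class
  is missed.\<close>

lemma Gen_proj_ev: "x \<in> lie_exprs (laurent R) \<Longrightarrow> loc_eq R x (Gen (proj (ev x)))"
proof (induction x)
  case (Gen v)
  then show ?case by (auto simp del: ev.simps intro: lie_eq.refl)
next
  case Zero
  show ?case using lie_eq.sym[OF Gen_proj_zero] by simp
next
  case (Plus x y)
  then have "loc_eq R (Plus x y) (Plus (Gen (proj (ev x))) (Gen (proj (ev y))))"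
    by (intro lie_eq.cong_Plus) auto
  also have "loc_eq R \<dots> (Gen (proj (ev (Plus x y))))"
    unfolding ev.simps by (rule lie_eq.sym[OF Gen_proj_add])
  finally show ?case .
next
  case (Scale c x)
  then have "loc_eq R (Scale c x) (Scale c (Gen (proj (ev x))))"
    by (intro lie_eq.cong_Scale) auto
  also have "loc_eq R \<dots> (Gen (proj (ev (Scale c x))))"
    unfolding ev.simps proj_aff_scale by (rule lie_eq.sym[OF lie_eq.Gen_smult]) simp
  finally show ?case .
next
  case (Bracket x y)
  then have "loc_eq R (Bracket x y) (Bracket (Gen (proj (ev x))) (Gen (proj (ev y))))"
    by (intro lie_eq.cong_Bracket) auto
  also have "loc_eq R \<dots> (Gen (proj (ev (Bracket x y))))"
    unfolding ev.simps(5) by (rule Bracket_Gen_eq) (use Bracket.prems ev_emb_range in auto)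
  finally show ?case .
qed

lemma Tw_emb: "a \<in> carrier R \<Longrightarrow> Tw (emb a) = emb (der R a)"
  by (simp add: Tw_def)

lemma ev_expr_der: "x \<in> lie_exprs (laurent R) \<Longrightarrow> ev (expr_der (der R) x) = M.aff_T (ev x)"
proof (induction x)
  case (Gen v)
  then have v: "v \<in> carrier (laurent R)" by simp
  have "lk (ev (Gen (der R \<circ> v))) t = lk (M.aff_T (ev (Gen v))) t" for t
    using v by (simp add: M.lookup_aff_T der_comp_laurent Tw_emb laurentD del: ev.simps)
  then show ?case unfolding expr_der.simps by (rule poly_mapping_eqI)
qed (auto simp: M.aff_T_sum M.aff_T_add M.aff_T_aff_bracket M.aff_T_aff_scale)

end

text \<open>The operator \<open>T + \<partial>\<^sub>x\<close> in coefficients: \<open>x^t\<close>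
  receives \<open>(t + 1) w_{t+1}\<close> from the derivative of \<open>x^(t+1)\<close>. It is the
  counterpart of \<open>total_der\<close> on the carrier.\<close>

definition laurent_der :: "('k::field_char_0, 'a, 'm) kt_module_scheme \<Rightarrow> (int \<Rightarrow> 'a) \<Rightarrow> int \<Rightarrow> 'a"
  where "laurent_der V w = (\<lambda>t. der V (w t) \<oplus>\<^bsub>V\<^esub> of_int (t + 1) \<odot>\<^bsub>V\<^esub> w (t + 1))"

text \<open>A choice of representative in \<open>R[x, x\<^sup>-\<^sup>1]\<close> of the class of each expression.\<close>

definition normal_form :: "('k::field_char_0, 'a, 'm) conformal_scheme \<Rightarrow> (('k, int \<Rightarrow> 'a) lie_expr \<Rightarrow> int \<Rightarrow> 'a) \<Rightarrow> bool"
  where "normal_form R J \<longleftrightarrow> (\<forall>x. J x \<in> carrier (laurent R)) \<and>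
    (\<forall>v\<in>carrier (laurent R). J (Gen v) = v) \<and>
    (\<forall>x y. loc_eq R x y \<longrightarrow> (\<exists>w\<in>carrier (laurent R). J x = J y \<oplus>\<^bsub>laurent R\<^esub> laurent_der R w)) \<and>
    (\<forall>x\<in>lie_exprs (laurent R). loc_eq R x (Gen (J x))) \<and>
    (\<forall>p x. expr_parity (laurent R) p x \<longrightarrow> J x \<in> homog (laurent R) p) \<and>
    (\<forall>x\<in>lie_exprs (laurent R). J (expr_der (der R) x) = der R \<circ> J x)"

text \<open>Each condition in \<open>normal_form\<close> speaks of \<open>R\<close> only, so the
  embedding and the total model can be discarded from here on.\<close>

lemma (in vertex_lie_algebra) normal_form_exists: "\<exists>J. normal_form R J"
proof -
  obtain emb :: "'a \<Rightarrow> ('a \<Rightarrow>\<^sub>0 'k)" and q :: "('a \<Rightarrow>\<^sub>0 'k) \<Rightarrow> 'a"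
    where "embedded_vertex_lie_algebra R emb q"
  proof (rule module_embedding[OF module_axioms], goal_cases)
    case (1 emb q)
    show ?case
      by (rule 1(1)[of emb q], intro embedded_vertex_lie_algebra.intro
          embedded_vertex_lie_algebra_axioms.intro vertex_lie_algebra_axioms) (fact 1)+
  qed
  then interpret E: embedded_vertex_lie_algebra R emb q .
  define J where "J x = E.proj (E.ev x)" for x
  have "normal_form R J"
    unfolding normal_form_def
  proof (intro conjI allI ballI impI)
    fix x y assume "loc_eq R x y"
    then obtain w where w: "E.ev x = E.ev y + E.M.total_der w"
      using E.ev_cong unfolding E.M.cong_def by blast
    have "E.proj (E.M.total_der w) = laurent_der R (E.proj w)"
      by (simp add: E.proj_def laurent_der_def E.M.lookup_total_der E.q_add E.q_sc E.Tw_def)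
    then show "\<exists>w\<in>carrier (laurent R). J x = J y \<oplus>\<^bsub>laurent R\<^esub> laurent_der R w"
      by (intro bexI[of _ "E.proj w"]) (simp_all add: J_def w E.proj_add)
  next
    fix p x assume "expr_parity (laurent R) p x"
    then have *: "\<forall>t. lk (E.ev x) t \<in> E.Hw p" by (rule E.ev_parity)
    have "J x t \<in> homog R p" for t
    proof -
      obtain a where "a \<in> homog R p" "lk (E.ev x) t = emb a"
        using * by (auto simp: E.Hw_def)
      then show ?thesis by (simp add: J_def E.proj_def homogD)
    qed
    moreover have "J x \<in> carrier (laurent R)" by (simp add: J_def)
    ultimately show "J x \<in> homog (laurent R) p" by (simp add: laurent_simps)
  next
    fix x assume x: "x \<in> lie_exprs (laurent R)"
    then show "J (expr_der (der R) x) = der R \<circ> J x"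
      by (auto simp: J_def E.ev_expr_der E.proj_def E.M.lookup_aff_T E.Tw_def)
    show "loc_eq R x (Gen (J x))" unfolding J_def by (rule E.Gen_proj_ev[OF x])
  qed (simp_all add: J_def del: E.ev.simps)
  then show ?thesis by (rule exI[of "normal_form R" J])
qed

context vertex_lie_algebra
begin

definition nf :: "('k, int \<Rightarrow> 'a) lie_expr \<Rightarrow> int \<Rightarrow> 'a"
  where "nf = (SOME J. normal_form R J)"

lemma normal_form_nf: "normal_form R nf"
  unfolding nf_def by (rule someI_ex[OF normal_form_exists])

lemma nf_closed [simp]: "nf x \<in> carrier (laurent R)"
  and nf_Gen: "v \<in> carrier (laurent R) \<Longrightarrow> nf (Gen v) = v"
  and nf_loc_eq: "loc_eq R x y \<Longrightarrow> \<exists>w\<in>carrier (laurent R). nf x = nf y \<oplus>\<^bsub>laurent R\<^esub> laurent_der R w"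
  and loc_eq_nf: "x \<in> lie_exprs (laurent R) \<Longrightarrow> loc_eq R x (Gen (nf x))"
  and nf_parity: "expr_parity (laurent R) p x \<Longrightarrow> nf x \<in> homog (laurent R) p"
  and nf_expr_der: "x \<in> lie_exprs (laurent R) \<Longrightarrow> nf (expr_der (der R) x) = der R \<circ> nf x"
  using normal_form_nf unfolding normal_form_def by blast+

end

section \<open>The Lie algebra of a vertex Lie algebra\<close>

context superspace
begin

lemma homog_decomp_unique:
  assumes "y \<oplus> z = y' \<oplus> z'" "y \<in> homog V p" "y' \<in> homog V p" "z \<in> homog V r" "z' \<in> homog V r" "p \<noteq> r"
  shows "y = y'" "z = z'"
proof -
  note cl = assms(2-5)[THEN homogD]
  have "y = (y \<oplus> z) \<oplus> \<ominus> z" using cl by (simp add: a_assoc r_neg)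
  also have "\<dots> = y' \<oplus> (z' \<ominus> z)" unfolding assms(1) using cl by (simp add: a_assoc minus_eq)
  finally have "y \<ominus> y' = (z' \<ominus> z) \<oplus> y' \<ominus> y'" using cl by (simp add: a_comm)
  then have "y \<ominus> y' = z' \<ominus> z" using cl by (simp add: minus_eq a_assoc r_neg)
  moreover have "y \<ominus> y' \<in> homog V p" "z' \<ominus> z \<in> homog V r" using assms by (auto simp: minus_eq)
  ultimately have "y \<ominus> y' = \<zero>" "z' \<ominus> z = \<zero>" using homog_inter[of "y \<ominus> y'" p r] assms(6) by auto
  moreover have "a = b" if "a \<ominus> b = \<zero>" "a \<in> carrier V" "b \<in> carrier V" for a b
    using that minus_equality[of a "\<ominus> b"] by (simp add: minus_eq)
  ultimately show "y = y'" "z = z'" using cl by metis+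
qed

text \<open>In \<open>bit\<close> the opposite parity is \<open>p + 1\<close>, so one formula covers
  the even and the odd component.\<close>

definition hcomp :: "bit \<Rightarrow> 'a \<Rightarrow> 'a"
  where "hcomp p x = (THE y. y \<in> homog V p \<and> (\<exists>z\<in>homog V (p + 1). x = y \<oplus> z))"

lemma hcomp_eqI:
  assumes "y \<in> homog V p" "z \<in> homog V (p + 1)" "x = y \<oplus> z"
  shows "hcomp p x = y"
proof -
  have "p \<noteq> p + 1" by (cases p) auto
  then show ?thesis unfolding hcomp_def
    using assms homog_decomp_unique(1)[of _ _ y z p "p + 1"] by (intro the_equality) auto
qed

lemma hcomp:
  assumes "x \<in> carrier V"
  shows "hcomp p x \<in> homog V p" "x = hcomp 0 x \<oplus> hcomp 1 x"
proof -
  obtain y z where yz: "y \<in> homog V 0" "z \<in> homog V 1" "x = y \<oplus> z" using homog_decomp[OF assms] .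
  then have "hcomp 0 x = y" by (intro hcomp_eqI[of _ _ z]) auto
  moreover have "hcomp 1 x = z"
    using yz by (intro hcomp_eqI[of _ _ y]) (auto simp: homogD a_comm)
  ultimately show "hcomp p x \<in> homog V p" "x = hcomp 0 x \<oplus> hcomp 1 x"
    using yz by (cases p; simp)+
qed

lemma hcomp_zero [simp]: "hcomp p \<zero> = \<zero>"
  by (rule hcomp_eqI[of _ _ \<zero>]) auto

lemma laurent_hcomp:
  assumes "v \<in> carrier (laurent V)"
  shows "hcomp p \<circ> v \<in> homog (laurent V) p" "v = (hcomp 0 \<circ> v) \<oplus>\<^bsub>laurent V\<^esub> (hcomp 1 \<circ> v)"
proof -
  have "hcomp p \<circ> v \<in> carrier (laurent V)"
    by (rule laurent_comp[OF assms]) (auto intro: homogD hcomp)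
  then show "hcomp p \<circ> v \<in> homog (laurent V) p" using assms by (auto simp: laurent_simps intro: hcomp)
  show "v = (hcomp 0 \<circ> v) \<oplus>\<^bsub>laurent V\<^esub> (hcomp 1 \<circ> v)" 
    using assms hcomp(2) by (auto simp: laurent_simps)
qed

lemma laurent_induct [consumes 1, case_names zero monomial add]:
  assumes "v \<in> carrier (laurent V)" "Q \<zero>\<^bsub>laurent V\<^esub>"
    and "\<And>a t. a \<in> carrier V \<Longrightarrow> Q (monomial V a t)"
    and "\<And>u v. u \<in> carrier (laurent V) \<Longrightarrow> v \<in> carrier (laurent V) \<Longrightarrow> Q u \<Longrightarrow> Q v \<Longrightarrow> Q (u \<oplus>\<^bsub>laurent V\<^esub> v)"
  shows "Q v"
proof -
  \<comment> \<open>Inducting on a superset \<open>A\<close> of the support allows a coefficient to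
    be cleared without asking whether it was nonzero.\<close>
  have "v \<in> carrier (laurent V) \<Longrightarrow> {t. v t \<noteq> \<zero>} \<subseteq> A \<Longrightarrow> Q v" if "finite A" for A v
    using that
  proof (induction arbitrary: v)
    case empty
    then have "v = \<zero>\<^bsub>laurent V\<^esub>" by (auto simp: laurent_simps)
    then show ?case using assms(2) by simp
  next
    case (insert t A)
    let ?v = "v(t := \<zero>)"
    have v: "?v \<in> carrier (laurent V)"
    proof -
      have "finite {s. ?v s \<noteq> \<zero>}"
        by (rule finite_subset[of _ "{s. v s \<noteq> \<zero>}"]) (use insert.prems in \<open>auto simp: laurent_simps\<close>)
      then show ?thesis using insert.prems by (auto simp: laurent_simps)
    qed
    have vt: "v s \<in> carrier V" for s using insert.prems by (auto simp: laurent_simps)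
    have sub: "{s. ?v s \<noteq> \<zero>} \<subseteq> A" using insert.prems by auto
    have "v = monomial V (v t) t \<oplus>\<^bsub>laurent V\<^esub> ?v"
      using vt by (auto simp: laurent_simps monomial_def)
    moreover have "Q (monomial V (v t) t \<oplus>\<^bsub>laurent V\<^esub> ?v)"
      by (rule assms(4)) (use v vt in \<open>auto intro: insert.IH[OF v sub] assms(3)\<close>)
    ultimately show ?case by simp
  qed
  moreover have "finite {t. v t \<noteq> \<zero>}" using assms(1) by (simp add: laurent_simps)
  ultimately show ?thesis using assms(1) by blast
qed

lemma lie_eq_exprs:
  assumes "lie_eq (laurent V) rels x y"
  shows "x \<in> lie_exprs (laurent V)" "y \<in> lie_exprs (laurent V)"
proof -
  have "x \<in> lie_exprs (laurent V) \<and> y \<in> lie_exprs (laurent V)"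
    using assms by induction auto
  then show "x \<in> lie_exprs (laurent V)" "y \<in> lie_exprs (laurent V)" by auto
qed

lemma lie_class_eq_iff:
  assumes "x \<in> lie_exprs (laurent V)"
  shows "lie_class (laurent V) rels x = lie_class (laurent V) rels y \<longleftrightarrow> lie_eq (laurent V) rels x y"
proof
  assume "lie_class (laurent V) rels x = lie_class (laurent V) rels y"
  then have "x \<in> lie_class (laurent V) rels y" using lie_eq.refl[OF assms] by (auto simp: lie_class_def)
  then show "lie_eq (laurent V) rels x y" by (auto simp: lie_class_def intro: lie_eq.sym)
next
  assume "lie_eq (laurent V) rels x y"
  then show "lie_class (laurent V) rels x = lie_class (laurent V) rels y"
    unfolding lie_class_def by (auto intro: lie_eq.sym lie_eq.trans)
qed

text \<open>Operations on classes are encoded as unions over all representatives; such a union is a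
  single class once the operation respects the congruence.\<close>

lemma UN_lie_class:
  assumes "x \<in> lie_exprs (laurent V)"
    and "\<And>x'. lie_eq (laurent V) rels x x' \<Longrightarrow> lie_class W rels' (f x) = lie_class W rels' (f x')"
  shows "(\<Union>x'\<in>lie_class (laurent V) rels x. lie_class W rels' (f x')) = lie_class W rels' (f x)"
proof -
  have "x \<in> lie_class (laurent V) rels x" using lie_eq.refl[OF assms(1)] by (simp add: lie_class_def)
  then show ?thesis using assms(2) unfolding lie_class_def[of "laurent V"] by blast
qed

end

lemma expr_parity_der:
  assumes "expr_parity (laurent V) p x"
    and "\<And>p v. v \<in> homog (laurent V) p \<Longrightarrow> T \<circ> v \<in> homog (laurent V) p"
  shows "expr_parity (laurent V) p (expr_der T x)"
  using assms(1)
  by induction (auto simp only: expr_der.simps assms(2) intro: expr_parity.intros)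

lemma expr_der_exprs:
  assumes "x \<in> lie_exprs V" "\<And>v. v \<in> carrier V \<Longrightarrow> T \<circ> v \<in> carrier V"
  shows "expr_der T x \<in> lie_exprs V"
  using assms(1) by (induction x) (auto simp: assms(2))

section \<open>The derivation on classes\<close>

context vertex_lie_algebra
begin

lemma der_comp_laurent_homog: "v \<in> homog (laurent R) p \<Longrightarrow> der R \<circ> v \<in> homog (laurent R) p"
  using der_comp_laurent[OF laurent_homog_carrier, of v p] by (auto simp: laurent_simps der_homog)

lemma der_comp_monomial: "der R \<circ> monomial R a t = monomial R (der R a) t"
  by (auto simp: monomial_def)

lemma monomial_linear:
  "a \<in> carrier R \<Longrightarrow> b \<in> carrier R \<Longrightarrow> monomial R (a \<oplus> b) t = monomial R a t \<oplus>\<^bsub>laurent R\<^esub> monomial R b t"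
  "monomial R (c \<odot> a) t = c \<odot>\<^bsub>laurent R\<^esub> monomial R a t"
  by (auto simp: monomial_def laurent_simps)

lemma laurent_der_closed [simp]:
  assumes "w \<in> carrier (laurent R)"
  shows "laurent_der R w \<in> carrier (laurent R)"
proof -
  have "finite ({t. w t \<noteq> \<zero>} \<union> (\<lambda>t. t - 1) ` {t. w t \<noteq> \<zero>})"
    using assms by (auto simp: laurent_simps)
  moreover have "{t. laurent_der R w t \<noteq> \<zero>} \<subseteq> {t. w t \<noteq> \<zero>} \<union> (\<lambda>t. t - 1) ` {t. w t \<noteq> \<zero>}"
  proof
    fix t assume t: "t \<in> {t. laurent_der R w t \<noteq> \<zero>}"
    have "w t \<noteq> \<zero> \<or> w (t + 1) \<noteq> \<zero>"
      using t by (auto simp: laurent_der_def)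
    moreover have "t = (t + 1) - 1" by simp
    ultimately show "t \<in> {t. w t \<noteq> \<zero>} \<union> (\<lambda>t. t - 1) ` {t. w t \<noteq> \<zero>}" by blast
  qed
  ultimately have "finite {t. laurent_der R w t \<noteq> \<zero>}" by (rule finite_subset[rotated])
  then show ?thesis using assms by (auto simp: laurent_simps laurent_der_def)
qed

lemma laurent_der_add:
  assumes "u \<in> carrier (laurent R)" "v \<in> carrier (laurent R)"
  shows "laurent_der R (u \<oplus>\<^bsub>laurent R\<^esub> v) = laurent_der R u \<oplus>\<^bsub>laurent R\<^esub> laurent_der R v"
proof
  fix t
  have "u s \<in> carrier R" "v s \<in> carrier R" for s using assms by (auto simp: laurent_simps)
  then show "laurent_der R (u \<oplus>\<^bsub>laurent R\<^esub> v) t = (laurent_der R u \<oplus>\<^bsub>laurent R\<^esub> laurent_der R v) t"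
    by (simp add: laurent_der_def laurent_simps der_add scalar_distrib a_ac)
qed

lemma laurent_der_homog:
  assumes "w \<in> homog (laurent R) p"
  shows "laurent_der R w \<in> homog (laurent R) p"
  using laurent_der_closed[OF laurent_homog_carrier[OF assms]] assms
  by (auto simp: laurent_simps laurent_der_def der_homog)

lemma laurent_der_monomial:
  assumes "a \<in> carrier R"
  shows "laurent_der R (monomial R a t) = monomial R (der R a) t \<oplus>\<^bsub>laurent R\<^esub> of_int t \<odot>\<^bsub>laurent R\<^esub> monomial R a (t - 1)"
  using assms by (auto simp: laurent_der_def monomial_def laurent_simps)

lemma loc_eq_der_relation:
  assumes "a \<in> carrier R"
  shows "loc_eq R (Gen (monomial R (der R a) t)) (Scale (- of_int t) (Gen (monomial R a (t - 1))))"
  by (rule lie_eq.rel) (use assms in \<open>auto simp: loc_rels_def\<close>)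

text \<open>On a monomial this is the relation \<open>(Ta)_t = -t a_{t-1}\<close> itself. With
  \<open>nf_loc_eq\<close> it shows that two classes agree exactly when their normal forms differ by
  an element of the image of \<open>laurent_der\<close>.\<close>

lemma loc_eq_Gen_laurent_der:
  "w \<in> carrier (laurent R) \<Longrightarrow> loc_eq R (Gen (laurent_der R w)) Zero"
proof (induction w rule: laurent_induct)
  case zero
  have "laurent_der R \<zero>\<^bsub>laurent R\<^esub> = \<zero>\<^bsub>laurent R\<^esub>" by (auto simp: laurent_der_def laurent_simps)
  then show ?case using lie_eq_Gen_zero by simp
next
  case (monomial a t)
  let ?g = "Gen (monomial R a (t - 1))"
  have g: "?g \<in> lie_exprs (laurent R)" using monomial by simp
  have "loc_eq R (Gen (laurent_der R (monomial R a t)))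
      (Plus (Gen (monomial R (der R a) t)) (Gen (of_int t \<odot>\<^bsub>laurent R\<^esub> monomial R a (t - 1))))"
    unfolding laurent_der_monomial[OF monomial] by (rule lie_eq.Gen_add) (use monomial in auto)
  also have "loc_eq R \<dots> (Plus (Scale (- of_int t) ?g) (Scale (of_int t) ?g))"
    using monomial by (intro lie_eq.cong_Plus loc_eq_der_relation lie_eq.Gen_smult) auto
  also have "loc_eq R \<dots> (Scale (- of_int t + of_int t) ?g)"
    by (rule lie_eq.sym[OF lie_eq.Scale_add[OF g]])
  also have "loc_eq R \<dots> Zero" using lie_eq_Scale_zero[OF g] by simp
  finally show ?case .
next
  case (add u v)
  have "loc_eq R (Gen (laurent_der R (u \<oplus>\<^bsub>laurent R\<^esub> v)))
      (Plus (Gen (laurent_der R u)) (Gen (laurent_der R v)))"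
    unfolding laurent_der_add[OF add(1,2)] by (rule lie_eq.Gen_add) (use add in auto)
  also have "loc_eq R \<dots> (Plus Zero Zero)" by (rule lie_eq.cong_Plus[OF add(3,4)])
  also have "loc_eq R \<dots> Zero" by (rule lie_eq.Plus_Zero) simp
  finally show ?case .
qed

text \<open>\<open>T\<close> acts on normal forms coefficientwise and commutes with
  \<open>T + \<partial>\<^sub>x\<close>. If two normal forms differ by
  \<open>laurent_der R w\<close>, their images under \<open>T\<close> differ by
  \<open>laurent_der R (der R \<circ> w)\<close>, which is again trivial.\<close>

lemma loc_eq_expr_der:
  assumes "loc_eq R x y"
  shows "loc_eq R (expr_der (der R) x) (expr_der (der R) y)"
proof -
  note xy = lie_eq_exprs[OF assms]
  then have dxy: "expr_der (der R) x \<in> lie_exprs (laurent R)" "expr_der (der R) y \<in> lie_exprs (laurent R)"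
    by (auto intro: expr_der_exprs der_comp_laurent)
  obtain w where w: "w \<in> carrier (laurent R)" "nf x = nf y \<oplus>\<^bsub>laurent R\<^esub> laurent_der R w"
    using nf_loc_eq[OF assms] by blast
  have ws: "w t \<in> carrier R" "nf y t \<in> carrier R" for t using w nf_closed[of y] by (auto simp: laurent_simps)
  have "der R \<circ> nf x = (der R \<circ> nf y) \<oplus>\<^bsub>laurent R\<^esub> laurent_der R (der R \<circ> w)"
    unfolding w(2) using ws by (auto simp: laurent_simps laurent_der_def der_add der_smult)
  then have eq: "nf (expr_der (der R) x) = nf (expr_der (der R) y) \<oplus>\<^bsub>laurent R\<^esub> laurent_der R (der R \<circ> w)"
    using xy nf_expr_der by simp
  have "loc_eq R (expr_der (der R) x) (Gen (nf (expr_der (der R) x)))" by (rule loc_eq_nf[OF dxy(1)])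
  also have "loc_eq R \<dots> (Plus (Gen (nf (expr_der (der R) y))) (Gen (laurent_der R (der R \<circ> w))))"
    unfolding eq by (rule lie_eq.Gen_add) (use w der_comp_laurent in auto)
  also have "loc_eq R \<dots> (Plus (expr_der (der R) y) Zero)"
    by (intro lie_eq.cong_Plus loc_eq_Gen_laurent_der lie_eq.sym[OF loc_eq_nf] dxy der_comp_laurent w)
  also have "loc_eq R \<dots> (Plus Zero (expr_der (der R) y))"
    by (rule lie_eq.Plus_commute) (use dxy in auto)
  also have "loc_eq R \<dots> (expr_der (der R) y)" by (rule lie_eq.Plus_Zero[OF dxy(2)])
  finally show ?thesis .
qed

section \<open>The structure of a differential Lie superalgebra on classes\<close>

lemma loc_lie_simps:
  "carrier (loc_lie R) = loc_class R ` lie_exprs (laurent R)"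
  "\<zero>\<^bsub>loc_lie R\<^esub> = loc_class R Zero"
  "homog (loc_lie R) p = loc_class R ` {x \<in> lie_exprs (laurent R). expr_parity (laurent R) p x}"
  "gen_fields (loc_lie R) = {\<lambda>t. loc_class R (Gen (monomial R a t)) |a. a \<in> carrier R}"
  by (simp_all add: loc_lie_def)

lemma loc_class_eq: "loc_eq R x y \<Longrightarrow> loc_class R x = loc_class R y"
  using lie_class_eq_iff lie_eq_exprs by blast

lemma loc_lie_ops:
  assumes x: "x \<in> lie_exprs (laurent R)"
  shows "c \<odot>\<^bsub>loc_lie R\<^esub> loc_class R x = loc_class R (Scale c x)"
    and "der (loc_lie R) (loc_class R x) = loc_class R (expr_der (der R) x)"
    and "y \<in> lie_exprs (laurent R) \<Longrightarrow> loc_class R x \<oplus>\<^bsub>loc_lie R\<^esub> loc_class R y = loc_class R (Plus x y)"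
    and "y \<in> lie_exprs (laurent R) \<Longrightarrow> loc_class R x \<otimes>\<^bsub>loc_lie R\<^esub> loc_class R y = loc_class R (Bracket x y)"
proof -
  show "c \<odot>\<^bsub>loc_lie R\<^esub> loc_class R x = loc_class R (Scale c x)"
    unfolding loc_lie_def using x
    by (simp, intro UN_lie_class loc_class_eq lie_eq.cong_Scale)
  show "der (loc_lie R) (loc_class R x) = loc_class R (expr_der (der R) x)"
    unfolding loc_lie_def using x
    by (simp, intro UN_lie_class loc_class_eq loc_eq_expr_der)
  assume y: "y \<in> lie_exprs (laurent R)"
  have "(\<Union>x\<in>loc_class R x. \<Union>y\<in>loc_class R y. loc_class R (f x y)) = loc_class R (f x y)"
    if f: "\<And>x x' y y'. loc_eq R x x' \<Longrightarrow> loc_eq R y y' \<Longrightarrow> loc_eq R (f x y) (f x' y')" for f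
  proof -
    have "(\<Union>y\<in>loc_class R y. loc_class R (f x' y)) = loc_class R (f x' y)" if "x' \<in> lie_exprs (laurent R)" for x'
      by (intro UN_lie_class loc_class_eq f lie_eq.refl that y)
    then have "(\<Union>x\<in>loc_class R x. \<Union>y\<in>loc_class R y. loc_class R (f x y)) = (\<Union>x\<in>loc_class R x. loc_class R (f x y))"
      by (intro SUP_cong HOL.refl) (auto simp: lie_class_def dest: lie_eq_exprs)
    also have "\<dots> = loc_class R (f x y)"
      by (intro UN_lie_class loc_class_eq f lie_eq.refl x y)
    finally show ?thesis .
  qed
  note * = this
  show "loc_class R x \<oplus>\<^bsub>loc_lie R\<^esub> loc_class R y = loc_class R (Plus x y)"
    "loc_class R x \<otimes>\<^bsub>loc_lie R\<^esub> loc_class R y = loc_class R (Bracket x y)"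
    unfolding loc_lie_def by (simp_all add: * lie_eq.cong_Plus lie_eq.cong_Bracket)
qed


lemma loc_lie_closed [simp]: "x \<in> lie_exprs (laurent R) \<Longrightarrow> loc_class R x \<in> carrier (loc_lie R)"
  by (simp add: loc_lie_simps)

lemma loc_lie_cases:
  assumes "X \<in> carrier (loc_lie R)"
  obtains x where "x \<in> lie_exprs (laurent R)" "X = loc_class R x"
  using assms by (auto simp: loc_lie_simps)

lemma loc_lie_homog_cases:
  assumes "X \<in> homog (loc_lie R) p"
  obtains x where "x \<in> lie_exprs (laurent R)" "expr_parity (laurent R) p x" "X = loc_class R x"
  using assms by (auto simp: loc_lie_simps)

lemma loc_lie_homogI [simp]:
  "x \<in> lie_exprs (laurent R) \<Longrightarrow> expr_parity (laurent R) p x \<Longrightarrow> loc_class R x \<in> homog (loc_lie R) p"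
  by (simp add: loc_lie_simps)

lemma loc_class_nf: "x \<in> lie_exprs (laurent R) \<Longrightarrow> loc_class R x = loc_class R (Gen (nf x))"
  by (rule loc_class_eq[OF loc_eq_nf])

lemma expr_der_closed [simp]: "x \<in> lie_exprs (laurent R) \<Longrightarrow> expr_der (der R) x \<in> lie_exprs (laurent R)"
  by (rule expr_der_exprs) (auto intro: der_comp_laurent)

lemma loc_lie_abelian_group: "abelian_group (loc_lie R)"
proof (rule abelian_groupI)
  fix X Y Z assume "X \<in> carrier (loc_lie R)" "Y \<in> carrier (loc_lie R)" "Z \<in> carrier (loc_lie R)"
  then obtain x y z where *: "x \<in> lie_exprs (laurent R)" "X = loc_class R x" "y \<in> lie_exprs (laurent R)" "Y = loc_class R y"
    "z \<in> lie_exprs (laurent R)" "Z = loc_class R z"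
    by (metis loc_lie_cases)
  show "(X \<oplus>\<^bsub>loc_lie R\<^esub> Y) \<oplus>\<^bsub>loc_lie R\<^esub> Z = X \<oplus>\<^bsub>loc_lie R\<^esub> (Y \<oplus>\<^bsub>loc_lie R\<^esub> Z)"
    using * by (simp add: loc_lie_ops) (intro loc_class_eq lie_eq.Plus_assoc)
next
  fix X Y assume "X \<in> carrier (loc_lie R)" "Y \<in> carrier (loc_lie R)"
  then obtain x y where *: "x \<in> lie_exprs (laurent R)" "X = loc_class R x" "y \<in> lie_exprs (laurent R)" "Y = loc_class R y"
    by (metis loc_lie_cases)
  show "X \<oplus>\<^bsub>loc_lie R\<^esub> Y \<in> carrier (loc_lie R)" using * by (simp add: loc_lie_ops)
  show "X \<oplus>\<^bsub>loc_lie R\<^esub> Y = Y \<oplus>\<^bsub>loc_lie R\<^esub> X"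
    using * by (simp add: loc_lie_ops) (intro loc_class_eq lie_eq.Plus_commute)
next
  fix X assume "X \<in> carrier (loc_lie R)"
  then obtain x where *: "x \<in> lie_exprs (laurent R)" "X = loc_class R x"
    by (metis loc_lie_cases)
  show "\<zero>\<^bsub>loc_lie R\<^esub> \<oplus>\<^bsub>loc_lie R\<^esub> X = X"
    using * by (simp add: loc_lie_simps loc_lie_ops) (intro loc_class_eq lie_eq.Plus_Zero)
  have "loc_eq R (Plus (Scale (-1) x) x) Zero"
    using lie_eq.Plus_commute[of "Scale (-1) x" "laurent R" x] lie_eq.Plus_inverse[OF *(1)] *(1)
    by (auto intro: lie_eq.trans)
  then have "loc_class R (Scale (-1) x) \<oplus>\<^bsub>loc_lie R\<^esub> X = \<zero>\<^bsub>loc_lie R\<^esub>"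
    using * by (simp add: loc_lie_simps loc_lie_ops loc_class_eq)
  then show "\<exists>Y\<in>carrier (loc_lie R). Y \<oplus>\<^bsub>loc_lie R\<^esub> X = \<zero>\<^bsub>loc_lie R\<^esub>"
    using * by (intro bexI[of _ "loc_class R (Scale (-1) x)"]) auto
qed (simp add: loc_lie_simps)

lemma loc_lie_module: "Module.module scalars (loc_lie R)"
proof (rule moduleI)
  fix c d X Y assume "X \<in> carrier (loc_lie R)" "Y \<in> carrier (loc_lie R)"
  then obtain x y where *: "x \<in> lie_exprs (laurent R)" "X = loc_class R x" "y \<in> lie_exprs (laurent R)" "Y = loc_class R y"
    by (metis loc_lie_cases)
  show "c \<odot>\<^bsub>loc_lie R\<^esub> (X \<oplus>\<^bsub>loc_lie R\<^esub> Y) = c \<odot>\<^bsub>loc_lie R\<^esub> X \<oplus>\<^bsub>loc_lie R\<^esub> c \<odot>\<^bsub>loc_lie R\<^esub> Y"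
    using * by (simp add: loc_lie_ops) (intro loc_class_eq lie_eq.Scale_Plus)
next
  fix c d X assume "X \<in> carrier (loc_lie R)"
  then obtain x where *: "x \<in> lie_exprs (laurent R)" "X = loc_class R x"
    by (metis loc_lie_cases)
  show "c \<odot>\<^bsub>loc_lie R\<^esub> X \<in> carrier (loc_lie R)"
    using * by (simp add: loc_lie_ops)
  show "(c \<oplus>\<^bsub>scalars\<^esub> d) \<odot>\<^bsub>loc_lie R\<^esub> X = c \<odot>\<^bsub>loc_lie R\<^esub> X \<oplus>\<^bsub>loc_lie R\<^esub> d \<odot>\<^bsub>loc_lie R\<^esub> X"
    using * by (simp add: loc_lie_ops) (intro loc_class_eq lie_eq.Scale_add)
  show "(c \<otimes>\<^bsub>scalars\<^esub> d) \<odot>\<^bsub>loc_lie R\<^esub> X = c \<odot>\<^bsub>loc_lie R\<^esub> (d \<odot>\<^bsub>loc_lie R\<^esub> X)"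
    using * by (simp add: loc_lie_ops) (intro loc_class_eq lie_eq.Scale_mult)
  show "\<one>\<^bsub>scalars\<^esub> \<odot>\<^bsub>loc_lie R\<^esub> X = X"
    using * by (simp add: loc_lie_ops) (intro loc_class_eq lie_eq.Scale_one)
qed (rule cring_scalars loc_lie_abelian_group)+

lemma loc_lie_uminus:
  assumes "x \<in> lie_exprs (laurent R)"
  shows "\<ominus>\<^bsub>loc_lie R\<^esub> loc_class R x = loc_class R (Scale (-1) x)"
proof -
  interpret L: Module.module scalars "loc_lie R" by (rule loc_lie_module)
  have "\<ominus>\<^bsub>loc_lie R\<^esub> loc_class R x = (\<ominus>\<^bsub>scalars\<^esub> \<one>\<^bsub>scalars\<^esub>) \<odot>\<^bsub>loc_lie R\<^esub> loc_class R x"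
    using assms by (subst L.smult_l_minus) (simp_all del: scalars_simps uminus_scalars add: L.smult_one)
  then show ?thesis using assms by (simp add: loc_lie_ops)
qed

lemma Gen_linear:
  "u \<in> carrier (laurent R) \<Longrightarrow> v \<in> carrier (laurent R) \<Longrightarrow>
    loc_class R (Gen (u \<oplus>\<^bsub>laurent R\<^esub> v)) = loc_class R (Gen u) \<oplus>\<^bsub>loc_lie R\<^esub> loc_class R (Gen v)"
  "v \<in> carrier (laurent R) \<Longrightarrow> loc_class R (Gen (c \<odot>\<^bsub>laurent R\<^esub> v)) = c \<odot>\<^bsub>loc_lie R\<^esub> loc_class R (Gen v)"
  "loc_class R (Gen \<zero>\<^bsub>laurent R\<^esub>) = \<zero>\<^bsub>loc_lie R\<^esub>"
  by (simp_all add: loc_lie_ops loc_lie_simps loc_class_eq lie_eq.Gen_add lie_eq.Gen_smult lie_eq_Gen_zero)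

lemma Gen_laurent_der:
  "w \<in> carrier (laurent R) \<Longrightarrow> loc_class R (Gen (laurent_der R w)) = \<zero>\<^bsub>loc_lie R\<^esub>"
  unfolding loc_lie_simps by (rule loc_class_eq[OF loc_eq_Gen_laurent_der])

lemma Gen_homog:
  "v \<in> homog (laurent R) p \<Longrightarrow> loc_class R (Gen v) \<in> homog (loc_lie R) p"
  by (auto intro!: loc_lie_homogI expr_parity.intros laurent_homog_carrier)

text \<open>The substance is that a class both even and odd is zero. Its even and odd
  representatives have normal forms of opposite parity that differ by
  \<open>laurent_der R w\<close>. As \<open>laurent_der\<close> is even, the even part of this
  equation displays the even normal form as a total derivative.\<close>

lemma loc_lie_superspace: "superspace (loc_lie R)"
proof -
  interpret L: Module.module scalars "loc_lie R" by (rule loc_lie_module)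
  have sub: "submodule (homog (loc_lie R) p) scalars (loc_lie R)" for p
  proof (rule L.submoduleI)
    show "homog (loc_lie R) p \<subseteq> carrier (loc_lie R)" by (auto simp: loc_lie_simps)
    show "\<zero>\<^bsub>loc_lie R\<^esub> \<in> homog (loc_lie R) p"
      unfolding loc_lie_simps(2) by (simp add: expr_parity.intros)
    show "\<ominus>\<^bsub>loc_lie R\<^esub> X \<in> homog (loc_lie R) p" if X: "X \<in> homog (loc_lie R) p" for X
      using X by (rule loc_lie_homog_cases) (simp add: loc_lie_uminus expr_parity.intros)
    show "c \<odot>\<^bsub>loc_lie R\<^esub> X \<in> homog (loc_lie R) p" if X: "X \<in> homog (loc_lie R) p" for c X
      using X by (rule loc_lie_homog_cases) (simp add: loc_lie_ops expr_parity.intros)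
    fix X Y assume "X \<in> homog (loc_lie R) p" "Y \<in> homog (loc_lie R) p"
    then show "X \<oplus>\<^bsub>loc_lie R\<^esub> Y \<in> homog (loc_lie R) p"
      by (elim loc_lie_homog_cases) (simp add: loc_lie_ops expr_parity.intros)
  qed
  have zero: "X = \<zero>\<^bsub>loc_lie R\<^esub>" if X01: "X \<in> homog (loc_lie R) 0" "X \<in> homog (loc_lie R) 1" for X
  proof -
    obtain x where x: "x \<in> lie_exprs (laurent R)" "expr_parity (laurent R) 0 x" "X = loc_class R x"
      by (rule loc_lie_homog_cases[OF X01(1)])
    obtain y where y: "y \<in> lie_exprs (laurent R)" "expr_parity (laurent R) 1 y" "X = loc_class R y"
      by (rule loc_lie_homog_cases[OF X01(2)])
    have "loc_eq R x y" using x y lie_class_eq_iff by metis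
    then obtain w where w: "w \<in> carrier (laurent R)" "nf x = nf y \<oplus>\<^bsub>laurent R\<^esub> laurent_der R w"
      using nf_loc_eq by blast
    let ?w = "\<lambda>p. hcomp p \<circ> w"
    have wp: "?w p \<in> homog (laurent R) p" for p using laurent_hcomp[OF w(1)] by blast
    note wc = wp[THEN laurent_homog_carrier]
    have dw: "laurent_der R w = laurent_der R (?w 0) \<oplus>\<^bsub>laurent R\<^esub> laurent_der R (?w 1)"
      by (subst laurent_hcomp(2)[OF w(1)]) (rule laurent_der_add[OF wc wc])
    \<comment> \<open>The added zero is the odd part of \<open>nf x t\<close>; it puts the equation
      into the form of two decompositions into an even and an odd summand.\<close>
    have "nf x t = laurent_der R (?w 0) t" for t
    proof (rule homog_decomp_unique(1)[of _ "\<zero>" _ "nf y t \<oplus> laurent_der R (?w 1) t" 0 1])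
      have t: "nf x t \<in> homog R 0" "nf y t \<in> homog R 1"
        using nf_parity x(2) y(2) by (auto simp: laurent_simps)
      have d: "laurent_der R (?w p) t \<in> homog R p" for p
        using laurent_der_homog[OF wp] by (auto simp: laurent_simps)
      show "nf x t \<in> homog R 0" "laurent_der R (?w 0) t \<in> homog R 0" "nf y t \<oplus> laurent_der R (?w 1) t \<in> homog R 1"
        by (intro t d homog_closed)+
      show "nf x t \<oplus> \<zero> = laurent_der R (?w 0) t \<oplus> (nf y t \<oplus> laurent_der R (?w 1) t)"
        using t[THEN homogD] d[THEN homogD] by (simp add: w(2) dw laurent_simps a_ac)
    qed auto
    then have "nf x = laurent_der R (?w 0)" by blast
    then show ?thesis using x(1,3) loc_class_nf Gen_laurent_der[OF wc] by metis
  qed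
  show ?thesis
  proof (intro superspace.intro loc_lie_module superspace_axioms.intro)
    show "submodule (homog (loc_lie R) p) scalars (loc_lie R)" for p by (rule sub)
    show "homog (loc_lie R) 0 \<inter> homog (loc_lie R) 1 = {\<zero>\<^bsub>loc_lie R\<^esub>}"
    proof -
      have "\<zero>\<^bsub>loc_lie R\<^esub> \<in> homog (loc_lie R) p" for p
        unfolding loc_lie_simps(2) by (simp add: expr_parity.intros)
      then show ?thesis using zero by blast
    qed
    have "X \<in> homog (loc_lie R) 0 <+>\<^bsub>loc_lie R\<^esub> homog (loc_lie R) 1" if X: "X \<in> carrier (loc_lie R)" for X
    proof -
      obtain x where x: "x \<in> lie_exprs (laurent R)" "X = loc_class R x" by (rule loc_lie_cases[OF X])
      let ?u = "\<lambda>p. hcomp p \<circ> nf x"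
      have u: "?u p \<in> homog (laurent R) p" for p using laurent_hcomp[OF nf_closed] by blast
      have "X = loc_class R (Gen (?u 0 \<oplus>\<^bsub>laurent R\<^esub> ?u 1))"
        unfolding laurent_hcomp(2)[OF nf_closed, symmetric] using x(2) loc_class_nf[OF x(1)] by (rule HOL.trans)
      also have "\<dots> = loc_class R (Gen (?u 0)) \<oplus>\<^bsub>loc_lie R\<^esub> loc_class R (Gen (?u 1))"
        by (intro Gen_linear laurent_homog_carrier[OF u])
      finally show ?thesis using Gen_homog[OF u] by (auto simp: set_add_def')
    qed
    moreover have "homog (loc_lie R) p \<subseteq> carrier (loc_lie R)" for p
      by (auto simp: loc_lie_simps)
    ultimately show "carrier (loc_lie R) = homog (loc_lie R) 0 <+>\<^bsub>loc_lie R\<^esub> homog (loc_lie R) 1"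
      by (auto simp: set_add_def' subset_iff intro!: L.a_closed)
  qed
qed

text \<open>The Lie axioms are rules of \<open>lie_eq\<close>, and the Leibniz rule is the clause of
  \<open>expr_der\<close> for brackets.\<close>

lemma loc_lie_differential: "differential_lie_algebra (loc_lie R)"
proof -
  interpret L: superspace "loc_lie R" by (rule loc_lie_superspace)
  note parity_intros = expr_parity.intros
  show ?thesis
  proof
    show "even_linear (loc_lie R) (loc_lie R) (der (loc_lie R))"
      unfolding even_linear_def
    proof (intro conjI ballI allI)
      show "der (loc_lie R) \<in> carrier (loc_lie R) \<rightarrow> carrier (loc_lie R)"
        by (auto elim!: loc_lie_cases simp: loc_lie_ops)
      show "der (loc_lie R) ` homog (loc_lie R) p \<subseteq> homog (loc_lie R) p" for p
        by (auto elim!: loc_lie_homog_cases simp: loc_lie_ops intro!: loc_lie_homogI expr_parity_der der_comp_laurent_homog)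
    qed (auto elim!: loc_lie_cases simp: loc_lie_ops)
    show "even_bilinear (loc_lie R) (monoid.mult (loc_lie R))"
      unfolding even_bilinear_def
    proof (intro conjI ballI allI)
      fix p r X Y assume "X \<in> homog (loc_lie R) p" "Y \<in> homog (loc_lie R) r"
      then show "X \<otimes>\<^bsub>loc_lie R\<^esub> Y \<in> homog (loc_lie R) (p + r)"
        by (elim loc_lie_homog_cases) (simp add: loc_lie_ops loc_lie_homogI[OF _ expr_parity.intros(5)] del: add_bit_eq_xor)
    qed (auto elim!: loc_lie_cases simp: loc_lie_ops loc_class_eq[OF lie_eq.Bracket_Plus_left]
        loc_class_eq[OF lie_eq.Bracket_Plus_right] loc_class_eq[OF lie_eq.Bracket_Scale_left]
        loc_class_eq[OF lie_eq.Bracket_Scale_right])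
    fix p r X Y
    assume "X \<in> homog (loc_lie R) p" "Y \<in> homog (loc_lie R) r"
    then obtain x y where *: "x \<in> lie_exprs (laurent R)" "expr_parity (laurent R) p x" "X = loc_class R x"
      "y \<in> lie_exprs (laurent R)" "expr_parity (laurent R) r y" "Y = loc_class R y"
      by (metis loc_lie_homog_cases)
    have sc: "\<ominus>\<^bsub>loc_lie R\<^esub> (c \<odot>\<^bsub>loc_lie R\<^esub> loc_class R e) = loc_class R (Scale (- c) e)"
      if "e \<in> lie_exprs (laurent R)" for c e
      using that by (simp add: loc_lie_ops L.scalar_distrib flip: loc_lie_ops(1))
    show "X \<otimes>\<^bsub>loc_lie R\<^esub> Y = \<ominus>\<^bsub>loc_lie R\<^esub> (parity_sign p r \<odot>\<^bsub>loc_lie R\<^esub> (Y \<otimes>\<^bsub>loc_lie R\<^esub> X))"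
      using * by (simp add: loc_lie_ops(4) sc) (intro loc_class_eq lie_eq.skew)
    fix Z assume "Z \<in> carrier (loc_lie R)"
    then obtain z where z: "z \<in> lie_exprs (laurent R)" "Z = loc_class R z" by (rule loc_lie_cases)
    show "X \<otimes>\<^bsub>loc_lie R\<^esub> Y \<otimes>\<^bsub>loc_lie R\<^esub> Z = X \<otimes>\<^bsub>loc_lie R\<^esub> (Y \<otimes>\<^bsub>loc_lie R\<^esub> Z)
        \<ominus>\<^bsub>loc_lie R\<^esub> parity_sign p r \<odot>\<^bsub>loc_lie R\<^esub> (Y \<otimes>\<^bsub>loc_lie R\<^esub> (X \<otimes>\<^bsub>loc_lie R\<^esub> Z))"
      unfolding L.minus_eq using * z
      by (simp add: loc_lie_ops(4) sc) (simp add: loc_lie_ops(3), intro loc_class_eq lie_eq.jacobi)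
  next
    fix X Y assume "X \<in> carrier (loc_lie R)" "Y \<in> carrier (loc_lie R)"
    then show "der (loc_lie R) (X \<otimes>\<^bsub>loc_lie R\<^esub> Y)
        = der (loc_lie R) X \<otimes>\<^bsub>loc_lie R\<^esub> Y \<oplus>\<^bsub>loc_lie R\<^esub> X \<otimes>\<^bsub>loc_lie R\<^esub> der (loc_lie R) Y"
      by (elim loc_lie_cases) (simp add: loc_lie_ops)
  qed
qed

end

section \<open>Fields\<close>

lemma submodule_scalarsI:
  assumes "Module.module scalars V" "S \<subseteq> carrier V" "\<zero>\<^bsub>V\<^esub> \<in> S"
    and "\<And>a b. a \<in> S \<Longrightarrow> b \<in> S \<Longrightarrow> a \<oplus>\<^bsub>V\<^esub> b \<in> S" "\<And>c a. a \<in> S \<Longrightarrow> c \<odot>\<^bsub>V\<^esub> a \<in> S"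
  shows "submodule S scalars V"
proof -
  interpret Module.module scalars V by (rule assms)
  show ?thesis
  proof (rule submoduleI)
    fix a assume a: "a \<in> S"
    then have "a \<in> carrier V" using assms(2) by blast
    then have "(- 1) \<odot>\<^bsub>V\<^esub> a = \<ominus>\<^bsub>V\<^esub> a"
      using smult_l_minus[of 1 a] smult_one[of a] by simp
    then show "\<ominus>\<^bsub>V\<^esub> a \<in> S" using assms(5)[OF a, of "- 1"] by simp
  qed (use assms in auto)
qed

lemma distributions_simps:
  "carrier (distributions \<gg>) = {a. \<forall>t. a t \<in> carrier \<gg>}"
  "\<zero>\<^bsub>distributions \<gg>\<^esub> = (\<lambda>t. \<zero>\<^bsub>\<gg>\<^esub>)"
  "a \<oplus>\<^bsub>distributions \<gg>\<^esub> b = (\<lambda>t. a t \<oplus>\<^bsub>\<gg>\<^esub> b t)"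
  "c \<odot>\<^bsub>distributions \<gg>\<^esub> a = (\<lambda>t. c \<odot>\<^bsub>\<gg>\<^esub> a t)"
  "homog (distributions \<gg>) p = {a. \<forall>t. a t \<in> homog \<gg> p}"
  "der (distributions \<gg>) = dist_deriv \<gg>"
  "nprod (distributions \<gg>) n a b = res_z ((mult_z_minus_w \<gg> ^^ n) (dist_bracket \<gg> a b))"
  by (simp_all add: distributions_def)

lemma (in kt_module) distributions_module: "Module.module scalars (distributions V)"
proof (rule moduleI)
  show "abelian_group (distributions V)"
  proof (rule abelian_groupI)
    fix a assume a: "a \<in> carrier (distributions V)"
    then have "(\<lambda>t. \<ominus> a t) \<in> carrier (distributions V)" "(\<lambda>t. \<ominus> a t) \<oplus>\<^bsub>distributions V\<^esub> a = \<zero>\<^bsub>distributions V\<^esub>"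
      by (auto simp: distributions_simps l_neg)
    then show "\<exists>b\<in>carrier (distributions V). b \<oplus>\<^bsub>distributions V\<^esub> a = \<zero>\<^bsub>distributions V\<^esub>" by blast
  qed (auto simp: distributions_simps a_ac)
qed (auto simp: distributions_simps cring_scalars scalar_distrib)

context vertex_lie_algebra
begin

definition field_of :: "'a \<Rightarrow> int \<Rightarrow> ('k, int \<Rightarrow> 'a) lie_expr set"
  where "field_of a = (\<lambda>t. loc_class R (Gen (monomial R a t)))"

lemma gen_fields_eq: "gen_fields (loc_lie R) = field_of ` carrier R"
  by (auto simp: loc_lie_simps field_of_def)

lemma field_of_linear:
  "a \<in> carrier R \<Longrightarrow> b \<in> carrier R \<Longrightarrow> field_of (a \<oplus> b) = field_of a \<oplus>\<^bsub>distributions (loc_lie R)\<^esub> field_of b"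
  "a \<in> carrier R \<Longrightarrow> field_of (c \<odot> a) = c \<odot>\<^bsub>distributions (loc_lie R)\<^esub> field_of a"
  "field_of \<zero> = \<zero>\<^bsub>distributions (loc_lie R)\<^esub>"
proof -
  show "a \<in> carrier R \<Longrightarrow> b \<in> carrier R \<Longrightarrow> field_of (a \<oplus> b) = field_of a \<oplus>\<^bsub>distributions (loc_lie R)\<^esub> field_of b"
    by (simp add: field_of_def distributions_simps monomial_linear Gen_linear)
  show smult: "a \<in> carrier R \<Longrightarrow> field_of (c \<odot> a) = c \<odot>\<^bsub>distributions (loc_lie R)\<^esub> field_of a" for a c
    by (simp add: field_of_def distributions_simps monomial_linear Gen_linear)
  have "monomial R \<zero> t = \<zero>\<^bsub>laurent R\<^esub>" for t by (auto simp: monomial_def laurent_simps)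
  then show "field_of \<zero> = \<zero>\<^bsub>distributions (loc_lie R)\<^esub>"
    by (simp add: field_of_def distributions_simps Gen_linear)
qed

lemma monomial_homog: "a \<in> homog R p \<Longrightarrow> monomial R a t \<in> homog (laurent R) p"
  using laurent_closed(4)[OF homogD, of a p t] by (auto simp: laurent_simps monomial_def)

lemma field_of_closed [simp]: "a \<in> carrier R \<Longrightarrow> field_of a \<in> carrier (distributions (loc_lie R))"
  by (simp add: field_of_def distributions_simps)

lemma field_of_homog: "a \<in> homog R p \<Longrightarrow> field_of a \<in> homog (distributions (loc_lie R)) p"
  by (simp add: field_of_def distributions_simps Gen_homog monomial_homog)

lemma field_of_der:
  assumes "a \<in> carrier R"
  shows "field_of (der R a) = der (distributions (loc_lie R)) (field_of a)"
    and "(\<lambda>t. der (loc_lie R) (field_of a t)) = dist_deriv (loc_lie R) (field_of a)"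
proof -
  show *: "field_of (der R a) = der (distributions (loc_lie R)) (field_of a)"
    unfolding distributions_simps field_of_def dist_deriv_def
    using assms by (auto simp: loc_lie_ops intro!: ext loc_class_eq loc_eq_der_relation)
  have "(\<lambda>t. der (loc_lie R) (field_of a t)) = field_of (der R a)"
    using assms by (auto simp: field_of_def loc_lie_ops der_comp_monomial)
  then show "(\<lambda>t. der (loc_lie R) (field_of a t)) = dist_deriv (loc_lie R) (field_of a)"
    using * by (simp add: distributions_simps)
qed

text \<open>The coefficient at \<open>z\<^sup>-\<^sup>s\<^sup>-\<^sup>1 w\<^sup>-\<^sup>t\<^sup>-\<^sup>1\<close> of \<open>(z - w)\<^sup>n [a(z), b(w)]\<close>.\<close>

definition shifted_bracket :: "nat \<Rightarrow> 'a \<Rightarrow> 'a \<Rightarrow> int \<Rightarrow> int \<Rightarrow> int \<Rightarrow> 'a"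
  where "shifted_bracket n a b s t = (\<lambda>m. if m \<le> s + t
    then (of_int s gchoose nat (s + t - m)) \<odot> nprod R (n + nat (s + t - m)) a b else \<zero>)"

lemma shifted_bracket_closed [simp]:
  assumes "a \<in> carrier R" "b \<in> carrier R"
  shows "shifted_bracket n a b s t \<in> carrier (laurent R)"
proof -
  have "{m. shifted_bracket n a b s t m \<noteq> \<zero>} \<subseteq> (\<lambda>i. s + t + int n - int i) ` {i. nprod R i a b \<noteq> \<zero>}"
  proof
    fix m assume "m \<in> {m. shifted_bracket n a b s t m \<noteq> \<zero>}"
    then have m: "m \<le> s + t" "nprod R (n + nat (s + t - m)) a b \<noteq> \<zero>"
      by (auto simp: shifted_bracket_def split: if_splits)
    then have "m = s + t + int n - int (n + nat (s + t - m))" by simp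
    then show "m \<in> (\<lambda>i. s + t + int n - int i) ` {i. nprod R i a b \<noteq> \<zero>}" using m(2) by blast
  qed
  then have "finite {m. shifted_bracket n a b s t m \<noteq> \<zero>}"
    by (rule finite_subset) (intro finite_imageI nprod_finite assms)
  then show ?thesis using assms by (auto simp: laurent_simps shifted_bracket_def)
qed

text \<open>Distinct indices give distinct exponents, so every coefficient receives at most one
  term. In this pointwise form, sums over different index sets can be compared directly.\<close>

lemma laurent_finsum:
  assumes "finite B" "\<And>i. x i \<in> carrier R"
  shows "(\<Oplus>\<^bsub>laurent R\<^esub>i\<in>B. c i \<odot>\<^bsub>laurent R\<^esub> monomial R (x i) (N - int i))
    = (\<lambda>m. if m \<le> N \<and> nat (N - m) \<in> B then c (nat (N - m)) \<odot> x (nat (N - m)) else \<zero>)"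
proof -
  interpret L: abelian_group "laurent R" by (rule laurent_abelian_group)
  from assms(1) show ?thesis
  proof induction
    case empty
    then show ?case by (simp add: laurent_simps)
  next
    case (insert i B)
    have "(\<Oplus>\<^bsub>laurent R\<^esub>i\<in>insert i B. c i \<odot>\<^bsub>laurent R\<^esub> monomial R (x i) (N - int i))
      = c i \<odot>\<^bsub>laurent R\<^esub> monomial R (x i) (N - int i) \<oplus>\<^bsub>laurent R\<^esub>
        (\<Oplus>\<^bsub>laurent R\<^esub>i\<in>B. c i \<odot>\<^bsub>laurent R\<^esub> monomial R (x i) (N - int i))"
      using insert assms(2) by (intro L.finsum_insert) auto
    also have "\<dots> = (\<lambda>m. if m \<le> N \<and> nat (N - m) \<in> insert i B then c (nat (N - m)) \<odot> x (nat (N - m)) else \<zero>)"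
    proof
      fix m
      have "m = N - int i \<longleftrightarrow> m \<le> N \<and> nat (N - m) = i" by auto
      then show "(c i \<odot>\<^bsub>laurent R\<^esub> monomial R (x i) (N - int i) \<oplus>\<^bsub>laurent R\<^esub>
        (\<Oplus>\<^bsub>laurent R\<^esub>i\<in>B. c i \<odot>\<^bsub>laurent R\<^esub> monomial R (x i) (N - int i))) m
        = (if m \<le> N \<and> nat (N - m) \<in> insert i B then c (nat (N - m)) \<odot> x (nat (N - m)) else \<zero>)"
        unfolding insert.IH using insert.hyps assms(2)
        by (auto simp: laurent_simps monomial_def)
    qed
    finally show ?case .
  qed
qed

section \<open>Commutators, locality and injectivity of fields\<close>

lemma Bracket_field_of:
  assumes "a \<in> carrier R" "b \<in> carrier R"
  shows "field_of a s \<otimes>\<^bsub>loc_lie R\<^esub> field_of b t = loc_class R (Gen (shifted_bracket 0 a b s t))"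
proof -
  let ?S = "\<Oplus>\<^bsub>laurent R\<^esub>i\<in>{i. nprod R i a b \<noteq> \<zero>}.
        (of_int s gchoose i) \<odot>\<^bsub>laurent R\<^esub> monomial R (nprod R i a b) (s + t - int i)"
  have S: "?S = shifted_bracket 0 a b s t"
    using assms by (subst laurent_finsum) (auto simp: nprod_finite shifted_bracket_def)
  have "loc_eq R (Bracket (Gen (monomial R a s)) (Gen (monomial R b t))) (Gen ?S)"
  proof (rule lie_eq.rel)
    show "(Bracket (Gen (monomial R a s)) (Gen (monomial R b t)), Gen ?S) \<in> loc_rels R"
      unfolding loc_rels_def using assms by blast
  qed (use assms S in auto)
  then show ?thesis unfolding S field_of_def using assms by (simp add: loc_lie_ops loc_class_eq)
qed

text \<open>Pascal's rule for \<open>s + 1\<close>. At the top exponent \<open>m = s + t + 1\<close>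
  only the leading product with index \<open>n\<close> is present, with coefficient 1 on both
  sides.\<close>

lemma shifted_bracket_Suc:
  assumes "a \<in> carrier R" "b \<in> carrier R"
  shows "shifted_bracket n a b (s + 1) t
    = shifted_bracket n a b s (t + 1) \<oplus>\<^bsub>laurent R\<^esub> shifted_bracket (Suc n) a b s t"
proof
  fix m
  consider "m \<le> s + t" | "m = s + t + 1" | "m > s + t + 1" by linarith
  then show "shifted_bracket n a b (s + 1) t m
    = (shifted_bracket n a b s (t + 1) \<oplus>\<^bsub>laurent R\<^esub> shifted_bracket (Suc n) a b s t) m"
  proof cases
    case 1
    then have e: "nat (s + 1 + t - m) = Suc (nat (s + t - m))" "nat (s + (t + 1) - m) = Suc (nat (s + t - m))"
      by auto
    show ?thesis using 1 assms
      by (simp add: shifted_bracket_def laurent_simps e gbinomial_Suc_Suc scalar_distrib a_comm)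
  qed (use assms in \<open>auto simp: shifted_bracket_def laurent_simps\<close>)
qed

lemma mult_z_minus_w_field_of:
  assumes "a \<in> carrier R" "b \<in> carrier R"
  shows "(mult_z_minus_w (loc_lie R) ^^ n) (dist_bracket (loc_lie R) (field_of a) (field_of b))
    = (\<lambda>s t. loc_class R (Gen (shifted_bracket n a b s t)))"
proof (induction n)
  case 0
  then show ?case using assms by (simp add: dist_bracket_def Bracket_field_of)
next
  case (Suc n)
  interpret L: superspace "loc_lie R" by (rule loc_lie_superspace)
  have cancel: "(X \<oplus>\<^bsub>loc_lie R\<^esub> Y) \<ominus>\<^bsub>loc_lie R\<^esub> X = Y"
    if "X \<in> carrier (loc_lie R)" "Y \<in> carrier (loc_lie R)" for X Y
    using that by (simp add: L.minus_eq L.a_comm[of X Y] L.a_assoc L.r_neg)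
  have "loc_class R (Gen (shifted_bracket n a b (s + 1) t)) \<ominus>\<^bsub>loc_lie R\<^esub> loc_class R (Gen (shifted_bracket n a b s (t + 1)))
    = loc_class R (Gen (shifted_bracket (Suc n) a b s t))" for s t
    unfolding shifted_bracket_Suc[OF assms]
    by (subst Gen_linear) (use assms in \<open>simp_all add: cancel\<close>)
  then show ?case unfolding funpow.simps comp_apply Suc.IH by (simp add: mult_z_minus_w_def)
qed

text \<open>The residue in \<open>z\<close> sets \<open>s = 0\<close>, and
  \<open>0 gchoose i\<close> vanishes for \<open>i > 0\<close>; one product survives.\<close>

lemma field_of_nprod:
  assumes "a \<in> carrier R" "b \<in> carrier R"
  shows "field_of (nprod R n a b) = nprod (distributions (loc_lie R)) n (field_of a) (field_of b)"
proof -
  have "shifted_bracket n a b 0 t = monomial R (nprod R n a b) t" for t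
  proof
    fix m
    consider "m < t" | "m = t" | "m > t" by linarith
    then show "shifted_bracket n a b 0 t m = monomial R (nprod R n a b) t m"
    proof cases
      case 1
      then have "nat (t - m) \<noteq> 0" by simp
      then obtain k where "nat (t - m) = Suc k" by (rule not0_implies_Suc[THEN exE])
      then show ?thesis using 1 assms by (simp add: shifted_bracket_def monomial_def)
    qed (use assms in \<open>auto simp: shifted_bracket_def monomial_def\<close>)
  qed
  then show ?thesis unfolding distributions_simps mult_z_minus_w_field_of[OF assms] res_z_def
    by (simp add: field_of_def)
qed

text \<open>Each factor \<open>z - w\<close> raises the product index by one, and beyond the last
  nonzero product nothing is left.\<close>

lemma field_of_local:
  assumes "a \<in> carrier R" "b \<in> carrier R"
  shows "local_pair (loc_lie R) (field_of a) (field_of b)"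
proof -
  obtain n where n: "\<forall>i\<in>{i. nprod R i a b \<noteq> \<zero>}. i < n"
    using nprod_finite[OF assms] unfolding finite_nat_set_iff_bounded by blast
  have "nprod R (n + k) a b = \<zero>" for k
  proof (rule ccontr)
    assume "nprod R (n + k) a b \<noteq> \<zero>"
    then have "n + k < n" using n by blast
    then show False by simp
  qed
  then have "shifted_bracket n a b s t = \<zero>\<^bsub>laurent R\<^esub>" for s t
    by (auto simp: shifted_bracket_def laurent_simps)
  then show ?thesis
    unfolding local_pair_def mult_z_minus_w_field_of[OF assms]
    by (intro exI[of _ n]) (simp add: Gen_linear)
qed

text \<open>Comparing lowest terms in \<open>a x\<^sup>-\<^sup>1 - b x\<^sup>-\<^sup>1 = (T + \<partial>\<^sub>x) w\<close> shows that \<open>w\<close>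
  has no terms of degree below \<open>0\<close>.\<close>

lemma field_of_inj:
  assumes "a \<in> carrier R" "b \<in> carrier R" "field_of a = field_of b"
  shows "a = b"
proof -
  \<comment> \<open>At exponent \<open>-1\<close> the term from \<open>\<partial>\<^sub>x\<close> is
    \<open>0 * w_0\<close>. The class there can be zero only through \<open>T w_{-1}\<close>, and
    \<open>w_{-1}\<close> is shown to vanish.\<close>
  have "loc_class R (Gen (monomial R a (-1))) = loc_class R (Gen (monomial R b (-1)))"
    using assms(3) unfolding field_of_def by meson
  then have "loc_eq R (Gen (monomial R a (-1))) (Gen (monomial R b (-1)))"
    using assms by (subst (asm) lie_class_eq_iff) auto
  then obtain w where w: "w \<in> carrier (laurent R)"
    "monomial R a (-1) = monomial R b (-1) \<oplus>\<^bsub>laurent R\<^esub> laurent_der R w"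
    using nf_loc_eq assms by (fastforce simp: nf_Gen)
  have wc: "w t \<in> carrier R" for t using w(1) by (simp add: laurent_simps)
  have eq: "monomial R a (-1) t = monomial R b (-1) t \<oplus> (der R (w t) \<oplus> of_int (t + 1) \<odot> w (t + 1))" for t
    using fun_cong[OF w(2), of t] by (simp add: laurent_simps laurent_der_def)
  have "finite {t. w t \<noteq> \<zero>}" using w(1) by (simp add: laurent_simps)
  then obtain N where N: "\<And>t. t \<le> N \<Longrightarrow> w t = \<zero>"
  proof (cases "{t. w t \<noteq> \<zero>} = {}")
    case False
    assume fin: "finite {t. w t \<noteq> \<zero>}"
    show thesis
    proof (rule that[of "Min {t. w t \<noteq> \<zero>} - 1"])
      fix t assume t: "t \<le> Min {t. w t \<noteq> \<zero>} - 1"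
      show "w t = \<zero>"
      proof (rule ccontr)
        assume "w t \<noteq> \<zero>"
        then have "Min {t. w t \<noteq> \<zero>} \<le> t" using fin by (intro Min_le) auto
        then show False using t by simp
      qed
    qed
  qed auto
  \<comment> \<open>Upward induction from below the support: for \<open>t < -1\<close> the
    coefficient equation with \<open>w t = 0\<close> reads \<open>(t + 1) w_{t+1} = 0\<close>, and
    \<open>t + 1\<close> is invertible in characteristic 0.\<close>
  have w0: "t \<le> - 1 \<Longrightarrow> w t = \<zero>" for t
  proof (cases "t \<le> N")
    case False
    then have "N \<le> t" by simp
    then show "t \<le> - 1 \<Longrightarrow> w t = \<zero>"
    proof (induction t rule: int_ge_induct)
      case (step t)
      then have "w t = \<zero>" "t < -1" by auto
      then have "of_int (t + 1) \<odot> w (t + 1) = \<zero>"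
        using eq[of t] wc by (simp add: monomial_def)
      then have "(1 / of_int (t + 1)) \<odot> (of_int (t + 1) \<odot> w (t + 1)) = \<zero>" by simp
      moreover have "(of_int (t + 1) :: 'k) \<noteq> 0" using \<open>t < -1\<close> by (simp del: of_int_add)
      ultimately show ?case using wc by (simp add: scalar_distrib(3)[symmetric] del: of_int_add)
    qed (use N in auto)
  qed (use N in auto)
  show ?thesis using eq[of "-1"] w0[of "-1"] wc[of 0] assms by (simp add: monomial_def)
qed

section \<open>Closure of the generating fields and linear generation\<close>

lemma fields_conformal_subalgebra:
  "conformal_subalgebra (distributions (loc_lie R)) (gen_fields (loc_lie R))"
  unfolding conformal_subalgebra_def gen_fields_eq
proof (intro conjI allI ballI)
  interpret L: differential_lie_algebra "loc_lie R" by (rule loc_lie_differential)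
  show "submodule (field_of ` carrier R) scalars (distributions (loc_lie R))"
  proof (rule submodule_scalarsI[OF L.distributions_module])
    show "\<zero>\<^bsub>distributions (loc_lie R)\<^esub> \<in> field_of ` carrier R"
      using field_of_linear(3) by (metis image_eqI zero_closed)
  qed (auto simp flip: field_of_linear)
  show "graded_subset (distributions (loc_lie R)) (field_of ` carrier R)"
    unfolding graded_subset_def
  proof (intro conjI ballI)
    fix v assume "v \<in> field_of ` carrier R"
    then obtain a where a: "a \<in> carrier R" "v = field_of a" by auto
    obtain y z where yz: "y \<in> homog R 0" "z \<in> homog R 1" "a = y \<oplus> z" by (rule homog_decomp[OF a(1)])
    show "\<exists>x\<in>field_of ` carrier R \<inter> homog (distributions (loc_lie R)) 0.
      \<exists>y\<in>field_of ` carrier R \<inter> homog (distributions (loc_lie R)) 1. v = x \<oplus>\<^bsub>distributions (loc_lie R)\<^esub> y"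
      using yz a field_of_homog[OF yz(1)] field_of_homog[OF yz(2)]
      by (intro bexI[of _ "field_of y"] bexI[of _ "field_of z"]) (auto simp: homogD field_of_linear)
  qed auto
qed (auto simp flip: field_of_der(1) field_of_nprod)

lemma conformal_closure_fields:
  "conformal_closure (distributions (loc_lie R)) (gen_fields (loc_lie R)) = gen_fields (loc_lie R)"
  unfolding conformal_closure_def using fields_conformal_subalgebra by blast

text \<open>By normal forms every class is that of a single generator, hence a sum of monomials. The
  coefficients of the fields therefore span linearly, without brackets among them.\<close>

lemma loc_lie_generated:
  assumes "submodule S scalars (loc_lie R)" "\<And>a t. a \<in> carrier R \<Longrightarrow> field_of a t \<in> S" "X \<in> carrier (loc_lie R)"
  shows "X \<in> S"
proof -
  interpret L: superspace "loc_lie R" by (rule loc_lie_superspace)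
  obtain x where x: "x \<in> lie_exprs (laurent R)" "X = loc_class R x" by (rule loc_lie_cases[OF assms(3)])
  have "loc_class R (Gen v) \<in> S" if "v \<in> carrier (laurent R)" for v
    using that
  proof (induction rule: laurent_induct)
    case zero
    have "\<zero>\<^bsub>loc_lie R\<^esub> \<in> S"
      using subgroup.one_closed[OF submodule.axioms(1)[OF assms(1)]] by simp
    then show ?case by (simp add: Gen_linear)
  next
    case (monomial a t)
    then show ?case using assms(2) by (simp add: field_of_def)
  next
    case (add u v)
    then show ?case using L.submoduleE(5)[OF assms(1)] by (simp add: Gen_linear)
  qed
  then show ?thesis using x loc_class_nf[OF x(1)] by simp
qed

lemma loc_lie_local: "local_lie_algebra (loc_lie R)"
proof (intro local_lie_algebra.intro loc_lie_differential local_lie_algebra_axioms.intro)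
  interpret L: superspace "loc_lie R" by (rule loc_lie_superspace)
  show "graded_subset (distributions (loc_lie R)) (gen_fields (loc_lie R))"
    using fields_conformal_subalgebra by (simp add: conformal_subalgebra_def)
  show "local_pair (loc_lie R) a b" if "a \<in> gen_fields (loc_lie R)" "b \<in> gen_fields (loc_lie R)" for a b
    using that field_of_local by (auto simp: gen_fields_eq)
  show "(\<lambda>t. der (loc_lie R) (a t)) = dist_deriv (loc_lie R) a" if "a \<in> gen_fields (loc_lie R)" for a
    using that field_of_der(2) by (auto simp: gen_fields_eq)
  have "linear_span (loc_lie R) {a t |a t. a \<in> gen_fields (loc_lie R)} \<subseteq> carrier (loc_lie R)"
    unfolding linear_span_def
  proof (rule Inter_lower)
    have "{a t |a t. a \<in> gen_fields (loc_lie R)} \<subseteq> carrier (loc_lie R)"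
      using field_of_closed by (auto simp: gen_fields_eq distributions_simps)
    then show "carrier (loc_lie R) \<in> {H. submodule H scalars (loc_lie R) \<and> {a t |a t. a \<in> gen_fields (loc_lie R)} \<subseteq> H}"
      using L.carrier_is_submodule by (intro CollectI conjI)
  qed
  moreover have "carrier (loc_lie R) \<subseteq> linear_span (loc_lie R) {a t |a t. a \<in> gen_fields (loc_lie R)}"
    unfolding linear_span_def gen_fields_eq
  proof (intro subsetI InterI)
    fix X S assume X: "X \<in> carrier (loc_lie R)"
      and S: "S \<in> {S. submodule S scalars (loc_lie R) \<and> {a t |a t. a \<in> field_of ` carrier R} \<subseteq> S}"
    show "X \<in> S" by (rule loc_lie_generated[OF _ _ X]) (use S in blast)+
  qed
  ultimately show "carrier (loc_lie R) = linear_span (loc_lie R) {a t |a t. a \<in> gen_fields (loc_lie R)}"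
    by (rule equalityI[rotated])
qed

end

section \<open>Morphisms of local Lie algebras\<close>

lemma even_linear_zero:
  assumes "superspace V" "superspace W" "even_linear V W f"
  shows "f \<zero>\<^bsub>V\<^esub> = \<zero>\<^bsub>W\<^esub>"
proof -
  interpret V: superspace V by (rule assms)
  interpret W: superspace W by (rule assms)
  have "f (0 \<odot>\<^bsub>V\<^esub> \<zero>\<^bsub>V\<^esub>) = 0 \<odot>\<^bsub>W\<^esub> f \<zero>\<^bsub>V\<^esub>" "f \<zero>\<^bsub>V\<^esub> \<in> carrier W"
    using assms(3) V.zero_closed unfolding even_linear_def by blast+
  then show ?thesis by simp
qed

lemma even_linearD:
  assumes "even_linear V W f"
  shows "x \<in> carrier V \<Longrightarrow> f x \<in> carrier W"
    and "x \<in> carrier V \<Longrightarrow> y \<in> carrier V \<Longrightarrow> f (x \<oplus>\<^bsub>V\<^esub> y) = f x \<oplus>\<^bsub>W\<^esub> f y"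
    and "x \<in> carrier V \<Longrightarrow> f (c \<odot>\<^bsub>V\<^esub> x) = c \<odot>\<^bsub>W\<^esub> f x"
    and "x \<in> homog V p \<Longrightarrow> f x \<in> homog W p"
  using assms unfolding even_linear_def by blast+

lemma even_linear_minus:
  assumes "superspace V" "superspace W" "even_linear V W f" "x \<in> carrier V" "y \<in> carrier V"
  shows "f (x \<ominus>\<^bsub>V\<^esub> y) = f x \<ominus>\<^bsub>W\<^esub> f y"
proof -
  interpret V: superspace V by (rule assms)
  interpret W: superspace W by (rule assms)
  have "f (\<ominus>\<^bsub>V\<^esub> y) = \<ominus>\<^bsub>W\<^esub> f y"
    using even_linearD(3)[OF assms(3,5), of "-1"] even_linearD(1)[OF assms(3,5)] assms(5)
    by (simp add: V.scalar_distrib W.scalar_distrib)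
  then show ?thesis using assms(4,5) by (simp add: V.minus_eq W.minus_eq even_linearD[OF assms(3)])
qed

lemma even_linear_compose:
  assumes "superspace V" "even_linear V W f" "even_linear W U g"
  shows "even_linear V U (compose (carrier V) g f)"
proof -
  interpret V: superspace V by (rule assms)
  show ?thesis
    unfolding even_linear_def
    by (auto simp: compose_def V.homogD intro: even_linearD[OF assms(2)] even_linearD[OF assms(3)]
        simp: even_linearD[OF assms(2)] even_linearD[OF assms(3)])
qed

lemma even_linear_id:
  assumes "superspace V"
  shows "even_linear V V (\<lambda>x\<in>carrier V. x)"
proof -
  interpret V: superspace V by (rule assms)
  show ?thesis unfolding even_linear_def by (auto simp: V.homogD)
qed

lemma mult_z_minus_w_closed:
  assumes "superspace \<gg>" "\<And>s t. F s t \<in> carrier \<gg>"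
  shows "(mult_z_minus_w \<gg> ^^ n) F s t \<in> carrier \<gg>"
proof -
  interpret superspace \<gg> by (rule assms)
  show ?thesis using assms(2) by (induction n arbitrary: s t) (auto simp: mult_z_minus_w_def)
qed

lemma mult_z_minus_w_map:
  assumes "superspace \<gg>" "superspace \<hh>" "even_linear \<gg> \<hh> f" "\<And>s t. F s t \<in> carrier \<gg>"
  shows "(mult_z_minus_w \<hh> ^^ n) (\<lambda>s t. f (F s t)) = (\<lambda>s t. f ((mult_z_minus_w \<gg> ^^ n) F s t))"
proof (induction n)
  case (Suc n)
  show ?case
    unfolding funpow.simps comp_apply Suc.IH
    by (simp add: mult_z_minus_w_def even_linear_minus[OF assms(1-3)] mult_z_minus_w_closed[OF assms(1,4)])
qed simp

lemma (in differential_lie_algebra) bracket_closed: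
  "x \<in> carrier \<gg> \<Longrightarrow> y \<in> carrier \<gg> \<Longrightarrow> x \<otimes> y \<in> carrier \<gg>"
  using bracket_bilinear by (simp add: even_bilinear_def)

text \<open>The derivation on distributions is \<open>\<partial>\<^sub>z\<close>, which any linear
  map respects coefficientwise. Preserving linearity, parity and the bracket is what makes
  \<open>f\<close> act on distributions as a conformal morphism.\<close>

locale differential_lie_hom = source: differential_lie_algebra \<gg> + target: differential_lie_algebra \<hh>
  for \<gg> :: "('k::field_char_0, 'a, 'm) kt_module_scheme" and \<hh> :: "('k, 'b, 'n) kt_module_scheme" +
  fixes f :: "'a \<Rightarrow> 'b"
  assumes even_linear: "even_linear \<gg> \<hh> f"
    and bracket: "x \<in> carrier \<gg> \<Longrightarrow> y \<in> carrier \<gg> \<Longrightarrow> f (x \<otimes>\<^bsub>\<gg>\<^esub> y) = f x \<otimes>\<^bsub>\<hh>\<^esub> f y"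
begin

lemmas hom_simps = even_linearD[OF even_linear]

lemma distributions_hom:
  assumes "a \<in> carrier (distributions \<gg>)"
  shows "f \<circ> a \<in> carrier (distributions \<hh>)"
    and "f \<circ> (c \<odot>\<^bsub>distributions \<gg>\<^esub> a) = c \<odot>\<^bsub>distributions \<hh>\<^esub> (f \<circ> a)"
    and "f \<circ> der (distributions \<gg>) a = der (distributions \<hh>) (f \<circ> a)"
  using assms by (auto simp: distributions_simps hom_simps dist_deriv_def)

lemma distributions_hom_add:
  assumes "a \<in> carrier (distributions \<gg>)" "b \<in> carrier (distributions \<gg>)"
  shows "f \<circ> (a \<oplus>\<^bsub>distributions \<gg>\<^esub> b) = (f \<circ> a) \<oplus>\<^bsub>distributions \<hh>\<^esub> (f \<circ> b)"
  using assms by (auto simp: distributions_simps hom_simps)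

lemma distributions_nprod:
  assumes "a \<in> carrier (distributions \<gg>)" "b \<in> carrier (distributions \<gg>)"
  shows "nprod (distributions \<gg>) n a b \<in> carrier (distributions \<gg>)"
    and "f \<circ> nprod (distributions \<gg>) n a b = nprod (distributions \<hh>) n (f \<circ> a) (f \<circ> b)"
proof -
  have cl: "a t \<in> carrier \<gg>" "b t \<in> carrier \<gg>" for t using assms by (auto simp: distributions_simps)
  have br: "dist_bracket \<gg> a b s t \<in> carrier \<gg>" for s t
    using cl by (simp add: dist_bracket_def source.bracket_closed)
  show "nprod (distributions \<gg>) n a b \<in> carrier (distributions \<gg>)"
    unfolding distributions_simps res_z_def
    using mult_z_minus_w_closed[OF source.superspace_axioms br] by simp
  have "dist_bracket \<hh> (f \<circ> a) (f \<circ> b) = (\<lambda>s t. f (dist_bracket \<gg> a b s t))"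
    using cl by (simp add: dist_bracket_def bracket)
  then show "f \<circ> nprod (distributions \<gg>) n a b = nprod (distributions \<hh>) n (f \<circ> a) (f \<circ> b)"
    unfolding distributions_simps res_z_def
    by (simp add: mult_z_minus_w_map[OF source.superspace_axioms target.superspace_axioms even_linear br] comp_def)
qed

text \<open>A closure is an intersection of subalgebras, so one closure is mapped into another by
  pulling subalgebras back. The delicate point is gradedness, which rests on the uniqueness of
  homogeneous decompositions in the target.\<close>

lemma conformal_subalgebra_vimage:
  assumes S: "conformal_subalgebra (distributions \<hh>) S"
  shows "conformal_subalgebra (distributions \<gg>) {b \<in> carrier (distributions \<gg>). f \<circ> b \<in> S}"
proof -
  interpret D: Module.module scalars "distributions \<hh>" by (rule target.distributions_module)
  have sub: "submodule S scalars (distributions \<hh>)" and gr: "graded_subset (distributions \<hh>) S"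
    and der: "\<And>a. a \<in> S \<Longrightarrow> der (distributions \<hh>) a \<in> S"
    and nprod: "\<And>n a b. a \<in> S \<Longrightarrow> b \<in> S \<Longrightarrow> nprod (distributions \<hh>) n a b \<in> S"
    using S by (auto simp: conformal_subalgebra_def)
  note subE = D.submoduleE(4,5)[OF sub]
  interpret G: Module.module scalars "distributions \<gg>" by (rule source.distributions_module)
  have der_closed: "der (distributions \<gg>) b \<in> carrier (distributions \<gg>)" if "b \<in> carrier (distributions \<gg>)" for b
    using that by (auto simp: distributions_simps dist_deriv_def)
  have zero: "f \<circ> \<zero>\<^bsub>distributions \<gg>\<^esub> \<in> S"
  proof -
    have "f \<circ> \<zero>\<^bsub>distributions \<gg>\<^esub> = \<zero>\<^bsub>distributions \<hh>\<^esub>"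
      using even_linear_zero[OF source.superspace_axioms target.superspace_axioms even_linear]
      by (auto simp: distributions_simps)
    then show ?thesis using subgroup.one_closed[OF submodule.axioms(1)[OF sub]] by simp
  qed
  show ?thesis
    unfolding conformal_subalgebra_def
  proof (intro conjI allI ballI)
    show "submodule {b \<in> carrier (distributions \<gg>). f \<circ> b \<in> S} scalars (distributions \<gg>)"
      by (rule submodule_scalarsI[OF source.distributions_module])
        (use G.a_closed G.smult_closed zero subE in \<open>auto simp: distributions_hom distributions_hom_add\<close>)
    show "graded_subset (distributions \<gg>) {b \<in> carrier (distributions \<gg>). f \<circ> b \<in> S}"
      unfolding graded_subset_def
    proof (intro conjI ballI)
      fix b assume "b \<in> {b \<in> carrier (distributions \<gg>). f \<circ> b \<in> S}"
      then have b: "b \<in> carrier (distributions \<gg>)" "f \<circ> b \<in> S" by auto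
      then have bt: "b t \<in> carrier \<gg>" for t by (simp add: distributions_simps)
      obtain x y where xy: "x \<in> S" "x \<in> homog (distributions \<hh>) 0" "y \<in> S" "y \<in> homog (distributions \<hh>) 1"
        "f \<circ> b = x \<oplus>\<^bsub>distributions \<hh>\<^esub> y"
        using gr b(2) unfolding graded_subset_def by blast
      let ?b = "\<lambda>p. source.hcomp p \<circ> b"
      have hb: "?b p \<in> homog (distributions \<gg>) p" "?b p \<in> carrier (distributions \<gg>)" for p
        using source.hcomp(1)[OF bt] source.homogD[OF source.hcomp(1)[OF bt]]
        by (simp_all add: distributions_simps)
      have b_eq: "b = ?b 0 \<oplus>\<^bsub>distributions \<gg>\<^esub> ?b 1"
        using source.hcomp(2)[OF bt] by (auto simp: distributions_simps)
      \<comment> \<open>The image of the decomposition of \<open>b\<close> and the decomposition of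
        \<open>f \<circ> b\<close> inside \<open>S\<close> are both homogeneous, so they coincide,
        and the components of \<open>b\<close> are mapped into \<open>S\<close>.\<close>
      have eq: "f (?b 0 t) = x t \<and> f (?b 1 t) = y t" for t
      proof -
        have "f (?b 0 t) \<oplus>\<^bsub>\<hh>\<^esub> f (?b 1 t) = x t \<oplus>\<^bsub>\<hh>\<^esub> y t"
          using fun_cong[OF xy(5), of t] source.hcomp(2)[OF bt[of t]] hb(2)
          by (simp add: distributions_simps hom_simps(2)[symmetric])
        moreover have "f (?b p t) \<in> homog \<hh> p" for p
          using hb(1)[of p] by (intro hom_simps) (simp add: distributions_simps)
        moreover have "x t \<in> homog \<hh> 0" "y t \<in> homog \<hh> 1"
          using xy by (auto simp: distributions_simps)
        ultimately show ?thesis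
          using target.homog_decomp_unique[of "f (?b 0 t)" "f (?b 1 t)" "x t" "y t" 0 1] by auto
      qed
      then have "f \<circ> ?b 0 = x" "f \<circ> ?b 1 = y" by auto
      then show "\<exists>x\<in>{b \<in> carrier (distributions \<gg>). f \<circ> b \<in> S} \<inter> homog (distributions \<gg>) 0.
        \<exists>y\<in>{b \<in> carrier (distributions \<gg>). f \<circ> b \<in> S} \<inter> homog (distributions \<gg>) 1.
          b = x \<oplus>\<^bsub>distributions \<gg>\<^esub> y"
        using b_eq hb xy by (intro bexI[of _ "?b 0"] bexI[of _ "?b 1"]) simp_all
    qed auto
    show "der (distributions \<gg>) ` {b \<in> carrier (distributions \<gg>). f \<circ> b \<in> S} \<subseteq> {b \<in> carrier (distributions \<gg>). f \<circ> b \<in> S}"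
      using der der_closed by (auto simp: distributions_hom(3))
  qed (use nprod in \<open>auto simp: distributions_nprod\<close>)
qed

lemma conformal_closure_map:
  assumes "F \<subseteq> carrier (distributions \<gg>)" "\<And>a. a \<in> F \<Longrightarrow> f \<circ> a \<in> conformal_closure (distributions \<hh>) G"
    and "b \<in> conformal_closure (distributions \<gg>) F"
  shows "f \<circ> b \<in> conformal_closure (distributions \<hh>) G"
  unfolding conformal_closure_def
proof (rule InterI)
  fix S assume "S \<in> {S. conformal_subalgebra (distributions \<hh>) S \<and> G \<subseteq> S}"
  then have S: "conformal_subalgebra (distributions \<hh>) S" "G \<subseteq> S" by auto
  then have "conformal_closure (distributions \<hh>) G \<subseteq> S" unfolding conformal_closure_def by blast
  then have "F \<subseteq> {b \<in> carrier (distributions \<gg>). f \<circ> b \<in> S}" using assms(1,2) by blast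
  then show "f \<circ> b \<in> S"
    using assms(3) conformal_subalgebra_vimage[OF S(1)] unfolding conformal_closure_def by blast
qed

end

section \<open>The two categories\<close>

lemma local_lie_homD:
  assumes "f \<in> local_lie_hom \<gg> \<hh>"
  shows "f \<in> carrier \<gg> \<rightarrow>\<^sub>E carrier \<hh>" "even_linear \<gg> \<hh> f"
    "x \<in> carrier \<gg> \<Longrightarrow> y \<in> carrier \<gg> \<Longrightarrow> f (x \<otimes>\<^bsub>\<gg>\<^esub> y) = f x \<otimes>\<^bsub>\<hh>\<^esub> f y"
    "x \<in> carrier \<gg> \<Longrightarrow> f (der \<gg> x) = der \<hh> (f x)"
    "a \<in> gen_fields \<gg> \<Longrightarrow> f \<circ> a \<in> conformal_closure (distributions \<hh>) (gen_fields \<hh>)"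
  using assms unfolding local_lie_hom_def by blast+

lemma local_lie_hom_differential:
  assumes "local_lie_algebra \<gg>" "local_lie_algebra \<hh>" "f \<in> local_lie_hom \<gg> \<hh>"
  shows "differential_lie_hom \<gg> \<hh> f"
  using assms local_lie_homD[OF assms(3)]
  by (auto simp: differential_lie_hom_def differential_lie_hom_axioms_def local_lie_algebra_def)

lemma (in local_lie_algebra) gen_fields_carrier: "gen_fields \<gg> \<subseteq> carrier (distributions \<gg>)"
  using fields_graded by (simp add: graded_subset_def)

text \<open>\<open>f\<close> sends generating fields only into the closure of those of the middle
  algebra, so \<open>g\<close> has to be controlled on a whole closure;
  \<open>conformal_closure_map\<close> does this.\<close>

lemma local_lie_hom_compose:
  assumes "local_lie_algebra \<gg>" "local_lie_algebra \<hh>" "local_lie_algebra \<kk>"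
    and f: "f \<in> local_lie_hom \<gg> \<hh>" and g: "g \<in> local_lie_hom \<hh> \<kk>"
  shows "compose (carrier \<gg>) g f \<in> local_lie_hom \<gg> \<kk>"
proof -
  interpret G: local_lie_algebra \<gg> by (rule assms)
  interpret H: local_lie_algebra \<hh> by (rule assms)
  interpret g: differential_lie_hom \<hh> \<kk> g by (rule local_lie_hom_differential[OF assms(2,3) g])
  note fE = even_linearD[OF local_lie_homD(2)[OF f]]
  show ?thesis
    unfolding local_lie_hom_def
  proof (intro CollectI conjI ballI)
    show "compose (carrier \<gg>) g f \<in> carrier \<gg> \<rightarrow>\<^sub>E carrier \<kk>"
      using fE(1) g.hom_simps(1) by (auto simp: compose_def)
    show "even_linear \<gg> \<kk> (compose (carrier \<gg>) g f)"
      by (rule even_linear_compose[OF G.superspace_axioms local_lie_homD(2)[OF f] g.even_linear])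
    fix a assume a: "a \<in> gen_fields \<gg>"
    then have "a t \<in> carrier \<gg>" for t using G.gen_fields_carrier by (auto simp: distributions_simps)
    then have "compose (carrier \<gg>) g f \<circ> a = g \<circ> (f \<circ> a)" by (auto simp: compose_def)
    then show "compose (carrier \<gg>) g f \<circ> a \<in> conformal_closure (distributions \<kk>) (gen_fields \<kk>)"
      using g.conformal_closure_map[OF H.gen_fields_carrier local_lie_homD(5)[OF g] local_lie_homD(5)[OF f a]]
      by simp
  qed (use fE(1) G.bracket_closed even_linearD(1)[OF G.der_even_linear] in
      \<open>auto simp: compose_def local_lie_homD(3,4)[OF f] local_lie_homD(3,4)[OF g]\<close>)
qed

lemma local_lie_hom_id:
  assumes "local_lie_algebra \<gg>"
  shows "(\<lambda>x\<in>carrier \<gg>. x) \<in> local_lie_hom \<gg> \<gg>"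
proof -
  interpret G: local_lie_algebra \<gg> by (rule assms)
  show ?thesis
    unfolding local_lie_hom_def
  proof (intro CollectI conjI ballI)
    show "even_linear \<gg> \<gg> (\<lambda>x\<in>carrier \<gg>. x)" by (rule even_linear_id[OF G.superspace_axioms])
    fix a assume a: "a \<in> gen_fields \<gg>"
    then have "a t \<in> carrier \<gg>" for t using G.gen_fields_carrier by (auto simp: distributions_simps)
    then have "(\<lambda>x\<in>carrier \<gg>. x) \<circ> a = a" by auto
    then show "(\<lambda>x\<in>carrier \<gg>. x) \<circ> a \<in> conformal_closure (distributions \<gg>) (gen_fields \<gg>)"
      using a unfolding conformal_closure_def by auto
  qed (use G.bracket_closed even_linearD(1)[OF G.der_even_linear] in auto)
qed

lemma compose_id_right: "f \<in> A \<rightarrow>\<^sub>E B \<Longrightarrow> compose A f (\<lambda>x\<in>A. x) = f"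
  by (rule extensionalityI[of _ A]) (auto simp: compose_def PiE_def)

lemma compose_id_left: "f \<in> A \<rightarrow>\<^sub>E B \<Longrightarrow> compose A (\<lambda>x\<in>B. x) f = f"
  by (rule extensionalityI[of _ A]) (auto simp: compose_def PiE_def Pi_def)

lemma compose_assoc_PiE:
  "f \<in> A \<rightarrow>\<^sub>E B \<Longrightarrow> compose A h (compose A g f) = compose A (compose B h g) f"
  by (rule ext) (auto simp: compose_def PiE_def Pi_def)

lemma local_lie_category: "category (local_lie_category :: (('k::field_char_0, 'a) local_lie, 'a \<Rightarrow> 'a) category)"
  by unfold_locales
    (auto simp: local_lie_category_def local_lie_hom_id
      intro: local_lie_hom_compose[rotated 3] compose_id_right compose_id_left compose_assoc_PiE dest: local_lie_homD(1))

lemma conformal_homD: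
  assumes "f \<in> conformal_hom R S"
  shows "f \<in> carrier R \<rightarrow>\<^sub>E carrier S" "even_linear R S f"
    "a \<in> carrier R \<Longrightarrow> f (der R a) = der S (f a)"
    "a \<in> carrier R \<Longrightarrow> b \<in> carrier R \<Longrightarrow> f (nprod R n a b) = nprod S n (f a) (f b)"
  using assms unfolding conformal_hom_def by blast+

lemma conformal_hom_compose:
  assumes "vertex_lie_algebra R" "f \<in> conformal_hom R S" "g \<in> conformal_hom S U"
  shows "compose (carrier R) g f \<in> conformal_hom R U"
proof -
  interpret R: vertex_lie_algebra R by (rule assms)
  note fE = even_linearD[OF conformal_homD(2)[OF assms(2)]] and gE = even_linearD[OF conformal_homD(2)[OF assms(3)]]
  show ?thesis
    unfolding conformal_hom_def
    using fE(1) gE(1) even_linear_compose[OF R.superspace_axioms conformal_homD(2)[OF assms(2)] conformal_homD(2)[OF assms(3)]]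
    by (auto simp: compose_def conformal_homD(3,4)[OF assms(2)] conformal_homD(3,4)[OF assms(3)])
qed

lemma conformal_hom_id:
  assumes "vertex_lie_algebra R"
  shows "(\<lambda>x\<in>carrier R. x) \<in> conformal_hom R R"
proof -
  interpret R: vertex_lie_algebra R by (rule assms)
  show ?thesis
    unfolding conformal_hom_def using even_linear_id[OF R.superspace_axioms] by auto
qed

lemma vertex_lie_category: "category (vertex_lie_category :: (('k::field_char_0, 'a) conformal, 'a \<Rightarrow> 'a) category)"
  by unfold_locales
    (auto simp: vertex_lie_category_def conformal_hom_id
      intro: conformal_hom_compose compose_id_right compose_id_left compose_assoc_PiE dest: conformal_homD(1))


section \<open>Full faithfulness\<close>

definition map_coeffs :: "('a \<Rightarrow> 'b) \<Rightarrow> ('k, int \<Rightarrow> 'a) lie_expr \<Rightarrow> ('k, int \<Rightarrow> 'b) lie_expr"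
  where "map_coeffs f = map_lie_expr (\<lambda>v. f \<circ> v)"

lemma map_coeffs_simps [simp]:
  "map_coeffs f (Gen v) = Gen (f \<circ> v)" "map_coeffs f Zero = Zero"
  "map_coeffs f (Plus x y) = Plus (map_coeffs f x) (map_coeffs f y)"
  "map_coeffs f (Scale c x) = Scale c (map_coeffs f x)"
  "map_coeffs f (Bracket x y) = Bracket (map_coeffs f x) (map_coeffs f y)"
  by (simp_all add: map_coeffs_def)

text \<open>Identities and composites of extensional morphisms have their expected values on the
  carrier only; this carries the functor laws over to expressions, whose coefficients lie
  there.\<close>

lemma map_coeffs_cong:
  assumes "x \<in> lie_exprs (laurent R)" "\<And>a. a \<in> carrier R \<Longrightarrow> f a = g a"
  shows "map_coeffs f x = map_coeffs g x"
  using assms(1) by (induction x) (auto simp: laurent_def assms(2))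

lemma map_coeffs_comp: "map_coeffs g (map_coeffs f x) = map_coeffs (g \<circ> f) x"
  by (induction x) (auto simp: comp_assoc)

lemma map_coeffs_id: "map_coeffs (\<lambda>a. a) x = x"
  by (induction x) (auto simp: comp_def)

locale vertex_lie_hom = source: vertex_lie_algebra R + target: vertex_lie_algebra S
  for R :: "('k::field_char_0, 'a, 'm) conformal_scheme" and S :: "('k, 'b, 'n) conformal_scheme" +
  fixes f :: "'a \<Rightarrow> 'b"
  assumes hom: "f \<in> conformal_hom R S"
begin

lemmas hom_simps = even_linearD[OF conformal_homD(2)[OF hom]] conformal_homD(3,4)[OF hom]

lemma hom_zero [simp]: "f \<zero>\<^bsub>R\<^esub> = \<zero>\<^bsub>S\<^esub>"
  by (rule even_linear_zero[OF source.superspace_axioms target.superspace_axioms conformal_homD(2)[OF hom]])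

lemma comp_laurent [simp]: "v \<in> carrier (laurent R) \<Longrightarrow> f \<circ> v \<in> carrier (laurent S)"
  by (rule laurent_comp) (auto simp: hom_simps)

lemma comp_laurent_homog: "v \<in> homog (laurent R) p \<Longrightarrow> f \<circ> v \<in> homog (laurent S) p"
  using comp_laurent[OF source.laurent_homog_carrier, of v p]
  by (auto simp: source.laurent_simps target.laurent_simps hom_simps)

lemma comp_laurent_linear:
  "u \<in> carrier (laurent R) \<Longrightarrow> v \<in> carrier (laurent R) \<Longrightarrow>
    f \<circ> (u \<oplus>\<^bsub>laurent R\<^esub> v) = (f \<circ> u) \<oplus>\<^bsub>laurent S\<^esub> (f \<circ> v)"
  "v \<in> carrier (laurent R) \<Longrightarrow> f \<circ> (c \<odot>\<^bsub>laurent R\<^esub> v) = c \<odot>\<^bsub>laurent S\<^esub> (f \<circ> v)"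
  by (auto simp: source.laurent_simps target.laurent_simps hom_simps)

lemma comp_monomial: "f \<circ> monomial R a t = monomial S (f a) t"
  by (auto simp: monomial_def)

lemma map_coeffs_exprs [simp]: "x \<in> lie_exprs (laurent R) \<Longrightarrow> map_coeffs f x \<in> lie_exprs (laurent S)"
  by (induction x) auto

lemma map_coeffs_parity: "expr_parity (laurent R) p x \<Longrightarrow> expr_parity (laurent S) p (map_coeffs f x)"
  by (induction rule: expr_parity.induct) (auto intro: expr_parity.intros comp_laurent_homog simp del: add_bit_eq_xor)

lemma map_coeffs_der:
  "x \<in> lie_exprs (laurent R) \<Longrightarrow> map_coeffs f (expr_der (der R) x) = expr_der (der S) (map_coeffs f x)"
  by (induction x) (auto simp: source.laurent_simps hom_simps)

text \<open>\<open>f\<close> may send a nonzero product to zero, so the two index sets can differ.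
  In the pointwise form of \<open>laurent_finsum\<close> the additional terms are visibly
  zero.\<close>

lemma comp_bracket_sum:
  assumes "a \<in> carrier R" "b \<in> carrier R"
  shows "f \<circ> (\<Oplus>\<^bsub>laurent R\<^esub>i\<in>{i. nprod R i a b \<noteq> \<zero>\<^bsub>R\<^esub>}.
        (of_int t gchoose i) \<odot>\<^bsub>laurent R\<^esub> monomial R (nprod R i a b) (t + s - int i))
    = (\<Oplus>\<^bsub>laurent S\<^esub>i\<in>{i. nprod S i (f a) (f b) \<noteq> \<zero>\<^bsub>S\<^esub>}.
        (of_int t gchoose i) \<odot>\<^bsub>laurent S\<^esub> monomial S (nprod S i (f a) (f b)) (t + s - int i))"
  using assms
  by (subst source.laurent_finsum target.laurent_finsum; (simp add: source.nprod_finite target.nprod_finite hom_simps)?)+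
    (auto simp: hom_simps simp flip: hom_simps(6))

lemma loc_eq_map: "loc_eq R x y \<Longrightarrow> loc_eq S (map_coeffs f x) (map_coeffs f y)"
proof (induction rule: lie_eq.induct)
  case (sym x y)
  show ?case by (rule lie_eq.sym[OF sym(2)])
next
  case (trans x y z)
  show ?case by (rule lie_eq.trans[OF trans(3,4)])
next
  case (skew x y p q)
  then show ?case by (simp add: lie_eq.skew map_coeffs_parity)
next
  case (jacobi x y z p q)
  then show ?case by (simp add: lie_eq.jacobi map_coeffs_parity)
next
  case (rel x y)
  from rel(1)[unfolded loc_rels_def] show ?case
  proof (elim UnE CollectE exE conjE)
    fix a t assume "(x, y) = (Gen (monomial R (der R a) t), Scale (- of_int t) (Gen (monomial R a (t - 1))))"
      and "a \<in> carrier R"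
    then show ?thesis by (simp add: comp_monomial hom_simps target.loc_eq_der_relation)
  next
    fix a b t s assume xy: "(x, y) = (Bracket (Gen (monomial R a t)) (Gen (monomial R b s)),
      Gen (\<Oplus>\<^bsub>laurent R\<^esub>i\<in>{i. nprod R i a b \<noteq> \<zero>\<^bsub>R\<^esub>}.
        (of_int t gchoose i) \<odot>\<^bsub>laurent R\<^esub> monomial R (nprod R i a b) (t + s - int i)))"
      and ab: "a \<in> carrier R" "b \<in> carrier R"
    have "(map_coeffs f x, map_coeffs f y) \<in> loc_rels S"
      unfolding loc_rels_def using xy ab hom_simps(1)
      by (auto simp: comp_monomial comp_bracket_sum)
    then show ?thesis using rel(2,3) by (intro lie_eq.rel) auto
  qed
qed (auto simp: comp_laurent_linear intro: lie_eq.intros)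

lemma loc_lie_map_class:
  assumes "x \<in> lie_exprs (laurent R)"
  shows "loc_lie_map R S f (loc_class R x) = loc_class S (map_coeffs f x)"
proof -
  have "loc_lie_map R S f (loc_class R x) = (\<Union>x'\<in>loc_class R x. loc_class S (map_coeffs f x'))"
    using assms by (simp add: loc_lie_map_def map_coeffs_def)
  also have "\<dots> = loc_class S (map_coeffs f x)"
    by (intro source.UN_lie_class assms target.loc_class_eq loc_eq_map)
  finally show ?thesis .
qed

lemma loc_lie_map_field_of: "a \<in> carrier R \<Longrightarrow> loc_lie_map R S f \<circ> source.field_of a = target.field_of (f a)"
  by (auto simp: source.field_of_def target.field_of_def loc_lie_map_class comp_monomial)

lemma loc_lie_map_hom: "loc_lie_map R S f \<in> local_lie_hom (loc_lie R) (loc_lie S)"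
  unfolding local_lie_hom_def
proof (intro CollectI conjI ballI)
  show "loc_lie_map R S f \<in> carrier (loc_lie R) \<rightarrow>\<^sub>E carrier (loc_lie S)"
  proof (rule PiE_I)
    show "loc_lie_map R S f X \<in> carrier (loc_lie S)" if "X \<in> carrier (loc_lie R)" for X
      using that by (auto elim!: source.loc_lie_cases simp: loc_lie_map_class)
  qed (simp add: loc_lie_map_def)
  show "even_linear (loc_lie R) (loc_lie S) (loc_lie_map R S f)"
    unfolding even_linear_def
    by (auto elim!: source.loc_lie_cases source.loc_lie_homog_cases
      simp: loc_lie_map_class source.loc_lie_ops target.loc_lie_ops map_coeffs_parity)
  fix a assume "a \<in> gen_fields (loc_lie R)"
  then obtain b where "b \<in> carrier R" "a = source.field_of b" by (auto simp: source.gen_fields_eq)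
  then show "loc_lie_map R S f \<circ> a \<in> conformal_closure (distributions (loc_lie S)) (gen_fields (loc_lie S))"
    unfolding target.conformal_closure_fields
    by (simp add: loc_lie_map_field_of target.gen_fields_eq hom_simps)
qed (auto elim!: source.loc_lie_cases
      simp: loc_lie_map_class source.loc_lie_ops target.loc_lie_ops map_coeffs_der)

end

lemma vertex_lie_homI:
  "vertex_lie_algebra R \<Longrightarrow> vertex_lie_algebra S \<Longrightarrow> f \<in> conformal_hom R S \<Longrightarrow> vertex_lie_hom R S f"
  by (simp add: vertex_lie_hom_def vertex_lie_hom_axioms_def)

section \<open>Injectivity and surjectivity on morphisms\<close>

lemma loc_lie_map_inj:
  assumes R: "vertex_lie_algebra R" and S: "vertex_lie_algebra S"
    and f: "f \<in> conformal_hom R S" and g: "g \<in> conformal_hom R S"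
    and eq: "loc_lie_map R S f = loc_lie_map R S g"
  shows "f = g"
proof -
  interpret f: vertex_lie_hom R S f by (rule vertex_lie_homI[OF R S f])
  interpret g: vertex_lie_hom R S g by (rule vertex_lie_homI[OF R S g])
  have "f a = g a" if a: "a \<in> carrier R" for a
  proof (rule f.target.field_of_inj)
    show "f.target.field_of (f a) = f.target.field_of (g a)"
      unfolding f.loc_lie_map_field_of[OF a, symmetric] g.loc_lie_map_field_of[OF a, symmetric] eq ..
  qed (use a f.hom_simps g.hom_simps in auto)
  then show ?thesis
    using conformal_homD(1)[OF f] conformal_homD(1)[OF g] by (intro extensionalityI[of _ "carrier R"]) (auto simp: PiE_def)
qed

text \<open>Every identity required of \<open>f\<close> is tested on fields. There it holds because
  \<open>\<phi>\<close> acts on distributions as a conformal morphism, and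
  \<open>field_of_inj\<close> brings it back to \<open>S\<close>.\<close>

lemma loc_lie_map_surj:
  assumes R: "vertex_lie_algebra R" and S: "vertex_lie_algebra S"
    and \<phi>: "\<phi> \<in> local_lie_hom (loc_lie R) (loc_lie S)"
  obtains f where "f \<in> conformal_hom R S" "loc_lie_map R S f = \<phi>"
proof -
  interpret R: vertex_lie_algebra R by (rule R)
  interpret S: vertex_lie_algebra S by (rule S)
  interpret L: local_lie_algebra "loc_lie R" by (rule R.loc_lie_local)
  interpret M: local_lie_algebra "loc_lie S" by (rule S.loc_lie_local)
  interpret \<phi>: differential_lie_hom "loc_lie R" "loc_lie S" \<phi>
    by (rule local_lie_hom_differential[OF L.local_lie_algebra_axioms M.local_lie_algebra_axioms \<phi>])
  have "\<phi> \<circ> a \<in> gen_fields (loc_lie S)" if "a \<in> gen_fields (loc_lie R)" for a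
    using local_lie_homD(5)[OF \<phi> that] by (simp add: S.conformal_closure_fields)
  then have "\<forall>a. \<exists>b. a \<in> carrier R \<longrightarrow> b \<in> carrier S \<and> \<phi> \<circ> R.field_of a = S.field_of b"
    unfolding R.gen_fields_eq S.gen_fields_eq by blast
  then have "\<exists>h. \<forall>a. a \<in> carrier R \<longrightarrow> h a \<in> carrier S \<and> \<phi> \<circ> R.field_of a = S.field_of (h a)"
    by (rule choice)
  then obtain f0 where f0: "\<And>a. a \<in> carrier R \<Longrightarrow> f0 a \<in> carrier S \<and> \<phi> \<circ> R.field_of a = S.field_of (f0 a)"
    by blast
  \<comment> \<open>Restriction makes the chosen function extensional, as morphisms are.\<close>
  define f where "f = restrict f0 (carrier R)"
  have fc [simp]: "f a \<in> carrier S" and field_of: "\<phi> \<circ> R.field_of a = S.field_of (f a)" if "a \<in> carrier R" for a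
    using f0[OF that] that by (auto simp: f_def)
  note inj = S.field_of_inj
  have add: "f (a \<oplus>\<^bsub>R\<^esub> b) = f a \<oplus>\<^bsub>S\<^esub> f b" if "a \<in> carrier R" "b \<in> carrier R" for a b
    by (rule inj) (use that in \<open>auto simp: R.field_of_linear S.field_of_linear \<phi>.distributions_hom_add simp flip: field_of\<close>)
  have smult: "f (c \<odot>\<^bsub>R\<^esub> a) = c \<odot>\<^bsub>S\<^esub> f a" if "a \<in> carrier R" for a c
    by (rule inj) (use that in \<open>auto simp: R.field_of_linear S.field_of_linear \<phi>.distributions_hom(2) simp flip: field_of\<close>)
  have der: "f (der R a) = der S (f a)" if "a \<in> carrier R" for a
    by (rule inj) (use that in \<open>auto simp: R.field_of_der(1) S.field_of_der(1) \<phi>.distributions_hom(3) simp flip: field_of\<close>)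
  have nprod: "f (nprod R n a b) = nprod S n (f a) (f b)" if "a \<in> carrier R" "b \<in> carrier R" for a b n
    by (rule inj) (use that in \<open>auto simp: R.field_of_nprod S.field_of_nprod \<phi>.distributions_nprod(2) simp flip: field_of\<close>)
  have homog: "f a \<in> homog S p" if "a \<in> homog R p" for a p
  proof -
    have a: "a \<in> carrier R" using that by (rule R.homogD)
    have neq: "p \<noteq> p + 1" by (cases p) auto
    have "S.field_of (f a) t \<in> homog (loc_lie S) p" for t
      using R.field_of_homog[OF that] \<phi>.hom_simps(4) by (auto simp: distributions_simps simp flip: field_of[OF a])
    define y z where "y = S.hcomp p (f a)" and "z = S.hcomp (p + 1) (f a)"
    have yz: "y \<in> homog S p" "z \<in> homog S (p + 1)" using S.hcomp a by (auto simp: y_def z_def)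
    have "f a = y \<oplus>\<^bsub>S\<^esub> z"
      using S.hcomp(2)[of "f a"] S.hcomp(1)[of "f a", THEN S.homogD] a
      unfolding y_def z_def by (cases p) (auto simp: S.a_comm)
    then have eq: "S.field_of (f a) = S.field_of y \<oplus>\<^bsub>distributions (loc_lie S)\<^esub> S.field_of z"
      using yz by (simp add: S.field_of_linear S.homogD)
    \<comment> \<open>\<open>z\<close> is the component of \<open>f a\<close> of the wrong parity.
      As \<open>\<phi>\<close> is even, the field of \<open>f a\<close> has coefficients of parity
      \<open>p\<close>, and uniqueness of decompositions in \<open>loc_lie S\<close> forces the
      field of \<open>z\<close>, and then \<open>z\<close>, to be zero.\<close>
    have "S.field_of z t = \<zero>\<^bsub>loc_lie S\<^esub>" for t
    proof -
      have h: "S.field_of y t \<in> homog (loc_lie S) p" "S.field_of z t \<in> homog (loc_lie S) (p + 1)"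
        "S.field_of (f a) t \<in> homog (loc_lie S) p"
        using S.field_of_homog[OF yz(1)] S.field_of_homog[OF yz(2)] \<open>S.field_of (f a) t \<in> _\<close>
        by (simp_all add: distributions_simps del: add_bit_eq_xor)
      have "S.field_of (f a) t \<oplus>\<^bsub>loc_lie S\<^esub> \<zero>\<^bsub>loc_lie S\<^esub> = S.field_of y t \<oplus>\<^bsub>loc_lie S\<^esub> S.field_of z t"
        using fun_cong[OF eq, of t] h M.homogD by (simp add: distributions_simps)
      from M.homog_decomp_unique(2)[OF this h(3,1) _ h(2) neq] show ?thesis by simp
    qed
    then have "S.field_of z = S.field_of \<zero>\<^bsub>S\<^esub>" by (auto simp: S.field_of_linear distributions_simps)
    then have "z = \<zero>\<^bsub>S\<^esub>" using yz(2) by (intro inj) (auto intro: S.homogD)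
    then show ?thesis using \<open>f a = y \<oplus>\<^bsub>S\<^esub> z\<close> yz by (simp add: S.homogD)
  qed
  have f: "f \<in> conformal_hom R S"
    unfolding conformal_hom_def even_linear_def
    using add smult der nprod homog by (auto simp: f_def[symmetric] intro: fc) (simp add: f_def)
  interpret f: vertex_lie_hom R S f by (rule vertex_lie_homI[OF R S f])
  note \<psi> = f.loc_lie_map_hom
  interpret \<psi>: differential_lie_hom "loc_lie R" "loc_lie S" "loc_lie_map R S f"
    by (rule local_lie_hom_differential[OF L.local_lie_algebra_axioms M.local_lie_algebra_axioms \<psi>])
  \<comment> \<open>The two maps agree on a submodule, and this submodule contains all coefficients
    of fields, which span.\<close>
  have "X \<in> {X \<in> carrier (loc_lie R). loc_lie_map R S f X = \<phi> X}" if "X \<in> carrier (loc_lie R)" for X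
  proof (rule R.loc_lie_generated[OF _ _ that])
    show "submodule {X \<in> carrier (loc_lie R). loc_lie_map R S f X = \<phi> X} scalars (loc_lie R)"
      by (rule submodule_scalarsI[OF R.loc_lie_module])
        (auto simp: \<phi>.hom_simps \<psi>.hom_simps
          even_linear_zero[OF L.superspace_axioms M.superspace_axioms \<phi>.even_linear]
          even_linear_zero[OF L.superspace_axioms M.superspace_axioms \<psi>.even_linear])
    show "R.field_of a t \<in> {X \<in> carrier (loc_lie R). loc_lie_map R S f X = \<phi> X}" if "a \<in> carrier R" for a t
      using that R.field_of_closed[OF that] fun_cong[OF f.loc_lie_map_field_of[OF that], of t] fun_cong[OF field_of[OF that], of t]
      by (auto simp: distributions_simps)
  qed
  then have "loc_lie_map R S f = \<phi>"
    using local_lie_homD(1)[OF \<phi>] local_lie_homD(1)[OF \<psi>]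
    by (intro extensionalityI[of _ "carrier (loc_lie R)"]) (auto simp: PiE_def)
  then show thesis using that f by blast
qed

theorem proposition2p4p4:
  "fully_faithful_functor
    (vertex_lie_category :: (('k::field_char_0, 'a) conformal, 'a \<Rightarrow> 'a) category)
    (local_lie_category ::
      (('k, ('k, int \<Rightarrow> 'a) lie_expr set) local_lie,
       ('k, int \<Rightarrow> 'a) lie_expr set \<Rightarrow> ('k, int \<Rightarrow> 'a) lie_expr set) category)
    loc_lie loc_lie_map"
proof (intro fully_faithful_functor.intro cat_functor.intro vertex_lie_category local_lie_category
    cat_functor_axioms.intro fully_faithful_functor_axioms.intro)
  let ?V = "vertex_lie_category :: (('k, 'a) conformal, 'a \<Rightarrow> 'a) category"
  let ?L = "local_lie_category :: (('k, ('k, int \<Rightarrow> 'a) lie_expr set) local_lie,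
       ('k, int \<Rightarrow> 'a) lie_expr set \<Rightarrow> ('k, int \<Rightarrow> 'a) lie_expr set) category"
  note cats = vertex_lie_category_def local_lie_category_def
  fix A B E :: "('k, 'a) conformal" and f g
  assume A: "A \<in> Obj ?V"
  then have A': "vertex_lie_algebra A" by (simp add: cats)
  interpret A: vertex_lie_algebra A by (rule A')
  show "loc_lie A \<in> Obj ?L" by (simp add: cats A.loc_lie_local)
  show "loc_lie_map A A (Id ?V A) = Id ?L (loc_lie A)"
  proof -
    interpret i: vertex_lie_hom A A "\<lambda>a\<in>carrier A. a"
      by (rule vertex_lie_homI[OF A' A' conformal_hom_id[OF A']])
    have "loc_lie_map A A (\<lambda>a\<in>carrier A. a) X = X" if "X \<in> carrier (loc_lie A)" for X
      using that
    proof (rule A.loc_lie_cases)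
      fix x assume x: "x \<in> lie_exprs (laurent A)" "X = loc_class A x"
      then show ?thesis
        using map_coeffs_cong[OF x(1), of "\<lambda>a\<in>carrier A. a" "\<lambda>a. a"]
        by (simp add: i.loc_lie_map_class map_coeffs_id)
    qed
    then show ?thesis by (auto simp: cats loc_lie_map_def intro!: ext)
  qed
  assume "B \<in> Obj ?V"
  then have B: "vertex_lie_algebra B" by (simp add: cats)
  show "bij_betw (loc_lie_map A B) (Hom ?V A B) (Hom ?L (loc_lie A) (loc_lie B))"
    unfolding bij_betw_def
  proof
    show "inj_on (loc_lie_map A B) (Hom ?V A B)"
      by (rule inj_onI) (auto simp: cats intro: loc_lie_map_inj[OF A' B])
    show "loc_lie_map A B ` Hom ?V A B = Hom ?L (loc_lie A) (loc_lie B)"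
    proof (intro equalityI subsetI)
      fix \<phi> assume "\<phi> \<in> Hom ?L (loc_lie A) (loc_lie B)"
      then obtain f where "f \<in> conformal_hom A B" "loc_lie_map A B f = \<phi>"
        using loc_lie_map_surj[OF A' B] by (auto simp: cats)
      then show "\<phi> \<in> loc_lie_map A B ` Hom ?V A B" by (auto simp: cats)
    qed (auto simp: cats intro: vertex_lie_hom.loc_lie_map_hom[OF vertex_lie_homI[OF A' B]])
  qed
  assume "f \<in> Hom ?V A B"
  then have f: "f \<in> conformal_hom A B" by (simp add: cats)
  interpret f: vertex_lie_hom A B f by (rule vertex_lie_homI[OF A' B f])
  show "loc_lie_map A B f \<in> Hom ?L (loc_lie A) (loc_lie B)"
    using f.loc_lie_map_hom by (simp add: cats)
  assume "E \<in> Obj ?V" "g \<in> Hom ?V B E"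
  then have E: "vertex_lie_algebra E" and g: "g \<in> conformal_hom B E" by (simp_all add: cats)
  interpret g: vertex_lie_hom B E g by (rule vertex_lie_homI[OF B E g])
  interpret gf: vertex_lie_hom A E "compose (carrier A) g f"
    by (rule vertex_lie_homI[OF A' E conformal_hom_compose[OF A' f g]])
  have "loc_lie_map A E (compose (carrier A) g f) X = loc_lie_map B E g (loc_lie_map A B f X)"
    if "X \<in> carrier (loc_lie A)" for X
    using that
  proof (rule A.loc_lie_cases)
    fix x assume x: "x \<in> lie_exprs (laurent A)" "X = loc_class A x"
    have "map_coeffs (compose (carrier A) g f) x = map_coeffs (g \<circ> f) x"
      by (rule map_coeffs_cong[OF x(1)]) (simp add: compose_def)
    then show ?thesis
      using x by (simp add: gf.loc_lie_map_class f.loc_lie_map_class g.loc_lie_map_class map_coeffs_comp)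
  qed
  then have "loc_lie_map A E (compose (carrier A) g f)
    = compose (carrier (loc_lie A)) (loc_lie_map B E g) (loc_lie_map A B f)"
    by (intro extensionalityI[of _ "carrier (loc_lie A)"])
      (simp_all add: compose_eq, simp add: loc_lie_map_def)
  then show "loc_lie_map A E (Comp ?V A B E g f)
    = Comp ?L (loc_lie A) (loc_lie B) (loc_lie E) (loc_lie_map B E g) (loc_lie_map A B f)"
    by (simp add: cats)
qed

end
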